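(* Over $\mathsf{RCA}_0$, the following statement implies $\mathsf{ACA}_0$: for every coloring $c:\mathbf{N}\to\{0,1\}$ there exist an infinite apart set $H$ of positive integers and positive integers $a,b$ such that $FS^{\{a,\,a+b,\,a+2b\}\cup\{b\}}(H)$ is monochromatic under $c$.
   Context: $\mathsf{RCA}_0$ is the base system of Reverse Mathematics (recursive comprehension with $\Sigma^0_1$-induction) and $\mathsf{ACA}_0$ is the subsystem of second-order arithmetic with arithmetical comprehension; over $\mathsf{RCA}_0$, $\mathsf{ACA}_0$ is equivalent to "for every $X$ the Turing jump $X'$ exists". For a positive integer $n=2^{t_1}+\dots+2^{t_k}$ with $t_1<\dots<t_k$ let $\lambda(n)=t_1$ and $\mu(n)=t_k$. A set $X$ of positive integers is apart (satisfies the Apartness Condition) if for all $x,x'\in X$ with $x<x'$ we have $\mu(x)<\lambda(x')$. For a set $A$ of positive integers and a set $B\subseteq\mathbf{N}$, $FS^{A}(B)$ denotes the set of all sums of exactly $j$ distinct elements of $B$, for all $j\in A$. A set is monochromatic under $c$ if $c$ is constant on it. The statement is understood in its natural formalization in the language of second-order arithmetic. *)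

theory Defs
  imports Main
begin

section \<open>The language of second-order arithmetic\<close>

text \<open>
  Number variables and set variables are both named by natural numbers; they live in separate name
  spaces.
\<close>

datatype tm =
    Var nat
  | Zero ("\<^bold>0")
  | One ("\<^bold>1")
  | Add tm tm (infixl "\<^bold>+" 65)
  | Mul tm tm (infixl "\<^bold>*" 70)

datatype fm =
    Eq tm tm (infix "\<^bold>=" 50)
  | Less tm tm (infix "\<^bold><" 50)
  | Mem tm nat (infix "\<^bold>\<in>" 50)
  | Neg fm ("\<^bold>\<not> _" [40] 40)
  | Conj fm fm (infixr "\<^bold>\<and>" 35)
  | Disj fm fm (infixr "\<^bold>\<or>" 30)
  | Imp fm fm (infixr "\<^bold>\<longrightarrow>" 25)
  | Iff fm fm (infixr "\<^bold>\<longleftrightarrow>" 25)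
  | AllN nat fm
  | ExN nat fm
  | AllS nat fm
  | ExS nat fm

primrec tvars :: "tm \<Rightarrow> nat set" where
  "tvars (Var x) = {x}"
| "tvars \<^bold>0 = {}"
| "tvars \<^bold>1 = {}"
| "tvars (t \<^bold>+ u) = tvars t \<union> tvars u"
| "tvars (t \<^bold>* u) = tvars t \<union> tvars u"

primrec free_sets :: "fm \<Rightarrow> nat set" where
  "free_sets (t \<^bold>= u) = {}"
| "free_sets (t \<^bold>< u) = {}"
| "free_sets (t \<^bold>\<in> X) = {X}"
| "free_sets (\<^bold>\<not> \<phi>) = free_sets \<phi>"
| "free_sets (\<phi> \<^bold>\<and> \<psi>) = free_sets \<phi> \<union> free_sets \<psi>"
| "free_sets (\<phi> \<^bold>\<or> \<psi>) = free_sets \<phi> \<union> free_sets \<psi>"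
| "free_sets (\<phi> \<^bold>\<longrightarrow> \<psi>) = free_sets \<phi> \<union> free_sets \<psi>"
| "free_sets (\<phi> \<^bold>\<longleftrightarrow> \<psi>) = free_sets \<phi> \<union> free_sets \<psi>"
| "free_sets (AllN x \<phi>) = free_sets \<phi>"
| "free_sets (ExN x \<phi>) = free_sets \<phi>"
| "free_sets (AllS X \<phi>) = free_sets \<phi> - {X}"
| "free_sets (ExS X \<phi>) = free_sets \<phi> - {X}"

primrec tsubst :: "nat \<Rightarrow> tm \<Rightarrow> tm \<Rightarrow> tm" where
  "tsubst x r (Var y) = (if y = x then r else Var y)"
| "tsubst x r \<^bold>0 = \<^bold>0"
| "tsubst x r \<^bold>1 = \<^bold>1"
| "tsubst x r (t \<^bold>+ u) = tsubst x r t \<^bold>+ tsubst x r u"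
| "tsubst x r (t \<^bold>* u) = tsubst x r t \<^bold>* tsubst x r u"

text \<open>
  This substitution does not rename bound variables. It is only used with terms whose sole variable
  is the replaced variable itself, for which no capture can occur (see \<open>sat_subst\<close> below).
\<close>

primrec subst :: "nat \<Rightarrow> tm \<Rightarrow> fm \<Rightarrow> fm" where
  "subst x r (t \<^bold>= u) = (tsubst x r t \<^bold>= tsubst x r u)"
| "subst x r (t \<^bold>< u) = (tsubst x r t \<^bold>< tsubst x r u)"
| "subst x r (t \<^bold>\<in> X) = (tsubst x r t \<^bold>\<in> X)"
| "subst x r (\<^bold>\<not> \<phi>) = (\<^bold>\<not> subst x r \<phi>)"
| "subst x r (\<phi> \<^bold>\<and> \<psi>) = (subst x r \<phi> \<^bold>\<and> subst x r \<psi>)"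
| "subst x r (\<phi> \<^bold>\<or> \<psi>) = (subst x r \<phi> \<^bold>\<or> subst x r \<psi>)"
| "subst x r (\<phi> \<^bold>\<longrightarrow> \<psi>) = (subst x r \<phi> \<^bold>\<longrightarrow> subst x r \<psi>)"
| "subst x r (\<phi> \<^bold>\<longleftrightarrow> \<psi>) = (subst x r \<phi> \<^bold>\<longleftrightarrow> subst x r \<psi>)"
| "subst x r (AllN y \<phi>) = AllN y (if y = x then \<phi> else subst x r \<phi>)"
| "subst x r (ExN y \<phi>) = ExN y (if y = x then \<phi> else subst x r \<phi>)"
| "subst x r (AllS X \<phi>) = AllS X (subst x r \<phi>)"
| "subst x r (ExS X \<phi>) = ExS X (subst x r \<phi>)"


section \<open>Structures and satisfaction\<close>

text \<open>
  General (Henkin) structures: the number domain is the whole type \<open>'a\<close>, the set quantifiers range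
  over the family \<open>Sets\<close>. The arithmetic is that of the structure and may be nonstandard. Derivability over RCA0 is rendered, via completeness, as truth in
  all models of RCA0, with arbitrary \<open>'a\<close>.
\<close>

record 'a l2_struct =
  zer :: 'a
  unit :: 'a
  add :: "'a \<Rightarrow> 'a \<Rightarrow> 'a"
  mul :: "'a \<Rightarrow> 'a \<Rightarrow> 'a"
  lt :: "'a \<Rightarrow> 'a \<Rightarrow> bool"
  Sets :: "'a set set"

primrec eval :: "'a l2_struct \<Rightarrow> (nat \<Rightarrow> 'a) \<Rightarrow> tm \<Rightarrow> 'a" where
  "eval M e (Var x) = e x"
| "eval M e \<^bold>0 = zer M"
| "eval M e \<^bold>1 = unit M"
| "eval M e (t \<^bold>+ u) = add M (eval M e t) (eval M e u)"
| "eval M e (t \<^bold>* u) = mul M (eval M e t) (eval M e u)"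

primrec sat :: "'a l2_struct \<Rightarrow> (nat \<Rightarrow> 'a) \<Rightarrow> (nat \<Rightarrow> 'a set) \<Rightarrow> fm \<Rightarrow> bool" where
  "sat M e s (t \<^bold>= u) \<longleftrightarrow> eval M e t = eval M e u"
| "sat M e s (t \<^bold>< u) \<longleftrightarrow> lt M (eval M e t) (eval M e u)"
| "sat M e s (t \<^bold>\<in> X) \<longleftrightarrow> eval M e t \<in> s X"
| "sat M e s (\<^bold>\<not> \<phi>) \<longleftrightarrow> \<not> sat M e s \<phi>"
| "sat M e s (\<phi> \<^bold>\<and> \<psi>) \<longleftrightarrow> sat M e s \<phi> \<and> sat M e s \<psi>"
| "sat M e s (\<phi> \<^bold>\<or> \<psi>) \<longleftrightarrow> sat M e s \<phi> \<or> sat M e s \<psi>"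
| "sat M e s (\<phi> \<^bold>\<longrightarrow> \<psi>) \<longleftrightarrow> (sat M e s \<phi> \<longrightarrow> sat M e s \<psi>)"
| "sat M e s (\<phi> \<^bold>\<longleftrightarrow> \<psi>) \<longleftrightarrow> (sat M e s \<phi> \<longleftrightarrow> sat M e s \<psi>)"
| "sat M e s (AllN x \<phi>) \<longleftrightarrow> (\<forall>a. sat M (e(x := a)) s \<phi>)"
| "sat M e s (ExN x \<phi>) \<longleftrightarrow> (\<exists>a. sat M (e(x := a)) s \<phi>)"
| "sat M e s (AllS X \<phi>) \<longleftrightarrow> (\<forall>A\<in>Sets M. sat M e (s(X := A)) \<phi>)"
| "sat M e s (ExS X \<phi>) \<longleftrightarrow> (\<exists>A\<in>Sets M. sat M e (s(X := A)) \<phi>)"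

text \<open>Free variables of axioms are read as universally quantified.\<close>

definition models :: "'a l2_struct \<Rightarrow> fm set \<Rightarrow> bool" (infix "\<Turnstile>" 50) where
  "M \<Turnstile> T \<longleftrightarrow> (\<forall>\<phi>\<in>T. \<forall>e s. range s \<subseteq> Sets M \<longrightarrow> sat M e s \<phi>)"

lemma eval_cong: "(\<And>x. x \<in> tvars t \<Longrightarrow> e x = e' x) \<Longrightarrow> eval M e t = eval M e' t"
  by (induction t) auto

lemma eval_upd [simp]: "x \<notin> tvars t \<Longrightarrow> eval M (e(x := a)) t = eval M e t"
  by (rule eval_cong) auto

lemma eval_subst: "eval M e (tsubst x r t) = eval M (e(x := eval M e r)) t"
  by (induction t) auto

lemma sat_subst:
  "tvars r \<subseteq> {x} \<Longrightarrow> sat M e s (subst x r \<phi>) \<longleftrightarrow> sat M (e(x := eval M e r)) s \<phi>"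
proof (induction \<phi> arbitrary: e s)
  case (AllN y \<phi>)
  show ?case
  proof (cases "y = x")
    case False
    then have "eval M (e(y := a)) r = eval M e r" for a
      using AllN.prems by (intro eval_upd) auto
    then show ?thesis
      using False AllN.IH[OF AllN.prems] by (simp add: fun_upd_twist[OF False] del: fun_upd_apply)
  qed (simp del: fun_upd_apply)
next
  case (ExN y \<phi>)
  show ?case
  proof (cases "y = x")
    case False
    then have "eval M (e(y := a)) r = eval M e r" for a
      using ExN.prems by (intro eval_upd) auto
    then show ?thesis
      using False ExN.IH[OF ExN.prems] by (simp add: fun_upd_twist[OF False] del: fun_upd_apply)
  qed (simp del: fun_upd_apply)
qed (auto simp: eval_subst)


section \<open>The systems RCA0 and ACA0\<close>

inductive sigma00 :: "fm \<Rightarrow> bool" where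
  "sigma00 (t \<^bold>= u)"
| "sigma00 (t \<^bold>< u)"
| "sigma00 (t \<^bold>\<in> X)"
| "sigma00 \<phi> \<Longrightarrow> sigma00 (\<^bold>\<not> \<phi>)"
| "sigma00 \<phi> \<Longrightarrow> sigma00 \<psi> \<Longrightarrow> sigma00 (\<phi> \<^bold>\<and> \<psi>)"
| "sigma00 \<phi> \<Longrightarrow> sigma00 \<psi> \<Longrightarrow> sigma00 (\<phi> \<^bold>\<or> \<psi>)"
| "sigma00 \<phi> \<Longrightarrow> sigma00 \<psi> \<Longrightarrow> sigma00 (\<phi> \<^bold>\<longrightarrow> \<psi>)"
| "sigma00 \<phi> \<Longrightarrow> sigma00 \<psi> \<Longrightarrow> sigma00 (\<phi> \<^bold>\<longleftrightarrow> \<psi>)"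
| "sigma00 \<phi> \<Longrightarrow> x \<notin> tvars t \<Longrightarrow> sigma00 (AllN x (Var x \<^bold>< t \<^bold>\<longrightarrow> \<phi>))"
| "sigma00 \<phi> \<Longrightarrow> x \<notin> tvars t \<Longrightarrow> sigma00 (ExN x (Var x \<^bold>< t \<^bold>\<and> \<phi>))"

definition sigma01 :: "fm \<Rightarrow> bool" where
  "sigma01 \<phi> \<longleftrightarrow> (\<exists>x \<theta>. sigma00 \<theta> \<and> \<phi> = ExN x \<theta>)"

definition pi01 :: "fm \<Rightarrow> bool" where
  "pi01 \<phi> \<longleftrightarrow> (\<exists>x \<theta>. sigma00 \<theta> \<and> \<phi> = AllN x \<theta>)"

text \<open>Arithmetical formulas have no set quantifiers, but may have free set variables.\<close>

primrec arithmetical :: "fm \<Rightarrow> bool" where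
  "arithmetical (t \<^bold>= u) = True"
| "arithmetical (t \<^bold>< u) = True"
| "arithmetical (t \<^bold>\<in> X) = True"
| "arithmetical (\<^bold>\<not> \<phi>) = arithmetical \<phi>"
| "arithmetical (\<phi> \<^bold>\<and> \<psi>) = (arithmetical \<phi> \<and> arithmetical \<psi>)"
| "arithmetical (\<phi> \<^bold>\<or> \<psi>) = (arithmetical \<phi> \<and> arithmetical \<psi>)"
| "arithmetical (\<phi> \<^bold>\<longrightarrow> \<psi>) = (arithmetical \<phi> \<and> arithmetical \<psi>)"
| "arithmetical (\<phi> \<^bold>\<longleftrightarrow> \<psi>) = (arithmetical \<phi> \<and> arithmetical \<psi>)"
| "arithmetical (AllN x \<phi>) = arithmetical \<phi>"
| "arithmetical (ExN x \<phi>) = arithmetical \<phi>"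
| "arithmetical (AllS X \<phi>) = False"
| "arithmetical (ExS X \<phi>) = False"

definition basic_axioms :: "fm set" where
  "basic_axioms = (let m = Var 0; n = Var 1 in
    {\<^bold>\<not> (n \<^bold>+ \<^bold>1 \<^bold>= \<^bold>0),
     m \<^bold>+ \<^bold>1 \<^bold>= n \<^bold>+ \<^bold>1 \<^bold>\<longrightarrow> m \<^bold>= n,
     m \<^bold>+ \<^bold>0 \<^bold>= m,
     m \<^bold>+ (n \<^bold>+ \<^bold>1) \<^bold>= (m \<^bold>+ n) \<^bold>+ \<^bold>1,
     m \<^bold>* \<^bold>0 \<^bold>= \<^bold>0,
     m \<^bold>* (n \<^bold>+ \<^bold>1) \<^bold>= (m \<^bold>* n) \<^bold>+ m,
     \<^bold>\<not> (m \<^bold>< \<^bold>0),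
     m \<^bold>< n \<^bold>+ \<^bold>1 \<^bold>\<longleftrightarrow> (m \<^bold>< n \<^bold>\<or> m \<^bold>= n)})"

definition induction_for :: "nat \<Rightarrow> fm \<Rightarrow> fm" where
  "induction_for n \<phi> =
    (subst n \<^bold>0 \<phi> \<^bold>\<and> AllN n (\<phi> \<^bold>\<longrightarrow> subst n (Var n \<^bold>+ \<^bold>1) \<phi>) \<^bold>\<longrightarrow> AllN n \<phi>)"

definition comprehension_for :: "nat \<Rightarrow> nat \<Rightarrow> fm \<Rightarrow> fm" where
  "comprehension_for X n \<phi> = ExS X (AllN n (Var n \<^bold>\<in> X \<^bold>\<longleftrightarrow> \<phi>))"

definition RCA0 :: "fm set" where
  "RCA0 = basic_axioms
    \<union> {induction_for n \<phi> | n \<phi>. sigma01 \<phi>}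
    \<union> {AllN n (\<phi> \<^bold>\<longleftrightarrow> \<psi>) \<^bold>\<longrightarrow> comprehension_for X n \<phi> | X n \<phi> \<psi>.
        sigma01 \<phi> \<and> pi01 \<psi> \<and> X \<notin> free_sets \<phi>}"

definition ACA0 :: "fm set" where
  "ACA0 = basic_axioms
    \<union> {induction_for 0 (Var 0 \<^bold>\<in> 0)}
    \<union> {comprehension_for X n \<phi> | X n \<phi>. arithmetical \<phi> \<and> X \<notin> free_sets \<phi>}"


section \<open>Finite sequences, sums and binary expansions in second-order arithmetic\<close>

text \<open>
  In the definitions below the first argument \<open>k\<close> is such that all bound number variables are named
  \<open>k\<close>, \<open>k + 1\<close>, \dots; the variables of the argument terms have to be smaller than \<open>k\<close>.
  The following binders hand the bound variable over as a term.
\<close>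

definition all :: "nat \<Rightarrow> (tm \<Rightarrow> fm) \<Rightarrow> fm" where
  "all k F = AllN k (F (Var k))"

definition ex :: "nat \<Rightarrow> (tm \<Rightarrow> fm) \<Rightarrow> fm" where
  "ex k F = ExN k (F (Var k))"

definition all_less :: "nat \<Rightarrow> tm \<Rightarrow> (tm \<Rightarrow> fm) \<Rightarrow> fm" where
  "all_less k t F = all k (\<lambda>x. x \<^bold>< t \<^bold>\<longrightarrow> F x)"

text \<open>
  Finite sequences are coded by pairs \<open>(c, d)\<close> by means of Goedel's beta function: the entry with
  index \<open>i\<close> is the remainder of \<open>c\<close> modulo \<open>1 + (i + 1) d\<close>.
\<close>

definition entry :: "nat \<Rightarrow> tm \<Rightarrow> tm \<Rightarrow> tm \<Rightarrow> tm \<Rightarrow> fm" where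
  "entry k c d i y =
    (y \<^bold>< \<^bold>1 \<^bold>+ (i \<^bold>+ \<^bold>1) \<^bold>* d \<^bold>\<and> ex k (\<lambda>q. c \<^bold>= q \<^bold>* (\<^bold>1 \<^bold>+ (i \<^bold>+ \<^bold>1) \<^bold>* d) \<^bold>+ y))"

text \<open>\<open>is_sum k F j n\<close>: \<open>n\<close> is the sum over \<open>i < j\<close> of the \<open>x\<close> with \<open>F i x\<close>;
  \<open>(c, d)\<close> codes the sequence of partial sums.\<close>

definition is_sum :: "nat \<Rightarrow> (nat \<Rightarrow> tm \<Rightarrow> tm \<Rightarrow> fm) \<Rightarrow> tm \<Rightarrow> tm \<Rightarrow> fm" where
  "is_sum k F j n = ex k (\<lambda>c. ex (k+1) (\<lambda>d.
     entry (k+2) c d \<^bold>0 \<^bold>0 \<^bold>\<and>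
     all_less (k+2) j (\<lambda>i. ex (k+3) (\<lambda>p. ex (k+4) (\<lambda>x.
       entry (k+5) c d i p \<^bold>\<and> F (k+5) i x \<^bold>\<and> entry (k+5) c d (i \<^bold>+ \<^bold>1) (p \<^bold>+ x)))) \<^bold>\<and>
     entry (k+2) c d j n))"

definition is_pow2 :: "nat \<Rightarrow> tm \<Rightarrow> tm \<Rightarrow> fm" where
  "is_pow2 k t y = ex k (\<lambda>c. ex (k+1) (\<lambda>d.
     entry (k+2) c d \<^bold>0 \<^bold>1 \<^bold>\<and>
     all_less (k+2) t (\<lambda>i. ex (k+3) (\<lambda>z.
       entry (k+4) c d i z \<^bold>\<and> entry (k+4) c d (i \<^bold>+ \<^bold>1) ((\<^bold>1 \<^bold>+ \<^bold>1) \<^bold>* z))) \<^bold>\<and>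
     entry (k+2) c d t y))"

text \<open>\<open>(c, d)\<close> codes a sequence of exponents, increasing on the indices \<open>0, \<dots>, l\<close>, whose powers of
  two sum up to \<open>n\<close>.\<close>

definition expansion :: "nat \<Rightarrow> tm \<Rightarrow> tm \<Rightarrow> tm \<Rightarrow> tm \<Rightarrow> fm" where
  "expansion k c d l n =
     (all_less k l (\<lambda>i. ex (k+1) (\<lambda>t. ex (k+2) (\<lambda>u.
        entry (k+3) c d i t \<^bold>\<and> entry (k+3) c d (i \<^bold>+ \<^bold>1) u \<^bold>\<and> t \<^bold>< u))) \<^bold>\<and>
      is_sum k (\<lambda>h i x. ex h (\<lambda>t. entry (h+1) c d i t \<^bold>\<and> is_pow2 (h+1) t x)) (l \<^bold>+ \<^bold>1) n)"

definition is_lambda :: "nat \<Rightarrow> tm \<Rightarrow> tm \<Rightarrow> fm" where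
  "is_lambda k n t = ex k (\<lambda>c. ex (k+1) (\<lambda>d. ex (k+2) (\<lambda>l.
     expansion (k+3) c d l n \<^bold>\<and> entry (k+3) c d \<^bold>0 t)))"

definition is_mu :: "nat \<Rightarrow> tm \<Rightarrow> tm \<Rightarrow> fm" where
  "is_mu k n t = ex k (\<lambda>c. ex (k+1) (\<lambda>d. ex (k+2) (\<lambda>l.
     expansion (k+3) c d l n \<^bold>\<and> entry (k+3) c d l t)))"

definition apart :: "nat \<Rightarrow> nat \<Rightarrow> fm" where
  "apart k X = all k (\<lambda>x. all (k+1) (\<lambda>x'. x \<^bold>\<in> X \<^bold>\<and> x' \<^bold>\<in> X \<^bold>\<and> x \<^bold>< x' \<^bold>\<longrightarrow>
     ex (k+2) (\<lambda>t. ex (k+3) (\<lambda>u. is_mu (k+4) x t \<^bold>\<and> is_lambda (k+4) x' u \<^bold>\<and> t \<^bold>< u))))"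

definition infinite_set :: "nat \<Rightarrow> nat \<Rightarrow> fm" where
  "infinite_set k X = all k (\<lambda>m. ex (k+1) (\<lambda>x. m \<^bold>< x \<^bold>\<and> x \<^bold>\<in> X))"

definition positive_set :: "nat \<Rightarrow> nat \<Rightarrow> fm" where
  "positive_set k X = all k (\<lambda>x. x \<^bold>\<in> X \<^bold>\<longrightarrow> \<^bold>0 \<^bold>< x)"

text \<open>\<open>n\<close> is the sum of exactly \<open>j\<close> distinct elements of \<open>X\<close>, listed by the sequence \<open>(c, d)\<close>.\<close>

definition sum_of_distinct :: "nat \<Rightarrow> nat \<Rightarrow> tm \<Rightarrow> tm \<Rightarrow> fm" where
  "sum_of_distinct k X j n = ex k (\<lambda>c. ex (k+1) (\<lambda>d.
     all_less (k+2) j (\<lambda>i. ex (k+3) (\<lambda>x. entry (k+4) c d i x \<^bold>\<and> x \<^bold>\<in> X)) \<^bold>\<and>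
     all_less (k+2) j (\<lambda>i. all_less (k+3) i (\<lambda>i'. ex (k+4) (\<lambda>x. ex (k+5) (\<lambda>x'.
       entry (k+6) c d i x \<^bold>\<and> entry (k+6) c d i' x' \<^bold>\<and> \<^bold>\<not> (x \<^bold>= x'))))) \<^bold>\<and>
     is_sum (k+2) (\<lambda>h i x. entry h c d i x) j n))"

text \<open>\<open>n \<in> FS\<^sup>A(X)\<close>, where \<open>A\<close> is given by a formula.\<close>

definition in_FS :: "nat \<Rightarrow> (tm \<Rightarrow> fm) \<Rightarrow> nat \<Rightarrow> tm \<Rightarrow> fm" where
  "in_FS k A X n = ex k (\<lambda>j. A j \<^bold>\<and> sum_of_distinct (k+1) X j n)"

text \<open>Functions are sets of pairs, with \<open>(i, j)\<close> coded by \<open>(i + j)\<^sup>2 + i\<close>.\<close>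

definition pair :: "tm \<Rightarrow> tm \<Rightarrow> tm" where
  "pair i j = (i \<^bold>+ j) \<^bold>* (i \<^bold>+ j) \<^bold>+ i"

definition two_coloring :: "nat \<Rightarrow> nat \<Rightarrow> fm" where
  "two_coloring k C =
     (all k (\<lambda>z. z \<^bold>\<in> C \<^bold>\<longrightarrow>
        ex (k+1) (\<lambda>n. ex (k+2) (\<lambda>i. (i \<^bold>= \<^bold>0 \<^bold>\<or> i \<^bold>= \<^bold>1) \<^bold>\<and> z \<^bold>= pair n i))) \<^bold>\<and>
      all k (\<lambda>n. ex (k+1) (\<lambda>i. pair n i \<^bold>\<in> C)) \<^bold>\<and>
      all k (\<lambda>n. all (k+1) (\<lambda>i. all (k+2) (\<lambda>j.
        pair n i \<^bold>\<in> C \<^bold>\<and> pair n j \<^bold>\<in> C \<^bold>\<longrightarrow> i \<^bold>= j))))"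

definition monochromatic_FS :: "nat \<Rightarrow> nat \<Rightarrow> (tm \<Rightarrow> fm) \<Rightarrow> nat \<Rightarrow> fm" where
  "monochromatic_FS k C A X =
     ex k (\<lambda>i. all (k+1) (\<lambda>n. in_FS (k+2) A X n \<^bold>\<longrightarrow> pair n i \<^bold>\<in> C))"

text \<open>The set variables 0 and 1 stand for the coloring and for the homogeneous set.\<close>

definition apart_hindman_AP :: fm where
  "apart_hindman_AP = AllS 0 (two_coloring 0 0 \<^bold>\<longrightarrow>
     ExS 1 (infinite_set 0 1 \<^bold>\<and> positive_set 0 1 \<^bold>\<and> apart 0 1 \<^bold>\<and>
       ex 0 (\<lambda>a. ex 1 (\<lambda>b. \<^bold>0 \<^bold>< a \<^bold>\<and> \<^bold>0 \<^bold>< b \<^bold>\<and>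
         monochromatic_FS 2 0
           (\<lambda>j. j \<^bold>= a \<^bold>\<or> j \<^bold>= a \<^bold>+ b \<^bold>\<or> j \<^bold>= a \<^bold>+ (\<^bold>1 \<^bold>+ \<^bold>1) \<^bold>* b \<^bold>\<or> j \<^bold>= b) 1))))"


section \<open>The meaning of the sentence in a structure\<close>

text \<open>
  The same notions stated directly about the elements of a structure; the lemmas confirm that no
  variable is captured in the sentence above.
\<close>

primrec tbound :: "tm \<Rightarrow> nat" where
  "tbound (Var x) = Suc x"
| "tbound \<^bold>0 = 0"
| "tbound \<^bold>1 = 0"
| "tbound (t \<^bold>+ u) = max (tbound t) (tbound u)"
| "tbound (t \<^bold>* u) = max (tbound t) (tbound u)"

lemma tvars_tbound: "x \<in> tvars t \<Longrightarrow> x < tbound t"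
  by (induction t) auto

context
  fixes M :: "'a l2_struct"
begin

definition Entry :: "'a \<Rightarrow> 'a \<Rightarrow> 'a \<Rightarrow> 'a \<Rightarrow> bool" where
  "Entry c d i y \<longleftrightarrow>
    (let m = add M (unit M) (mul M (add M i (unit M)) d) in
      lt M y m \<and> (\<exists>q. c = add M (mul M q m) y))"

definition Is_sum :: "('a \<Rightarrow> 'a \<Rightarrow> bool) \<Rightarrow> 'a \<Rightarrow> 'a \<Rightarrow> bool" where
  "Is_sum F j n \<longleftrightarrow> (\<exists>c d. Entry c d (zer M) (zer M) \<and>
     (\<forall>i. lt M i j \<longrightarrow>
       (\<exists>p x. Entry c d i p \<and> F i x \<and> Entry c d (add M i (unit M)) (add M p x))) \<and>
     Entry c d j n)"

definition Is_pow2 :: "'a \<Rightarrow> 'a \<Rightarrow> bool" where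
  "Is_pow2 t y \<longleftrightarrow> (\<exists>c d. Entry c d (zer M) (unit M) \<and>
     (\<forall>i. lt M i t \<longrightarrow> (\<exists>z. Entry c d i z \<and>
       Entry c d (add M i (unit M)) (mul M (add M (unit M) (unit M)) z))) \<and>
     Entry c d t y)"

definition Expansion :: "'a \<Rightarrow> 'a \<Rightarrow> 'a \<Rightarrow> 'a \<Rightarrow> bool" where
  "Expansion c d l n \<longleftrightarrow>
     (\<forall>i. lt M i l \<longrightarrow> (\<exists>t u. Entry c d i t \<and> Entry c d (add M i (unit M)) u \<and> lt M t u)) \<and>
     Is_sum (\<lambda>i x. \<exists>t. Entry c d i t \<and> Is_pow2 t x) (add M l (unit M)) n"

definition Is_lambda :: "'a \<Rightarrow> 'a \<Rightarrow> bool" where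
  "Is_lambda n t \<longleftrightarrow> (\<exists>c d l. Expansion c d l n \<and> Entry c d (zer M) t)"

definition Is_mu :: "'a \<Rightarrow> 'a \<Rightarrow> bool" where
  "Is_mu n t \<longleftrightarrow> (\<exists>c d l. Expansion c d l n \<and> Entry c d l t)"

definition Apart :: "'a set \<Rightarrow> bool" where
  "Apart X \<longleftrightarrow> (\<forall>x x'. x \<in> X \<and> x' \<in> X \<and> lt M x x' \<longrightarrow>
     (\<exists>t u. Is_mu x t \<and> Is_lambda x' u \<and> lt M t u))"

definition Sum_of_distinct :: "'a set \<Rightarrow> 'a \<Rightarrow> 'a \<Rightarrow> bool" where
  "Sum_of_distinct X j n \<longleftrightarrow> (\<exists>c d.
     (\<forall>i. lt M i j \<longrightarrow> (\<exists>x. Entry c d i x \<and> x \<in> X)) \<and>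
     (\<forall>i. lt M i j \<longrightarrow> (\<forall>i'. lt M i' i \<longrightarrow>
       (\<exists>x x'. Entry c d i x \<and> Entry c d i' x' \<and> x \<noteq> x'))) \<and>
     Is_sum (Entry c d) j n)"

definition FS_set :: "'a set \<Rightarrow> 'a set \<Rightarrow> 'a set" where
  "FS_set A X = {n. \<exists>j\<in>A. Sum_of_distinct X j n}"

definition Pair_code :: "'a \<Rightarrow> 'a \<Rightarrow> 'a" where
  "Pair_code i j = add M (mul M (add M i j) (add M i j)) i"

definition Two_coloring :: "'a set \<Rightarrow> bool" where
  "Two_coloring C \<longleftrightarrow>
     (\<forall>z\<in>C. \<exists>n. \<exists>i\<in>{zer M, unit M}. z = Pair_code n i) \<and> (\<forall>n. \<exists>!i. Pair_code n i \<in> C)"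

lemma sat_all [simp]: "sat M e s (all k F) \<longleftrightarrow> (\<forall>a. sat M (e(k := a)) s (F (Var k)))"
  by (simp add: all_def)

lemma sat_ex [simp]: "sat M e s (ex k F) \<longleftrightarrow> (\<exists>a. sat M (e(k := a)) s (F (Var k)))"
  by (simp add: ex_def)

lemma eval_upd_fresh [simp]: "tbound t \<le> k \<Longrightarrow> eval M (e(k := a)) t = eval M e t"
  using tvars_tbound by (intro eval_upd) fastforce

lemma sat_all_less [simp]:
  "tbound t \<le> k \<Longrightarrow>
    sat M e s (all_less k t F) \<longleftrightarrow> (\<forall>a. lt M a (eval M e t) \<longrightarrow> sat M (e(k := a)) s (F (Var k)))"
  by (simp add: all_less_def)

lemma sat_entry [simp]:
  assumes "tbound c \<le> k" "tbound d \<le> k" "tbound i \<le> k" "tbound y \<le> k"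
  shows "sat M e s (entry k c d i y) \<longleftrightarrow> Entry (eval M e c) (eval M e d) (eval M e i) (eval M e y)"
  using assms by (simp add: entry_def Entry_def Let_def)

lemma sat_is_sum:
  assumes "tbound j \<le> k" "tbound n \<le> k"
    and F: "\<And>e' h i x. k \<le> h \<Longrightarrow> (\<And>v. v < k \<Longrightarrow> e' v = e v) \<Longrightarrow> tbound i \<le> h \<Longrightarrow> tbound x \<le> h \<Longrightarrow>
      sat M e' s (F h i x) \<longleftrightarrow> G (eval M e' i) (eval M e' x)"
  shows "sat M e s (is_sum k F j n) \<longleftrightarrow> Is_sum G (eval M e j) (eval M e n)"
  using assms(1,2) by (simp add: is_sum_def Is_sum_def F)

lemma sat_is_pow2 [simp]:
  assumes "tbound t \<le> k" "tbound y \<le> k"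
  shows "sat M e s (is_pow2 k t y) \<longleftrightarrow> Is_pow2 (eval M e t) (eval M e y)"
  using assms by (simp add: is_pow2_def Is_pow2_def)

lemma sat_expansion [simp]:
  assumes "tbound c \<le> k" "tbound d \<le> k" "tbound l \<le> k" "tbound n \<le> k"
  shows "sat M e s (expansion k c d l n) \<longleftrightarrow>
    Expansion (eval M e c) (eval M e d) (eval M e l) (eval M e n)"
proof -
  have "sat M e s (is_sum k (\<lambda>h i x. ex h (\<lambda>t. entry (h+1) c d i t \<^bold>\<and> is_pow2 (h+1) t x))
      (l \<^bold>+ \<^bold>1) n) \<longleftrightarrow>
    Is_sum (\<lambda>i x. \<exists>t. Entry (eval M e c) (eval M e d) i t \<and> Is_pow2 t x)
      (eval M e (l \<^bold>+ \<^bold>1)) (eval M e n)"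
  proof (rule sat_is_sum)
    fix e' h i x
    assume *: "k \<le> h" "\<And>v. v < k \<Longrightarrow> e' v = e v" "tbound i \<le> h" "tbound x \<le> h"
    have "eval M e' c = eval M e c" "eval M e' d = eval M e d"
      using *(2) assms(1,2) tvars_tbound by (fastforce intro!: eval_cong)+
    then show "sat M e' s (ex h (\<lambda>t. entry (h+1) c d i t \<^bold>\<and> is_pow2 (h+1) t x)) \<longleftrightarrow>
        (\<exists>t. Entry (eval M e c) (eval M e d) (eval M e' i) t \<and> Is_pow2 t (eval M e' x))"
      using * assms by simp
  qed (use assms in auto)
  then show ?thesis
    using assms by (simp add: expansion_def Expansion_def)
qed

lemma sat_is_lambda [simp]:
  assumes "tbound n \<le> k" "tbound t \<le> k"
  shows "sat M e s (is_lambda k n t) \<longleftrightarrow> Is_lambda (eval M e n) (eval M e t)"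
  using assms by (simp add: is_lambda_def Is_lambda_def)

lemma sat_is_mu [simp]:
  assumes "tbound n \<le> k" "tbound t \<le> k"
  shows "sat M e s (is_mu k n t) \<longleftrightarrow> Is_mu (eval M e n) (eval M e t)"
  using assms by (simp add: is_mu_def Is_mu_def)

lemma sat_apart [simp]: "sat M e s (apart k X) \<longleftrightarrow> Apart (s X)"
  by (simp add: apart_def Apart_def)

lemma sat_sum_of_distinct [simp]:
  assumes "tbound j \<le> k" "tbound n \<le> k"
  shows "sat M e s (sum_of_distinct k X j n) \<longleftrightarrow> Sum_of_distinct (s X) (eval M e j) (eval M e n)"
proof -
  have "sat M e' s (is_sum (Suc (Suc k)) (\<lambda>h. entry h (Var k) (Var (Suc k))) j n) \<longleftrightarrow>
      Is_sum (Entry (e' k) (e' (Suc k))) (eval M e' j) (eval M e' n)" for e'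
    by (rule sat_is_sum) (use assms in auto)
  then show ?thesis
    using assms by (simp add: sum_of_distinct_def Sum_of_distinct_def)
qed

lemma sat_two_coloring [simp]: "sat M e s (two_coloring k C) \<longleftrightarrow> Two_coloring (s C)"
  unfolding two_coloring_def Two_coloring_def Pair_code_def pair_def Ex1_def by simp blast

lemma sat_apart_hindman_AP:
  "sat M e s apart_hindman_AP \<longleftrightarrow>
    (\<forall>C\<in>Sets M. Two_coloring C \<longrightarrow>
      (\<exists>H\<in>Sets M. (\<forall>m. \<exists>x. lt M m x \<and> x \<in> H) \<and> (\<forall>x\<in>H. lt M (zer M) x) \<and> Apart H \<and>
        (\<exists>a b. lt M (zer M) a \<and> lt M (zer M) b \<and>
          (\<exists>i. \<forall>n\<in>FS_set ({a, add M a b, add M a (mul M (add M (unit M) (unit M)) b)} \<union> {b}) H.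
            Pair_code n i \<in> C))))"
proof -
  have "sat M e' s' (in_FS 4 (\<lambda>j. j \<^bold>= Var 0 \<^bold>\<or> j \<^bold>= Var 0 \<^bold>+ Var 1 \<^bold>\<or>
        j \<^bold>= Var 0 \<^bold>+ (\<^bold>1 \<^bold>+ \<^bold>1) \<^bold>* Var 1 \<^bold>\<or> j \<^bold>= Var 1) X (Var 3)) \<longleftrightarrow>
      e' 3 \<in> FS_set ({e' 0, add M (e' 0) (e' 1),
        add M (e' 0) (mul M (add M (unit M) (unit M)) (e' 1))} \<union> {e' 1}) (s' X)" for e' s' X
    unfolding in_FS_def FS_set_def by simp blast
  then show ?thesis
    by (simp add: apart_hindman_AP_def infinite_set_def positive_set_def monochromatic_FS_def
          pair_def Pair_code_def Ball_def Bex_def)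
qed

end

end

theory Submission
  imports Defs
begin

text \<open>
  Let \<open>A\<close> be a set of pairs, read as an enumeration in which \<open>v\<close> appears at stage \<open>s\<close> if
  \<open>\<langle>v, s\<rangle> \<in> A\<close>; it is enough to show that the projection of \<open>A\<close> is a set. As in the work of Blass,
  Hirst and Simpson on Hindman's theorem, call a gap between consecutive exponents \<open>s < t\<close> of \<open>n\<close>
  very short if some \<open>v \<le> s\<close> appears by stage \<open>\<mu>(n)\<close> but not by stage \<open>t\<close>, and color \<open>n\<close> by the parity
  of the number of its very short gaps. For apart \<open>n < m\<close> the gaps of \<open>n + m\<close> are those of \<open>n\<close>, those
  of \<open>m\<close>, and the one between \<open>\<mu>(n)\<close> and \<open>\<lambda>(m)\<close>.

  Let \<open>x\<close> and \<open>x\<^sub>0\<close> be sums of \<open>a\<close> elements of a homogeneous set, and let \<open>y\<close> and \<open>z\<close> be sums of \<open>b\<close>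
  later elements with \<open>z\<close> far beyond \<open>y\<close>. As \<open>z\<close>, \<open>x + z\<close> and \<open>x + y + z\<close> have the same color, \<open>x\<close>
  and \<open>x + y\<close> have an even number of short gaps, that is, of gaps that are very short with respect
  to stage \<open>\<mu>(z)\<close>. Hence the gap between \<open>x\<close> and \<open>y\<close> is short iff \<open>y\<close> has an odd number of short gaps,
  a condition that does not depend on \<open>x\<close>. It fails for \<open>x\<^sub>0\<close> if \<open>y\<close> is far enough beyond \<open>x\<^sub>0\<close>, so it fails
  for all \<open>x\<close> before \<open>y\<close>: every \<open>v \<le> \<mu>(x)\<close> that ever appears has appeared by stage \<open>\<lambda>(y)\<close>.
\<close>

section \<open>The axioms of RCA0 in a fixed model\<close>

lemma sat_set_upd: "X \<notin> free_sets \<phi> \<Longrightarrow> sat M e (s(X := A)) \<phi> \<longleftrightarrow> sat M e s \<phi>"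
proof (induction \<phi> arbitrary: e s)
  case (AllS Y \<phi>)
  then show ?case
    by (cases "Y = X") (simp_all add: fun_upd_twist[of X Y] del: fun_upd_apply)
next
  case (ExS Y \<phi>)
  then show ?case
    by (cases "Y = X") (simp_all add: fun_upd_twist[of X Y] del: fun_upd_apply)
qed auto

text \<open>Both substituted terms contain no variable other than \<open>n\<close>, so
  \<open>sat_subst\<close> applies and nothing is captured.\<close>

lemma sat_induction_for:
  "sat M e s (induction_for n \<phi>) \<longleftrightarrow>
    (sat M (e(n := zer M)) s \<phi> \<and>
      (\<forall>a. sat M (e(n := a)) s \<phi> \<longrightarrow> sat M (e(n := add M a (unit M))) s \<phi>) \<longrightarrow>
      (\<forall>a. sat M (e(n := a)) s \<phi>))"
  by (simp add: induction_for_def sat_subst fun_upd_same del: fun_upd_apply)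

locale RCA0_model =
  fixes M :: "'a l2_struct"
  assumes Sets_nonempty: "Sets M \<noteq> {}" and RCA0: "M \<Turnstile> RCA0"
begin

abbreviation zero_M ("\<zero>") where "\<zero> \<equiv> zer M"
abbreviation one_M ("\<one>") where "\<one> \<equiv> unit M"
abbreviation add_M (infixl "\<oplus>" 65) where "x \<oplus> y \<equiv> add M x y"
abbreviation mul_M (infixl "\<otimes>" 70) where "x \<otimes> y \<equiv> mul M x y"
abbreviation lt_M (infix "\<prec>" 50) where "x \<prec> y \<equiv> lt M x y"

text \<open>Axioms hold under assignments into \<open>Sets M\<close>, so even a formula without set
  variables has to be evaluated under some such assignment.\<close>

definition some_set :: "nat \<Rightarrow> 'a set" where
  "some_set = (\<lambda>_. SOME A. A \<in> Sets M)"

lemma range_some_set: "range some_set \<subseteq> Sets M"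
  using Sets_nonempty by (auto simp: some_set_def intro: someI_ex)

lemma basic_axiom_sat: "\<phi> \<in> basic_axioms \<Longrightarrow> sat M e some_set \<phi>"
  using RCA0 range_some_set by (auto simp: models_def RCA0_def)

lemma add_one_nonzero [simp]: "n \<oplus> \<one> \<noteq> \<zero>"
  using basic_axiom_sat[of "\<^bold>\<not> (Var 1 \<^bold>+ \<^bold>1 \<^bold>= \<^bold>0)" "\<lambda>_. n"]
  by (simp add: basic_axioms_def Let_def)

lemma add_one_inject [simp]: "m \<oplus> \<one> = n \<oplus> \<one> \<longleftrightarrow> m = n"
  using basic_axiom_sat[of "Var 0 \<^bold>+ \<^bold>1 \<^bold>= Var 1 \<^bold>+ \<^bold>1 \<^bold>\<longrightarrow> Var 0 \<^bold>= Var 1" "(\<lambda>_. n)(0 := m)"]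
  by (auto simp: basic_axioms_def Let_def)

lemma add_zero_right [simp]: "m \<oplus> \<zero> = m"
  using basic_axiom_sat[of "Var 0 \<^bold>+ \<^bold>0 \<^bold>= Var 0" "\<lambda>_. m"] by (simp add: basic_axioms_def Let_def)

lemma add_Suc_right: "m \<oplus> (n \<oplus> \<one>) = m \<oplus> n \<oplus> \<one>"
  using basic_axiom_sat[of "Var 0 \<^bold>+ (Var 1 \<^bold>+ \<^bold>1) \<^bold>= (Var 0 \<^bold>+ Var 1) \<^bold>+ \<^bold>1" "(\<lambda>_. n)(0 := m)"]
  by (simp add: basic_axioms_def Let_def)

lemma mul_zero_right [simp]: "m \<otimes> \<zero> = \<zero>"
  using basic_axiom_sat[of "Var 0 \<^bold>* \<^bold>0 \<^bold>= \<^bold>0" "\<lambda>_. m"] by (simp add: basic_axioms_def Let_def)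

lemma mul_Suc_right: "m \<otimes> (n \<oplus> \<one>) = m \<otimes> n \<oplus> m"
  using basic_axiom_sat[of "Var 0 \<^bold>* (Var 1 \<^bold>+ \<^bold>1) \<^bold>= (Var 0 \<^bold>* Var 1) \<^bold>+ Var 0" "(\<lambda>_. n)(0 := m)"]
  by (simp add: basic_axioms_def Let_def)

lemma not_lt_zero [simp]: "\<not> m \<prec> \<zero>"
  using basic_axiom_sat[of "\<^bold>\<not> (Var 0 \<^bold>< \<^bold>0)" "\<lambda>_. m"] by (simp add: basic_axioms_def Let_def)

lemma lt_add_one_iff: "m \<prec> n \<oplus> \<one> \<longleftrightarrow> m \<prec> n \<or> m = n"
  using basic_axiom_sat[of "Var 0 \<^bold>< Var 1 \<^bold>+ \<^bold>1 \<^bold>\<longleftrightarrow> (Var 0 \<^bold>< Var 1 \<^bold>\<or> Var 0 \<^bold>= Var 1)" "(\<lambda>_. n)(0 := m)"]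
  by (simp add: basic_axioms_def Let_def)

text \<open>Fixed convention: variable 0 carries the induction and variable 1 the existential
  witness, so parameters are named from 2 on.\<close>

lemma sigma01_induction:
  assumes s: "range s \<subseteq> Sets M" and \<theta>: "sigma00 \<theta>"
    and 0: "\<exists>b. sat M (e(0 := \<zero>, 1 := b)) s \<theta>"
    and step: "\<And>n b. sat M (e(0 := n, 1 := b)) s \<theta> \<Longrightarrow> \<exists>b. sat M (e(0 := n \<oplus> \<one>, 1 := b)) s \<theta>"
  shows "\<exists>b. sat M (e(0 := n, 1 := b)) s \<theta>"
proof -
  have "sigma01 (ExN 1 \<theta>)"
    using \<theta> by (auto simp: sigma01_def)
  then have "sat M e s (induction_for 0 (ExN 1 \<theta>))"
    using RCA0 s unfolding models_def RCA0_def by blast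
  then have "sat M (e(0 := \<zero>)) s (ExN 1 \<theta>) \<Longrightarrow>
      (\<And>n. sat M (e(0 := n)) s (ExN 1 \<theta>) \<Longrightarrow> sat M (e(0 := n \<oplus> \<one>)) s (ExN 1 \<theta>)) \<Longrightarrow>
      sat M (e(0 := n)) s (ExN 1 \<theta>)"
    unfolding sat_induction_for by blast
  then show ?thesis
    unfolding sat.simps using 0 step by blast
qed

text \<open>As \<open>X\<close> is fresh for \<open>\<theta>\<close>, interpreting it by the new set
  leaves \<open>\<theta>\<close> unchanged, and the set given by the axiom is the displayed
  one.\<close>

lemma delta01_comprehension:
  assumes s: "range s \<subseteq> Sets M" and \<theta>: "sigma00 \<theta>" "sigma00 \<eta>" and X: "X \<notin> free_sets \<theta>"
    and eq: "\<And>a. (\<exists>b. sat M (e(0 := a, 1 := b)) s \<theta>) \<longleftrightarrow> (\<forall>b. sat M (e(0 := a, 1 := b)) s \<eta>)"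
  shows "{a. \<exists>b. sat M (e(0 := a, 1 := b)) s \<theta>} \<in> Sets M"
proof -
  have 1: "sigma01 (ExN 1 \<theta>)" "pi01 (AllN 1 \<eta>)" "X \<notin> free_sets (ExN 1 \<theta>)"
    using \<theta> X by (auto simp: sigma01_def pi01_def)
  have "sat M e s (AllN 0 (ExN 1 \<theta> \<^bold>\<longleftrightarrow> AllN 1 \<eta>) \<^bold>\<longrightarrow> comprehension_for X 0 (ExN 1 \<theta>))"
    using RCA0 s 1 unfolding models_def RCA0_def by blast
  moreover have "sat M e s (AllN 0 (ExN 1 \<theta> \<^bold>\<longleftrightarrow> AllN 1 \<eta>))"
    using eq by (simp del: fun_upd_apply)
  ultimately have "sat M e s (comprehension_for X 0 (ExN 1 \<theta>))"
    by simp
  then obtain A where A: "A \<in> Sets M"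
      and "\<forall>a. a \<in> A \<longleftrightarrow> (\<exists>b. sat M (e(0 := a, 1 := b)) (s(X := A)) \<theta>)"
    unfolding comprehension_for_def by (simp del: fun_upd_apply add: fun_upd_same) blast
  then have "A = {a. \<exists>b. sat M (e(0 := a, 1 := b)) s \<theta>}"
    using sat_set_upd[OF X] by blast
  with A show ?thesis
    by simp
qed

section \<open>Arithmetic in models of RCA0\<close>

text \<open>Parameters enter as \<open>Var 2\<close> and \<open>Var 3\<close>. Where
  \<open>Var 1\<close> does not occur, the existential quantifier is vacuous.\<close>

lemmas arith_induction = sigma01_induction[OF range_some_set]

lemma add_assoc: "x \<oplus> y \<oplus> z = x \<oplus> (y \<oplus> z)"
  using arith_induction[of "Var 2 \<^bold>+ Var 3 \<^bold>+ Var 0 \<^bold>= Var 2 \<^bold>+ (Var 3 \<^bold>+ Var 0)" "(\<lambda>_. x)(3 := y)" z]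
  by (simp add: sigma00.intros add_Suc_right)

lemma add_zero_left: "\<zero> \<oplus> x = x"
  using arith_induction[of "\<^bold>0 \<^bold>+ Var 0 \<^bold>= Var 0" "\<lambda>_. x" x]
  by (simp add: sigma00.intros add_assoc[symmetric])

lemma add_one_commute: "\<one> \<oplus> x = x \<oplus> \<one>"
  using arith_induction[of "\<^bold>1 \<^bold>+ Var 0 \<^bold>= Var 0 \<^bold>+ \<^bold>1" "\<lambda>_. x" x]
  by (simp add: sigma00.intros add_assoc[symmetric] add_zero_left)

lemma add_commute: "x \<oplus> y = y \<oplus> x"
  using arith_induction[of "Var 2 \<^bold>+ Var 0 \<^bold>= Var 0 \<^bold>+ Var 2" "\<lambda>_. x" y]
  by (simp add: sigma00.intros add_assoc[symmetric] add_zero_left)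
    (metis add_assoc add_one_commute)

lemma add_left_cancel: "x \<oplus> y = x \<oplus> z \<Longrightarrow> y = z"
  using arith_induction[of "Var 0 \<^bold>+ Var 2 \<^bold>= Var 0 \<^bold>+ Var 3 \<^bold>\<longrightarrow> Var 2 \<^bold>= Var 3" "(\<lambda>_. y)(3 := z)" x]
  by (simp add: sigma00.intros add_zero_left) (metis add_one_inject add_assoc add_commute)

lemma mul_zero_left: "\<zero> \<otimes> x = \<zero>"
  using arith_induction[of "\<^bold>0 \<^bold>* Var 0 \<^bold>= \<^bold>0" "\<lambda>_. x" x]
  by (simp add: sigma00.intros mul_Suc_right)

lemma mul_one_right: "x \<otimes> \<one> = x"
  using mul_Suc_right[of x \<zero>] by (simp add: add_zero_left)

lemma mul_distrib_right: "x \<otimes> (y \<oplus> z) = x \<otimes> y \<oplus> x \<otimes> z"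
  using arith_induction[of "Var 2 \<^bold>* (Var 3 \<^bold>+ Var 0) \<^bold>= Var 2 \<^bold>* Var 3 \<^bold>+ Var 2 \<^bold>* Var 0"
      "(\<lambda>_. x)(3 := y)" z]
  by (simp add: sigma00.intros mul_Suc_right add_assoc[symmetric])

lemma mul_distrib_left: "(x \<oplus> y) \<otimes> z = x \<otimes> z \<oplus> y \<otimes> z"
  using arith_induction[of "(Var 2 \<^bold>+ Var 3) \<^bold>* Var 0 \<^bold>= Var 2 \<^bold>* Var 0 \<^bold>+ Var 3 \<^bold>* Var 0"
      "(\<lambda>_. x)(3 := y)" z]
  by (simp add: sigma00.intros mul_Suc_right) (metis add_assoc add_commute)

lemma mul_one_left: "\<one> \<otimes> x = x"
  using arith_induction[of "\<^bold>1 \<^bold>* Var 0 \<^bold>= Var 0" "\<lambda>_. x" x]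
  by (simp add: sigma00.intros mul_Suc_right)

lemma mul_commute: "x \<otimes> y = y \<otimes> x"
  using arith_induction[of "Var 2 \<^bold>* Var 0 \<^bold>= Var 0 \<^bold>* Var 2" "\<lambda>_. x" y]
  by (simp add: sigma00.intros mul_Suc_right mul_zero_left mul_distrib_left mul_one_left)

lemma mul_assoc: "x \<otimes> y \<otimes> z = x \<otimes> (y \<otimes> z)"
  using arith_induction[of "Var 2 \<^bold>* Var 3 \<^bold>* Var 0 \<^bold>= Var 2 \<^bold>* (Var 3 \<^bold>* Var 0)"
      "(\<lambda>_. x)(3 := y)" z]
  by (simp add: sigma00.intros mul_Suc_right mul_distrib_right mul_one_right)

lemma zero_or_add_one: "x = \<zero> \<or> (\<exists>y. x = y \<oplus> \<one>)"
  using arith_induction[of "Var 0 \<^bold>= \<^bold>0 \<^bold>\<or> Var 0 \<^bold>= Var 1 \<^bold>+ \<^bold>1" "\<lambda>_. x" x]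
  by (simp add: sigma00.intros)

lemma lt_addI: "x \<prec> x \<oplus> (y \<oplus> \<one>)"
  using arith_induction[of "Var 2 \<^bold>< Var 2 \<^bold>+ (Var 0 \<^bold>+ \<^bold>1)" "\<lambda>_. x" y]
  by (simp add: sigma00.intros lt_add_one_iff add_zero_left add_assoc[symmetric])

lemma lt_iff: "x \<prec> y \<longleftrightarrow> (\<exists>z. y = x \<oplus> (z \<oplus> \<one>))"
proof
  assume "x \<prec> y"
  \<comment> \<open>The induction step in the form to which \<open>simp\<close> reduces it: the
    witness is zero if \<open>x = n\<close> and the successor of the old one if
    \<open>x \<prec> n\<close>.\<close>
  have step: "\<exists>b. (x \<prec> n \<longrightarrow> n = x \<oplus> b) \<and> (x = n \<longrightarrow> n = n \<oplus> b)"
    if "x \<prec> n \<longrightarrow> n = x \<oplus> b \<oplus> \<one>" for n b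
    using that by (cases "x = n") (auto simp: add_assoc intro: exI[of _ \<zero>])
  note \<open>x \<prec> y\<close> moreover have "\<exists>z. x \<prec> y \<longrightarrow> y = x \<oplus> (z \<oplus> \<one>)"
    using arith_induction[of "Var 2 \<^bold>< Var 0 \<^bold>\<longrightarrow> Var 0 \<^bold>= Var 2 \<^bold>+ (Var 1 \<^bold>+ \<^bold>1)" "\<lambda>_. x" y]
    by (simp add: sigma00.intros lt_add_one_iff add_assoc[symmetric] step)
  ultimately show "\<exists>z. y = x \<oplus> (z \<oplus> \<one>)"
    by blast
qed (auto intro: lt_addI)

lemma lt_linear: "x \<prec> y \<or> x = y \<or> y \<prec> x"
proof -
  have zero: "\<zero> = y \<or> \<zero> \<prec> y"
    using zero_or_add_one[of y] by (auto simp: lt_iff add_zero_left)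
  have suc: "n \<oplus> \<one> = y \<or> n \<oplus> \<one> \<prec> y" if "n \<prec> y" for n
    using that unfolding lt_iff by (metis add_assoc add_commute add_zero_left zero_or_add_one)
  show ?thesis
    using arith_induction[of "Var 0 \<^bold>< Var 2 \<^bold>\<or> Var 0 \<^bold>= Var 2 \<^bold>\<or> Var 2 \<^bold>< Var 0" "\<lambda>_. y" x]
    by (simp add: sigma00.intros lt_add_one_iff) (metis zero suc)
qed

lemma lt_irrefl: "\<not> x \<prec> x"
  unfolding lt_iff by (metis add_left_cancel add_zero_right add_one_nonzero)

lemma lt_trans: "x \<prec> y \<Longrightarrow> y \<prec> z \<Longrightarrow> x \<prec> z"
  unfolding lt_iff by (metis add_assoc)

definition le :: "'a \<Rightarrow> 'a \<Rightarrow> bool" (infix "\<preceq>" 50) where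
  "x \<preceq> y \<longleftrightarrow> x \<prec> y \<or> x = y"

text \<open>Truncated subtraction: with this default the laws for iterated differences and for
  products with differences hold without side conditions.\<close>

definition diff :: "'a \<Rightarrow> 'a \<Rightarrow> 'a" (infixl "\<ominus>" 65) where
  "x \<ominus> y = (if y \<preceq> x then THE z. y \<oplus> z = x else \<zero>)"

lemma le_iff_add: "x \<preceq> y \<longleftrightarrow> (\<exists>z. y = x \<oplus> z)"
  unfolding le_def lt_iff by (metis zero_or_add_one add_zero_right)

lemma add_diff: "x \<oplus> y \<ominus> x = y"
  unfolding diff_def by (auto simp: le_iff_add dest: add_left_cancel)

lemma diff_le_zero: "x \<preceq> y \<Longrightarrow> x \<ominus> y = \<zero>"
  by (metis diff_def le_def lt_irrefl lt_trans add_diff add_zero_right)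

lemma le_total: "x \<preceq> y \<or> y \<preceq> x"
  using lt_linear le_def by blast

text \<open>Makes the library's order and cancellation rules and \<open>algebra_simps\<close>
  available for the possibly nonstandard numbers of the structure.\<close>

sublocale arith: discrete_linordered_semidom
  where minus = "(\<ominus>)" and plus = "(\<oplus>)" and zero = "\<zero>" and times = "(\<otimes>)" and one = "\<one>"
    and less_eq = "(\<preceq>)" and less = "(\<prec>)"
proof
  fix a b c
  show "a \<oplus> b \<oplus> c = a \<oplus> (b \<oplus> c)" "a \<oplus> b = b \<oplus> a" "\<zero> \<oplus> a = a"
      "a \<otimes> b \<otimes> c = a \<otimes> (b \<otimes> c)" "a \<otimes> b = b \<otimes> a" "\<one> \<otimes> a = a"
      "(a \<oplus> b) \<otimes> c = a \<otimes> c \<oplus> b \<otimes> c" "a \<oplus> b \<ominus> a = b"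
    by (simp_all add: add_assoc add_zero_left mul_assoc mul_one_left mul_distrib_left add_diff)
      (simp_all add: add_commute mul_commute)
  show "a \<otimes> (b \<oplus> c) = a \<otimes> b \<oplus> a \<otimes> c"
    by (rule mul_distrib_right)
  show "\<zero> \<noteq> \<one>"
    using add_one_nonzero[of \<zero>] by (simp add: add_zero_left)
  show "\<zero> \<prec> \<one>"
    using lt_addI[of \<zero> \<zero>] by (simp add: add_zero_left)
  show "\<zero> \<otimes> a = \<zero>" "a \<otimes> \<zero> = \<zero>"
    by (simp_all add: mul_zero_left)
  show "a \<ominus> b \<ominus> c = a \<ominus> (b \<oplus> c)"
    by (cases "b \<oplus> c \<preceq> a")
      (metis le_iff_add add_assoc add_diff, metis le_iff_add add_assoc add_diff diff_le_zero le_total)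
  have mono: "a \<otimes> b \<preceq> a \<otimes> c" if "b \<preceq> c" for a b c
    using that by (metis le_iff_add mul_distrib_right)
  show "a \<otimes> (b \<ominus> c) = a \<otimes> b \<ominus> a \<otimes> c"
    using le_total[of b c] mono[of b c a]
    by (metis add_diff diff_le_zero le_iff_add mul_distrib_right mul_zero_right)
  show "a \<prec> b \<longleftrightarrow> a \<preceq> b \<and> \<not> b \<preceq> a"
    using le_def lt_irrefl lt_trans by blast
  show "a \<preceq> a" "a \<preceq> b \<or> b \<preceq> a"
    using le_total le_def by blast+
  show "a \<preceq> b \<Longrightarrow> b \<preceq> c \<Longrightarrow> a \<preceq> c"
    unfolding le_def using lt_trans by blast
  show "a \<preceq> b \<Longrightarrow> b \<preceq> a \<Longrightarrow> a = b"
    unfolding le_def using lt_irrefl lt_trans by blast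
  show "a \<preceq> b \<Longrightarrow> c \<oplus> a \<preceq> c \<oplus> b"
    by (metis le_iff_add add_assoc)
  show "b \<preceq> a \<Longrightarrow> a \<ominus> b \<oplus> b = a"
    by (metis le_iff_add add_diff add_commute)
  show "a \<prec> b \<longleftrightarrow> a \<oplus> \<one> \<preceq> b"
    by (metis le_iff_add lt_iff add_assoc add_commute)
  have pos: "a \<noteq> \<zero> \<Longrightarrow> b \<noteq> \<zero> \<Longrightarrow> a \<otimes> b \<noteq> \<zero>" for a b
    by (metis add_one_nonzero zero_or_add_one mul_Suc_right add_assoc)
  then show "a \<noteq> \<zero> \<Longrightarrow> b \<noteq> \<zero> \<Longrightarrow> a \<otimes> b \<noteq> \<zero>" .
  show "c \<otimes> a \<prec> c \<otimes> b" if "a \<prec> b" "\<zero> \<prec> c"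
  proof -
    obtain z where z: "b = a \<oplus> (z \<oplus> \<one>)"
      using \<open>a \<prec> b\<close> lt_iff by blast
    have "c \<noteq> \<zero>"
      using \<open>\<zero> \<prec> c\<close> lt_irrefl by blast
    then have "c \<otimes> (z \<oplus> \<one>) \<noteq> \<zero>"
      by (intro pos) auto
    then obtain w where "c \<otimes> (z \<oplus> \<one>) = w \<oplus> \<one>"
      using zero_or_add_one by blast
    then show ?thesis
      unfolding z mul_distrib_right by (simp add: lt_addI)
  qed
qed

end

lemma eval_pair [simp]: "eval M e (pair t u) = Pair_code M (eval M e t) (eval M e u)"
  by (simp add: pair_def Pair_code_def)

context RCA0_model
begin

section \<open>Predicates and functions that are sets of the model\<close>

abbreviation pair_M ("\<langle>_, _\<rangle>") where "\<langle>x, y\<rangle> \<equiv> Pair_code M x y"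

lemma zero_le [simp]: "\<zero> \<preceq> x"
  by (simp add: le_iff_add add_zero_left)

lemma lt_add_one_le: "x \<prec> y \<oplus> \<one> \<longleftrightarrow> x \<preceq> y"
  by (simp add: lt_add_one_iff le_def)

lemma self_le_square: "x \<preceq> x \<otimes> x"
proof (cases "x = \<zero>")
  case False
  then obtain y where "x = y \<oplus> \<one>"
    using zero_or_add_one by blast
  then have "x \<otimes> x = x \<oplus> x \<otimes> y"
    by (simp add: mul_distrib_right mul_one_right arith.add.commute)
  then show ?thesis
    by (auto simp: le_iff_add)
qed simp

lemma pair_ge_left [simp]: "x \<preceq> \<langle>x, y\<rangle>"
  unfolding Pair_code_def by (metis le_iff_add add_commute)

lemma pair_ge_right [simp]: "y \<preceq> \<langle>x, y\<rangle>"
  unfolding Pair_code_def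
  by (metis le_iff_add add_commute self_le_square arith.order_trans)

lemma le_pair_left [simp]: "z \<preceq> x \<Longrightarrow> z \<preceq> \<langle>x, y\<rangle>"
  and le_pair_right [simp]: "z \<preceq> y \<Longrightarrow> z \<preceq> \<langle>x, y\<rangle>"
  using arith.order_trans pair_ge_left pair_ge_right by blast+

text \<open>A pair with sum \<open>s\<close> has a code between the square of \<open>s\<close> and
  that square plus \<open>s\<close>, hence below the square of \<open>s + 1\<close>. So the code
  determines the sum, and then the first component.\<close>

lemma pair_less:
  assumes "x \<oplus> y \<prec> x' \<oplus> y'"
  shows "\<langle>x, y\<rangle> \<prec> \<langle>x', y'\<rangle>"
proof -
  let ?s = "x \<oplus> y"
  obtain z where z: "x' \<oplus> y' = ?s \<oplus> \<one> \<oplus> z"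
    using assms lt_iff by (metis add_assoc add_commute)
  have "(x' \<oplus> y') \<otimes> (x' \<oplus> y') = (?s \<oplus> \<one>) \<otimes> (?s \<oplus> \<one>) \<oplus> (z \<otimes> (?s \<oplus> \<one> \<oplus> z) \<oplus> (?s \<oplus> \<one>) \<otimes> z)"
    unfolding z by (simp add: algebra_simps)
  also have "(?s \<oplus> \<one>) \<otimes> (?s \<oplus> \<one>) = ?s \<otimes> ?s \<oplus> x \<oplus> (y \<oplus> ?s \<oplus> \<one>)"
    by (simp add: algebra_simps)
  finally have "\<langle>x', y'\<rangle> = \<langle>x, y\<rangle> \<oplus> ((z \<otimes> (?s \<oplus> \<one> \<oplus> z) \<oplus> (?s \<oplus> \<one>) \<otimes> z \<oplus> y \<oplus> ?s \<oplus> x') \<oplus> \<one>)"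
    unfolding Pair_code_def by (simp add: algebra_simps)
  then show ?thesis
    unfolding lt_iff by blast
qed

lemma pair_inject [simp]: "\<langle>x, y\<rangle> = \<langle>x', y'\<rangle> \<longleftrightarrow> x = x' \<and> y = y'"
proof
  assume eq: "\<langle>x, y\<rangle> = \<langle>x', y'\<rangle>"
  then have "x \<oplus> y = x' \<oplus> y'"
    using pair_less lt_linear lt_irrefl by metis
  with eq show "x = x' \<and> y = y'"
    unfolding Pair_code_def using add_left_cancel by metis
qed auto

text \<open>Not every number codes a pair; the default zero keeps the projections total and bounded
  by their argument.\<close>

definition proj1 :: "'a \<Rightarrow> 'a" where
  "proj1 z = (if \<exists>x y. z = \<langle>x, y\<rangle> then THE x. \<exists>y. z = \<langle>x, y\<rangle> else \<zero>)"

definition proj2 :: "'a \<Rightarrow> 'a" where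
  "proj2 z = (if \<exists>x y. z = \<langle>x, y\<rangle> then THE y. \<exists>x. z = \<langle>x, y\<rangle> else \<zero>)"

lemma proj1_pair [simp]: "proj1 \<langle>x, y\<rangle> = x" and proj2_pair [simp]: "proj2 \<langle>x, y\<rangle> = y"
  by (auto simp: proj1_def proj2_def)

lemma proj1_le: "proj1 z \<preceq> z" and proj2_le: "proj2 z \<preceq> z"
proof -
  have "proj1 z \<preceq> z \<and> proj2 z \<preceq> z"
  proof (cases "\<exists>x y. z = \<langle>x, y\<rangle>")
    case False
    then have "proj1 z = \<zero>" "proj2 z = \<zero>"
      unfolding proj1_def proj2_def by simp_all
    then show ?thesis
      by simp
  qed auto
  then show "proj1 z \<preceq> z" "proj2 z \<preceq> z"
    by auto
qed

text \<open>All quantifiers on the right are bounded, so the graph of the projection is given by a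
  \<open>sigma00\<close> formula.\<close>

lemma eq_proj1_iff: "x = proj1 z \<longleftrightarrow> (\<exists>y. y \<preceq> z \<and> z = \<langle>x, y\<rangle>) \<or>
    x = \<zero> \<and> \<not> (\<exists>u. u \<preceq> z \<and> (\<exists>v. v \<preceq> z \<and> z = \<langle>u, v\<rangle>))"
  by (cases "\<exists>u v. z = \<langle>u, v\<rangle>")
    (auto simp: proj1_def, (metis pair_ge_left pair_ge_right)?)

lemma eq_proj2_iff: "x = proj2 z \<longleftrightarrow> (\<exists>y. y \<preceq> z \<and> z = \<langle>y, x\<rangle>) \<or>
    x = \<zero> \<and> \<not> (\<exists>u. u \<preceq> z \<and> (\<exists>v. v \<preceq> z \<and> z = \<langle>u, v\<rangle>))"
  by (cases "\<exists>u v. z = \<langle>u, v\<rangle>")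
    (auto simp: proj2_def, (metis pair_ge_left pair_ge_right)?)

text \<open>By \<open>\<Delta>\<^sub>1\<close> comprehension, membership in \<open>Sets M\<close> plays the role of \<open>\<Delta>\<^sub>1\<close> definability with
  parameters. In the rules \<open>delta_intros\<close> below, a bound variable is turned into a component of a
  coded pair, so that unary predicates and functions suffice and no formulas have to be written.\<close>

definition delta_pred :: "('a \<Rightarrow> bool) \<Rightarrow> bool" where
  "delta_pred P \<longleftrightarrow> Collect P \<in> Sets M"

definition delta_fun :: "('a \<Rightarrow> 'a) \<Rightarrow> bool" where
  "delta_fun f \<longleftrightarrow> {z. \<exists>x. z = \<langle>x, f x\<rangle>} \<in> Sets M"

text \<open>Two set parameters, named 0 and 1, suffice for the closure rules below; the name 2 stays
  free for the set to be formed.\<close>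

definition set_env :: "'a set \<Rightarrow> 'a set \<Rightarrow> nat \<Rightarrow> 'a set" where
  "set_env A B = (\<lambda>_. B)(0 := A)"

lemma set_env_simps [simp]: "set_env A B 0 = A" "set_env A B (Suc 0) = B"
  by (auto simp: set_env_def)

text \<open>\<open>\<theta>\<close> and \<open>\<eta>\<close> are the matrices of an existential and
  of a universal definition of the same predicate.\<close>

lemma comprehension:
  assumes "\<And>a. P a \<longleftrightarrow> (\<exists>b. sat M (e(0 := a, 1 := b)) (set_env A B) \<theta>)"
    and "\<And>a. P a \<longleftrightarrow> (\<forall>b. sat M (e(0 := a, 1 := b)) (set_env A B) \<eta>)"
    and "A \<in> Sets M" "B \<in> Sets M" "sigma00 \<theta>" "sigma00 \<eta>" "free_sets \<theta> \<subseteq> {0, 1}"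
  shows "delta_pred P"
proof -
  have range: "range (set_env A B) \<subseteq> Sets M"
    using assms(3,4) by (auto simp: set_env_def)
  have fresh: "2 \<notin> free_sets \<theta>"
    using assms(7) by auto
  have "(\<exists>b. sat M (e(0 := a, 1 := b)) (set_env A B) \<theta>) \<longleftrightarrow>
      (\<forall>b. sat M (e(0 := a, 1 := b)) (set_env A B) \<eta>)" for a
    using assms(1,2) by blast
  from delta01_comprehension[OF range assms(5,6) fresh this]
  have "{a. \<exists>b. sat M (e(0 := a, 1 := b)) (set_env A B) \<theta>} \<in> Sets M" .
  moreover have "Collect P = {a. \<exists>b. sat M (e(0 := a, 1 := b)) (set_env A B) \<theta>}"
    using assms(1) by (intro Collect_cong)
  ultimately show ?thesis
    by (simp only: delta_pred_def)
qed

abbreviation bex_le :: "nat \<Rightarrow> nat \<Rightarrow> fm \<Rightarrow> fm" where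
  "bex_le x y \<phi> \<equiv> ExN x (Var x \<^bold>< Var y \<^bold>+ \<^bold>1 \<^bold>\<and> \<phi>)"

named_theorems delta_intros

lemma Sets_ex: "\<exists>A. A \<in> Sets M"
  using Sets_nonempty by blast

lemma delta_pred_not [delta_intros]: "delta_pred P \<Longrightarrow> delta_pred (\<lambda>x. \<not> P x)"
  by (rule comprehension[of _ undefined "Collect P" "Collect P" "\<^bold>\<not> (Var 0 \<^bold>\<in> 0)" "\<^bold>\<not> (Var 0 \<^bold>\<in> 0)"])
    (auto simp: delta_pred_def simp: sigma00.intros)

lemma delta_pred_conj [delta_intros]: "delta_pred P \<Longrightarrow> delta_pred Q \<Longrightarrow> delta_pred (\<lambda>x. P x \<and> Q x)"
  by (rule comprehension[of _ undefined "Collect P" "Collect Q"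
        "Var 0 \<^bold>\<in> 0 \<^bold>\<and> Var 0 \<^bold>\<in> 1" "Var 0 \<^bold>\<in> 0 \<^bold>\<and> Var 0 \<^bold>\<in> 1"])
    (auto simp: delta_pred_def simp: sigma00.intros)

lemma delta_pred_disj [delta_intros]:
  assumes "delta_pred P" "delta_pred Q" shows "delta_pred (\<lambda>x. P x \<or> Q x)"
proof -
  have "delta_pred (\<lambda>x. \<not> (\<not> P x \<and> \<not> Q x))"
    using assms by (intro delta_intros)
  then show ?thesis
    by simp
qed

lemma delta_pred_imp [delta_intros]: "delta_pred P \<Longrightarrow> delta_pred Q \<Longrightarrow> delta_pred (\<lambda>x. P x \<longrightarrow> Q x)"
  unfolding imp_conv_disj by (intro delta_intros)

lemma delta_pred_iff [delta_intros]: "delta_pred P \<Longrightarrow> delta_pred Q \<Longrightarrow> delta_pred (\<lambda>x. P x \<longleftrightarrow> Q x)"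
  unfolding iff_conv_conj_imp by (intro delta_intros)

lemma delta_pred_const [delta_intros]: "delta_pred (\<lambda>_. P)"
proof -
  obtain A where "A \<in> Sets M"
    using Sets_ex by blast
  then have "delta_pred (\<lambda>x. x \<in> A)"
    by (simp add: delta_pred_def)
  then have "delta_pred (\<lambda>x. x \<in> A \<and> x \<notin> A)" "delta_pred (\<lambda>x. \<not> (x \<in> A \<and> x \<notin> A))"
    by (intro delta_intros; assumption)+
  then show ?thesis
    by (cases P) simp_all
qed

text \<open>The value of \<open>f\<close> is unique, so a condition on it can be written with an
  existential as well as with a universal quantifier over the graph.\<close>

lemma delta_pred_comp: "delta_pred P \<Longrightarrow> delta_fun f \<Longrightarrow> delta_pred (\<lambda>x. P (f x))"
  by (rule comprehension[of _ undefined "{z. \<exists>x. z = \<langle>x, f x\<rangle>}" "Collect P"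
        "pair (Var 0) (Var 1) \<^bold>\<in> 0 \<^bold>\<and> Var 1 \<^bold>\<in> 1" "pair (Var 0) (Var 1) \<^bold>\<in> 0 \<^bold>\<longrightarrow> Var 1 \<^bold>\<in> 1"])
    (auto simp: delta_pred_def delta_fun_def simp: sigma00.intros)

lemma delta_pred_mem [delta_intros]: "A \<in> Sets M \<Longrightarrow> delta_fun f \<Longrightarrow> delta_pred (\<lambda>x. f x \<in> A)"
  by (rule delta_pred_comp) (simp_all add: delta_pred_def)

lemma delta_pred_bex_le [delta_intros]:
  "delta_fun t \<Longrightarrow> delta_pred (\<lambda>z. P (proj1 z) (proj2 z)) \<Longrightarrow> delta_pred (\<lambda>x. \<exists>y. y \<preceq> t x \<and> P x y)"
  by (rule comprehension[of _ undefined "{z. \<exists>x. z = \<langle>x, t x\<rangle>}" "{z. P (proj1 z) (proj2 z)}"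
        "pair (Var 0) (Var 1) \<^bold>\<in> 0 \<^bold>\<and> bex_le 2 1 (pair (Var 0) (Var 2) \<^bold>\<in> 1)"
        "pair (Var 0) (Var 1) \<^bold>\<in> 0 \<^bold>\<longrightarrow> bex_le 2 1 (pair (Var 0) (Var 2) \<^bold>\<in> 1)"])
    (auto simp: delta_pred_def delta_fun_def lt_add_one_le simp: sigma00.intros)

text \<open>\<open>Var 2\<close> and \<open>Var 3\<close> are the components of the code
  \<open>Var 0\<close>, and \<open>Var 1\<close> is the intermediate value \<open>g x\<close>. As
  this value is unique, the conjunction and the implication define the same graph.\<close>

lemma delta_fun_comp:
  assumes "delta_fun f" "delta_fun g" shows "delta_fun (\<lambda>x. f (g x))"
  unfolding delta_fun_def delta_pred_def[symmetric]
  by (rule comprehension[of _ undefined "{z. \<exists>x. z = \<langle>x, f x\<rangle>}" "{z. \<exists>x. z = \<langle>x, g x\<rangle>}"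
        "bex_le 2 0 (bex_le 3 0 (Var 0 \<^bold>= pair (Var 2) (Var 3) \<^bold>\<and>
          pair (Var 2) (Var 1) \<^bold>\<in> 1 \<^bold>\<and> pair (Var 1) (Var 3) \<^bold>\<in> 0))"
        "bex_le 2 0 (bex_le 3 0 (Var 0 \<^bold>= pair (Var 2) (Var 3) \<^bold>\<and>
          (pair (Var 2) (Var 1) \<^bold>\<in> 1 \<^bold>\<longrightarrow> pair (Var 1) (Var 3) \<^bold>\<in> 0)))"])
    (use assms in \<open>auto simp: delta_fun_def lt_add_one_le simp: sigma00.intros\<close>, metis pair_inject)

lemma delta_fun_pair [delta_intros]:
  assumes "delta_fun f" "delta_fun g" shows "delta_fun (\<lambda>x. \<langle>f x, g x\<rangle>)"
  unfolding delta_fun_def delta_pred_def[symmetric]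
  by (rule comprehension[of _ undefined "{z. \<exists>x. z = \<langle>x, f x\<rangle>}" "{z. \<exists>x. z = \<langle>x, g x\<rangle>}"
        "bex_le 2 0 (bex_le 3 0 (bex_le 4 0 (Var 0 \<^bold>= pair (Var 2) (pair (Var 3) (Var 4)) \<^bold>\<and>
          pair (Var 2) (Var 3) \<^bold>\<in> 0 \<^bold>\<and> pair (Var 2) (Var 4) \<^bold>\<in> 1)))"
        "bex_le 2 0 (bex_le 3 0 (bex_le 4 0 (Var 0 \<^bold>= pair (Var 2) (pair (Var 3) (Var 4)) \<^bold>\<and>
          pair (Var 2) (Var 3) \<^bold>\<in> 0 \<^bold>\<and> pair (Var 2) (Var 4) \<^bold>\<in> 1)))"])
    (use assms in \<open>auto simp: delta_fun_def lt_add_one_le simp: sigma00.intros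
\<close>)

text \<open>In \<open>\<rho>\<close> the argument is \<open>Var 2\<close> and the value
  \<open>Var 3\<close>; both are bounded by the code of their pair, so bounded quantifiers recover
  them.\<close>

lemma delta_fun_sigma00:
  assumes "sigma00 \<rho>" "free_sets \<rho> \<subseteq> {0, 1}"
    and "A \<in> Sets M" "B \<in> Sets M"
    and eq: "\<And>e. sat M e (set_env A B) \<rho> \<longleftrightarrow> e 3 = f (e 2)"
  shows "delta_fun f"
  unfolding delta_fun_def delta_pred_def[symmetric]
  by (rule comprehension[of _ undefined A B
        "bex_le 2 0 (bex_le 3 0 (Var 0 \<^bold>= pair (Var 2) (Var 3) \<^bold>\<and> \<rho>))"
        "bex_le 2 0 (bex_le 3 0 (Var 0 \<^bold>= pair (Var 2) (Var 3) \<^bold>\<and> \<rho>))"])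
    (use assms in \<open>auto simp: lt_add_one_le eq simp: sigma00.intros\<close>)

lemma delta_fun_id [delta_intros]: "delta_fun (\<lambda>x. x)"
  using Sets_ex by (auto intro!: delta_fun_sigma00[of "Var 3 \<^bold>= Var 2"] sigma00.intros)

text \<open>An element of the structure need not be the value of a closed term, so \<open>c\<close>
  enters through the assignment, as the free variable \<open>Var 3\<close>.\<close>

lemma delta_fun_const [delta_intros]: "delta_fun (\<lambda>_. c)"
proof -
  obtain A where A: "A \<in> Sets M"
    using Sets_ex by blast
  show ?thesis
    unfolding delta_fun_def delta_pred_def[symmetric]
    by (rule comprehension[of _ "\<lambda>_. c" A A "bex_le 2 0 (Var 0 \<^bold>= pair (Var 2) (Var 3))"
          "bex_le 2 0 (Var 0 \<^bold>= pair (Var 2) (Var 3))"])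
      (use A in \<open>auto simp: lt_add_one_le simp: sigma00.intros\<close>)
qed

lemma delta_fun_proj1': "delta_fun proj1"
proof -
  obtain A where "A \<in> Sets M"
    using Sets_ex by blast
  then show ?thesis
    by (rule_tac delta_fun_sigma00[of "bex_le 4 2 (Var 2 \<^bold>= pair (Var 3) (Var 4)) \<^bold>\<or>
      Var 3 \<^bold>= \<^bold>0 \<^bold>\<and> \<^bold>\<not> (bex_le 4 2 (bex_le 5 2 (Var 2 \<^bold>= pair (Var 4) (Var 5))))" A A])
     (simp_all add: lt_add_one_le eq_proj1_iff sigma00.intros)
qed

lemma delta_fun_proj2': "delta_fun proj2"
proof -
  obtain A where "A \<in> Sets M"
    using Sets_ex by blast
  then show ?thesis
    by (rule_tac delta_fun_sigma00[of "bex_le 4 2 (Var 2 \<^bold>= pair (Var 4) (Var 3)) \<^bold>\<or>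
      Var 3 \<^bold>= \<^bold>0 \<^bold>\<and> \<^bold>\<not> (bex_le 4 2 (bex_le 5 2 (Var 2 \<^bold>= pair (Var 4) (Var 5))))" A A])
     (simp_all add: lt_add_one_le eq_proj2_iff sigma00.intros)
qed

lemma delta_fun_proj1 [delta_intros]: "delta_fun f \<Longrightarrow> delta_fun (\<lambda>x. proj1 (f x))" and delta_fun_proj2 [delta_intros]: "delta_fun f \<Longrightarrow> delta_fun (\<lambda>x. proj2 (f x))"
  using delta_fun_comp delta_fun_proj1' delta_fun_proj2' by auto

text \<open>In \<open>\<rho>\<close> the arguments are \<open>Var 4\<close> and \<open>Var 5\<close>
  and the value is \<open>Var 3\<close>. Applying \<open>h\<close> first to the two components of a
  single code keeps its arguments bounded.\<close>

lemma delta_fun_op: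
  assumes "sigma00 \<rho>" "free_sets \<rho> = {}"
    and eq: "\<And>e s. sat M e s \<rho> \<longleftrightarrow> e 3 = h (e 4) (e 5)" and "delta_fun f" "delta_fun g"
  shows "delta_fun (\<lambda>x. h (f x) (g x))"
proof -
  have "delta_fun (\<lambda>x. h (proj1 x) (proj2 x))"
    by (rule delta_fun_sigma00[of "bex_le 4 2 (bex_le 5 2 (pair (Var 2) (Var 4) \<^bold>\<in> 0 \<^bold>\<and> pair (Var 2) (Var 5) \<^bold>\<in> 1 \<^bold>\<and> \<rho>))"
          "{z. \<exists>x. z = \<langle>x, proj1 x\<rangle>}" "{z. \<exists>x. z = \<langle>x, proj2 x\<rangle>}"])
      (use assms delta_fun_proj1' delta_fun_proj2' proj1_le proj2_le in \<open>auto simp: delta_fun_def lt_add_one_le simp: sigma00.intros\<close>)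
  from delta_fun_comp[OF this delta_fun_pair[OF assms(4,5)]] show ?thesis
    by simp
qed

lemma delta_fun_add [delta_intros]: "delta_fun f \<Longrightarrow> delta_fun g \<Longrightarrow> delta_fun (\<lambda>x. f x \<oplus> g x)"
  by (rule delta_fun_op[of "Var 3 \<^bold>= Var 4 \<^bold>+ Var 5" "(\<oplus>)"]) (auto simp: sigma00.intros)

lemma delta_fun_mul [delta_intros]: "delta_fun f \<Longrightarrow> delta_fun g \<Longrightarrow> delta_fun (\<lambda>x. f x \<otimes> g x)"
  by (rule delta_fun_op[of "Var 3 \<^bold>= Var 4 \<^bold>* Var 5" "(\<otimes>)"]) (auto simp: sigma00.intros)

lemma delta_fun_diff [delta_intros]: "delta_fun f \<Longrightarrow> delta_fun g \<Longrightarrow> delta_fun (\<lambda>x. f x \<ominus> g x)"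
proof (rule delta_fun_op[of "Var 3 \<^bold>+ Var 5 \<^bold>= Var 4 \<^bold>\<or> Var 4 \<^bold>< Var 5 \<^bold>\<and> Var 3 \<^bold>= \<^bold>0" "(\<ominus>)"])
  show "sat M e s (Var 3 \<^bold>+ Var 5 \<^bold>= Var 4 \<^bold>\<or> Var 4 \<^bold>< Var 5 \<^bold>\<and> Var 3 \<^bold>= \<^bold>0) \<longleftrightarrow> e 3 = e 4 \<ominus> e 5" for e s
  proof (cases "e 4 \<prec> e 5")
    case True
    then have "e 4 \<ominus> e 5 = \<zero>" "e 3 \<oplus> e 5 \<noteq> e 4"
      using diff_le_zero le_def le_iff_add lt_irrefl lt_trans add_commute by metis+
    with True show ?thesis
      by simp
  next
    case False
    then have "e 4 \<ominus> e 5 \<oplus> e 5 = e 4"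
      using arith.le_add_diff_inverse2 arith.not_less by blast
    then have "e 3 \<oplus> e 5 = e 4 \<longleftrightarrow> e 3 = e 4 \<ominus> e 5"
      using add_left_cancel add_commute by metis
    with False show ?thesis
      by simp
  qed
qed (auto simp: sigma00.intros)

lemma delta_pred_rel:
  assumes "sigma00 \<rho>" "free_sets \<rho> = {}"
    and eq: "\<And>e s. sat M e s \<rho> \<longleftrightarrow> R (e 4) (e 5)" and "delta_fun f" "delta_fun g"
  shows "delta_pred (\<lambda>x. R (f x) (g x))"
proof -
  have "delta_pred (\<lambda>x. R (proj1 x) (proj2 x))"
    by (rule comprehension[of _ undefined "{z. \<exists>x. z = \<langle>x, proj1 x\<rangle>}" "{z. \<exists>x. z = \<langle>x, proj2 x\<rangle>}"
          "bex_le 4 0 (bex_le 5 0 (pair (Var 0) (Var 4) \<^bold>\<in> 0 \<^bold>\<and> pair (Var 0) (Var 5) \<^bold>\<in> 1 \<^bold>\<and> \<rho>))"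
          "bex_le 4 0 (bex_le 5 0 (pair (Var 0) (Var 4) \<^bold>\<in> 0 \<^bold>\<and> pair (Var 0) (Var 5) \<^bold>\<in> 1 \<^bold>\<and> \<rho>))"])
      (use assms delta_fun_proj1' delta_fun_proj2' proj1_le proj2_le in \<open>auto simp: delta_fun_def lt_add_one_le simp: sigma00.intros\<close>)
  from delta_pred_comp[OF this delta_fun_pair[OF assms(4,5)]] show ?thesis
    by simp
qed

lemma delta_pred_eq [delta_intros]: "delta_fun f \<Longrightarrow> delta_fun g \<Longrightarrow> delta_pred (\<lambda>x. f x = g x)"
  by (rule delta_pred_rel[of "Var 4 \<^bold>= Var 5" "(=)"]) (auto simp: sigma00.intros)

lemma delta_pred_lt [delta_intros]: "delta_fun f \<Longrightarrow> delta_fun g \<Longrightarrow> delta_pred (\<lambda>x. f x \<prec> g x)"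
  by (rule delta_pred_rel[of "Var 4 \<^bold>< Var 5" "(\<prec>)"]) (auto simp: sigma00.intros)

lemma delta_pred_le [delta_intros]: "delta_fun f \<Longrightarrow> delta_fun g \<Longrightarrow> delta_pred (\<lambda>x. f x \<preceq> g x)"
  unfolding le_def by (intro delta_intros)

lemma delta_pred_bex_lt [delta_intros]:
  assumes "delta_fun t" "delta_pred (\<lambda>z. P (proj1 z) (proj2 z))"
  shows "delta_pred (\<lambda>x. \<exists>y. y \<prec> t x \<and> P x y)"
proof -
  have "delta_pred (\<lambda>x. \<exists>y. y \<preceq> t x \<and> (y \<prec> t x \<and> P x y))"
    by (intro delta_intros assms delta_fun_comp[OF assms(1)])
  then show ?thesis
    by (rule back_subst[of delta_pred]) (auto simp: le_def)
qed

lemma delta_pred_ball_lt [delta_intros]: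
  assumes "delta_fun t" "delta_pred (\<lambda>z. P (proj1 z) (proj2 z))" shows "delta_pred (\<lambda>x. \<forall>y. y \<prec> t x \<longrightarrow> P x y)"
proof -
  have "delta_pred (\<lambda>x. \<not> (\<exists>y. y \<prec> t x \<and> \<not> P x y))"
    using assms by (intro delta_pred_not delta_pred_bex_lt)
  then show ?thesis
    by simp
qed

lemma delta_pred_ball_le [delta_intros]:
  assumes "delta_fun t" "delta_pred (\<lambda>z. P (proj1 z) (proj2 z))" shows "delta_pred (\<lambda>x. \<forall>y. y \<preceq> t x \<longrightarrow> P x y)"
proof -
  have "delta_pred (\<lambda>x. \<not> (\<exists>y. y \<preceq> t x \<and> \<not> P x y))"
    using assms by (intro delta_pred_not delta_pred_bex_le)
  then show ?thesis
    by simp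
qed

lemma delta_pred_comp2:
  assumes "delta_pred (\<lambda>z. P (proj1 z) (proj2 z))" "delta_fun f" "delta_fun g" shows "delta_pred (\<lambda>x. P (f x) (g x))"
  using delta_pred_comp[OF assms(1) delta_fun_pair[OF assms(2,3)]] by simp

lemma delta_fun_comp2:
  assumes "delta_fun (\<lambda>z. h (proj1 z) (proj2 z))" "delta_fun f" "delta_fun g" shows "delta_fun (\<lambda>x. h (f x) (g x))"
  using delta_fun_comp[OF assms(1) delta_fun_pair[OF assms(2,3)]] by simp

text \<open>Numbers that are not codes of pairs have projections too and must be cut out of the
  graph.\<close>

lemma delta_fun_graph: "delta_pred (\<lambda>z. proj2 z = f (proj1 z)) \<Longrightarrow> delta_fun f"
proof -
  assume "delta_pred (\<lambda>z. proj2 z = f (proj1 z))"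
  moreover have "delta_pred (\<lambda>z. z = \<langle>proj1 z, proj2 z\<rangle>)"
    by (intro delta_intros)
  ultimately have "delta_pred (\<lambda>z. z = \<langle>proj1 z, proj2 z\<rangle> \<and> proj2 z = f (proj1 z))"
    using delta_pred_conj by blast
  then show ?thesis
    unfolding delta_fun_def delta_pred_def[symmetric] by (rule back_subst[of delta_pred]) (metis proj1_pair proj2_pair)
qed

lemma delta_fun_if [delta_intros]:
  assumes "delta_pred P" "delta_fun f" "delta_fun g" shows "delta_fun (\<lambda>x. if P x then f x else g x)"
proof (rule delta_fun_graph)
  have "delta_pred (\<lambda>z. (P (proj1 z) \<longrightarrow> proj2 z = f (proj1 z)) \<and> (\<not> P (proj1 z) \<longrightarrow> proj2 z = g (proj1 z)))"
    by (intro delta_intros delta_pred_comp[OF assms(1)] delta_fun_comp[OF assms(2)] delta_fun_comp[OF assms(3)])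
  then show "delta_pred (\<lambda>z. proj2 z = (if P (proj1 z) then f (proj1 z) else g (proj1 z)))"
    by (rule back_subst[of delta_pred]) (rule ext, auto)
qed

text \<open>Induction without formulas: the relation enters as a set of codes of pairs, so one
  atomic formula covers all instances.\<close>

lemma sigma_induct [case_names definable zero step]:
  assumes "delta_pred (\<lambda>z. R (proj1 z) (proj2 z))" and "\<exists>y. R \<zero> y"
    and "\<And>x y. R x y \<Longrightarrow> \<exists>y'. R (x \<oplus> \<one>) y'"
  shows "\<exists>y. R x y"
proof -
  have "range (\<lambda>_. {z. R (proj1 z) (proj2 z)}) \<subseteq> Sets M"
    using assms(1) by (auto simp: delta_pred_def)
  from sigma01_induction[OF this, of "pair (Var 0) (Var 1) \<^bold>\<in> 0"] assms(2,3) show ?thesis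
    by (simp add: sigma00.intros)
qed

lemma delta_induct [case_names definable zero step]:
  assumes "delta_pred P" and "P \<zero>" and "\<And>x. P x \<Longrightarrow> P (x \<oplus> \<one>)"
  shows "P x"
  using sigma_induct[of "\<lambda>x y. P x" x] delta_pred_comp[OF assms(1) delta_fun_proj1'] assms by blast

text \<open>If no element of \<open>P\<close> were least, induction on \<open>x\<close> would show
  that \<open>P\<close> fails everywhere up to \<open>x\<close>.\<close>

lemma delta_least:
  assumes "delta_pred P" "P x"
  obtains y where "P y" "\<And>w. w \<prec> y \<Longrightarrow> \<not> P w"
proof (rule ccontr)
  assume "\<not> thesis"
  then have no: "P y \<Longrightarrow> \<exists>w. w \<prec> y \<and> P w" for y
    using that by blast
  have "\<forall>w. w \<preceq> x \<longrightarrow> \<not> P w" for x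
  proof (induct x rule: delta_induct)
    case definable
    show ?case
      by (intro delta_intros delta_pred_comp[OF assms(1)])
  next
    case zero
    then show ?case
      using no[of \<zero>] by (auto simp: le_def)
  next
    case (step x)
    then show ?case
      using no by (metis le_def lt_add_one_iff)
  qed
  then show False
    using assms(2) le_def by blast
qed

text \<open>Replaces choice: being the least witness is decidable by bounded search, so the choice
  function is definable.\<close>

lemma minimisation:
  assumes R: "delta_pred (\<lambda>z. R (proj1 z) (proj2 z))" and ex: "\<And>x. \<exists>y. R x y"
  obtains f where "delta_fun f" "\<And>x. R x (f x)" "\<And>x w. R x w \<Longrightarrow> f x \<preceq> w"
proof -
  have "\<exists>y. R x y \<and> (\<forall>w. w \<prec> y \<longrightarrow> \<not> R x w)" for x
    using delta_least[OF delta_pred_comp2[OF R delta_fun_const delta_fun_id]] ex by metis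
  then obtain f where f: "\<And>x. R x (f x)" "\<And>x w. w \<prec> f x \<Longrightarrow> \<not> R x w"
    by metis
  have "delta_pred (\<lambda>z. R (proj1 z) (proj2 z) \<and> (\<forall>w. w \<prec> proj2 z \<longrightarrow> \<not> R (proj1 z) w))"
    by (intro delta_intros delta_pred_comp2[OF R])
  moreover have "proj2 z = f (proj1 z) \<longleftrightarrow> R (proj1 z) (proj2 z) \<and> (\<forall>w. w \<prec> proj2 z \<longrightarrow> \<not> R (proj1 z) w)" for z
    using f by (metis lt_linear)
  ultimately have "delta_fun f"
    by (intro delta_fun_graph) simp
  with f that show ?thesis
    using arith.not_less by blast
qed

section \<open>Division and the beta function\<close>

lemma lt_imp_le: "x \<prec> y \<Longrightarrow> x \<preceq> y"
  by (simp add: le_def)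

lemma lt_le_trans: "x \<prec> y \<Longrightarrow> y \<preceq> z \<Longrightarrow> x \<prec> z"
  and le_lt_trans: "x \<preceq> y \<Longrightarrow> y \<prec> z \<Longrightarrow> x \<prec> z"
  unfolding le_def using lt_trans by blast+

lemma pos_iff: "\<zero> \<prec> x \<longleftrightarrow> x \<noteq> \<zero>"
  using zero_le[of x] le_def lt_irrefl by metis

lemma add_one_le_iff: "x \<oplus> \<one> \<preceq> y \<longleftrightarrow> x \<prec> y"
  by (rule arith.less_iff_succ_less_eq[symmetric])

text \<open>The bounds on \<open>q\<close> and \<open>r\<close> keep the claim decidable, so that
  \<open>delta_induct\<close> applies.\<close>

lemma division_ex: "m \<noteq> \<zero> \<Longrightarrow> \<exists>q. q \<preceq> n \<and> (\<exists>r. r \<prec> m \<and> n = q \<otimes> m \<oplus> r)"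
proof (induct n rule: delta_induct)
  case definable
  show ?case
    by (intro delta_intros)
next
  case zero
  then show ?case
    by (auto intro!: exI[of _ \<zero>] simp: pos_iff)
next
  case (step n)
  then obtain q r where *: "q \<preceq> n" "r \<prec> m" "n = q \<otimes> m \<oplus> r"
    by blast
  show ?case
  proof (cases "r \<oplus> \<one> = m")
    case True
    then have "n \<oplus> \<one> = (q \<oplus> \<one>) \<otimes> m \<oplus> \<zero>"
      using * by (auto simp: algebra_simps)
    moreover have "\<zero> \<prec> m"
      using step pos_iff by metis
    ultimately show ?thesis
      using *(1) arith.add_right_mono by blast
  next
    case False
    then have "r \<oplus> \<one> \<prec> m"
      using *(2) add_one_le_iff le_def by blast
    moreover have "n \<oplus> \<one> = q \<otimes> m \<oplus> (r \<oplus> \<one>)"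
      using *(3) by (simp add: algebra_simps)
    moreover have "q \<preceq> n \<oplus> \<one>"
      using *(1) lt_add_one_le lt_imp_le by blast
    ultimately show ?thesis
      by blast
  qed
qed

lemma division_less:
  assumes "q \<prec> q'" "r \<prec> m"
  shows "q \<otimes> m \<oplus> r \<prec> q' \<otimes> m \<oplus> r'"
proof -
  have "q \<otimes> m \<oplus> r \<prec> (q \<oplus> \<one>) \<otimes> m"
    using assms(2) by (simp add: algebra_simps)
  also have "(q \<oplus> \<one>) \<otimes> m \<preceq> q' \<otimes> m"
    using assms(1) add_one_le_iff arith.mult_right_mono by simp
  finally show ?thesis
    using lt_le_trans le_iff_add by blast
qed

text \<open>With quotient zero for the divisor zero, \<open>quo_rem\<close> holds without side
  condition.\<close>

definition quo :: "'a \<Rightarrow> 'a \<Rightarrow> 'a" where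
  "quo n m = (if m = \<zero> then \<zero> else SOME q. q \<preceq> n \<and> (\<exists>r. r \<prec> m \<and> n = q \<otimes> m \<oplus> r))"

definition rem :: "'a \<Rightarrow> 'a \<Rightarrow> 'a" where
  "rem n m = n \<ominus> quo n m \<otimes> m"

lemma quo_rem: "quo n m \<otimes> m \<oplus> rem n m = n" (is ?eq) and rem_less: "m \<noteq> \<zero> \<Longrightarrow> rem n m \<prec> m"
proof -
  have "?eq \<and> (m \<noteq> \<zero> \<longrightarrow> rem n m \<prec> m)"
  proof (cases "m = \<zero>")
    case False
    then obtain r where "r \<prec> m" "n = quo n m \<otimes> m \<oplus> r"
      using someI_ex[OF division_ex[OF False, of n]] unfolding quo_def by auto
    then show ?thesis
      unfolding rem_def by (metis add_diff)
  qed (simp add: quo_def rem_def)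
  then show ?eq "m \<noteq> \<zero> \<Longrightarrow> rem n m \<prec> m"
    by auto
qed

lemma quo_rem_unique:
  assumes "n = q \<otimes> m \<oplus> r" "r \<prec> m"
  shows "quo n m = q" "rem n m = r"
proof -
  have "rem n m \<prec> m"
    using assms(2) not_lt_zero rem_less by metis
  then show "quo n m = q"
    using quo_rem[of n m] division_less assms lt_linear lt_irrefl by metis
  then show "rem n m = r"
    using assms(1) add_diff by (simp add: rem_def)
qed

text \<open>A quantifier-free description of the graph, from which the definability of quotients
  follows.\<close>

lemma quo_eq_iff: "y = quo n m \<longleftrightarrow>
    m = \<zero> \<and> y = \<zero> \<or> m \<noteq> \<zero> \<and> y \<otimes> m \<preceq> n \<and> n \<prec> (y \<oplus> \<one>) \<otimes> m"
proof (cases "m = \<zero>")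
  case False
  have "y = quo n m" if bounds: "y \<otimes> m \<preceq> n" "n \<prec> (y \<oplus> \<one>) \<otimes> m"
  proof -
    obtain r where r: "n = y \<otimes> m \<oplus> r"
      using bounds(1) unfolding le_iff_add by blast
    then have "r \<prec> m"
      using bounds(2) by (simp add: algebra_simps)
    with r show ?thesis
      using quo_rem_unique by metis
  qed
  moreover have "quo n m \<otimes> m \<preceq> n"
    using quo_rem le_iff_add by metis
  moreover have "n \<prec> (quo n m \<oplus> \<one>) \<otimes> m"
    using division_less[of "quo n m" "quo n m \<oplus> \<one>" "rem n m" m \<zero>] quo_rem[of n m] rem_less[OF False]
    by (simp add: lt_add_one_iff)
  ultimately show ?thesis
    using False by blast
qed (simp add: quo_def)

lemma delta_fun_quo [delta_intros]:
  assumes "delta_fun f" "delta_fun g" shows "delta_fun (\<lambda>x. quo (f x) (g x))"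
proof -
  have "delta_fun (\<lambda>z. quo (proj1 z) (proj2 z))"
    by (rule delta_fun_graph, unfold quo_eq_iff) (intro delta_intros)
  then show ?thesis
    using assms by (rule delta_fun_comp2)
qed

lemma delta_fun_rem [delta_intros]: "delta_fun f \<Longrightarrow> delta_fun g \<Longrightarrow> delta_fun (\<lambda>x. rem (f x) (g x))"
  unfolding rem_def by (intro delta_intros)

lemma rem_add_mult [simp]: "rem (q \<otimes> m \<oplus> n) m = rem n m"
  and quo_add_mult: "m \<noteq> \<zero> \<Longrightarrow> quo (q \<otimes> m \<oplus> n) m = q \<oplus> quo n m"
proof -
  have *: "quo (q \<otimes> m \<oplus> n) m = q \<oplus> quo n m \<and> rem (q \<otimes> m \<oplus> n) m = rem n m" if "m \<noteq> \<zero>"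
  proof -
    have "q \<otimes> m \<oplus> n = q \<otimes> m \<oplus> (quo n m \<otimes> m \<oplus> rem n m)"
      by (simp add: quo_rem)
    then have "q \<otimes> m \<oplus> n = (q \<oplus> quo n m) \<otimes> m \<oplus> rem n m"
      by (simp add: algebra_simps)
    then show ?thesis
      using quo_rem_unique rem_less[OF that] by blast
  qed
  then show "rem (q \<otimes> m \<oplus> n) m = rem n m" "m \<noteq> \<zero> \<Longrightarrow> quo (q \<otimes> m \<oplus> n) m = q \<oplus> quo n m"
    by (cases "m = \<zero>") (simp_all add: *)
qed

lemma rem_small [simp]: "n \<prec> m \<Longrightarrow> rem n m = n" and quo_small [simp]: "n \<prec> m \<Longrightarrow> quo n m = \<zero>"
  using quo_rem_unique[of n \<zero> m n] by auto

text \<open>Congruence with multiples of \<open>m\<close> added on both sides, which avoids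
  subtraction.\<close>

lemma rem_cong:
  assumes "x \<oplus> v \<otimes> m = w \<otimes> m \<oplus> y"
  shows "rem x m = rem y m"
  using rem_add_mult[of v m x] rem_add_mult[of w m y] assms by (simp add: add_commute)

section \<open>Goedel's beta function and Chinese remaindering\<close>

definition modulus :: "'a \<Rightarrow> 'a \<Rightarrow> 'a" where
  "modulus d i = \<one> \<oplus> (i \<oplus> \<one>) \<otimes> d"

definition entry_at :: "'a \<Rightarrow> 'a \<Rightarrow> 'a" where
  "entry_at w i = rem (proj1 w) (modulus (proj2 w) i)"

lemma delta_fun_modulus [delta_intros]: "delta_fun f \<Longrightarrow> delta_fun g \<Longrightarrow> delta_fun (\<lambda>x. modulus (f x) (g x))"
  unfolding modulus_def by (intro delta_intros)

lemma delta_fun_entry_at [delta_intros]: "delta_fun f \<Longrightarrow> delta_fun g \<Longrightarrow> delta_fun (\<lambda>x. entry_at (f x) (g x))"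
  unfolding entry_at_def by (intro delta_intros)

lemma modulus_nonzero [simp]: "modulus d i \<noteq> \<zero>"
  unfolding modulus_def using add_one_nonzero add_commute by metis

text \<open>Replaces the relational entries of the formal sentence by the total function
  \<open>entry_at\<close>, so that the formal notions can be unfolded by rewriting.\<close>

lemma Entry_iff: "Entry M c d i y \<longleftrightarrow> y = entry_at \<langle>c, d\<rangle> i"
proof -
  have "Entry M c d i y \<longleftrightarrow> y \<prec> modulus d i \<and> (\<exists>q. c = q \<otimes> modulus d i \<oplus> y)"
    by (simp add: Entry_def modulus_def Let_def)
  also have "\<dots> \<longleftrightarrow> y = rem c (modulus d i)"
  proof
    assume "y \<prec> modulus d i \<and> (\<exists>q. c = q \<otimes> modulus d i \<oplus> y)"
    then obtain q where "y \<prec> modulus d i" "c = q \<otimes> modulus d i \<oplus> y"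
      by blast
    then show "y = rem c (modulus d i)"
      using quo_rem_unique(2) by simp
  next
    assume "y = rem c (modulus d i)"
    then show "y \<prec> modulus d i \<and> (\<exists>q. c = q \<otimes> modulus d i \<oplus> y)"
      using quo_rem[of c "modulus d i"] rem_less[of "modulus d i" c] by (auto intro: sym)
  qed
  finally show ?thesis
    by (simp add: entry_at_def)
qed

text \<open>Coprimality expressed through an inverse. The bound on \<open>u\<close> keeps it
  decidable, and \<open>rem \<one> m\<close> in place of \<open>\<one>\<close> covers the modulus
  one.\<close>

definition inv_mod :: "'a \<Rightarrow> 'a \<Rightarrow> bool" where
  "inv_mod x m \<longleftrightarrow> (\<exists>u. u \<prec> m \<and> rem (u \<otimes> x) m = rem \<one> m)"

lemma delta_pred_inv_mod [delta_intros]: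
  assumes "delta_fun f" "delta_fun g" shows "delta_pred (\<lambda>x. inv_mod (f x) (g x))"
  unfolding inv_mod_def by (intro delta_intros delta_fun_comp[OF assms(1)] delta_fun_comp[OF assms(2)])

lemma rem_mult_rem: "rem (rem u m \<otimes> x) m = rem (u \<otimes> x) m"
proof -
  have "u \<otimes> x = (quo u m \<otimes> m \<oplus> rem u m) \<otimes> x"
    by (simp add: quo_rem)
  then have "u \<otimes> x = (quo u m \<otimes> x) \<otimes> m \<oplus> rem u m \<otimes> x"
    by (simp add: algebra_simps)
  then show ?thesis
    by simp
qed

lemma inv_modI: "rem (u \<otimes> x) m = rem \<one> m \<Longrightarrow> m \<noteq> \<zero> \<Longrightarrow> inv_mod x m"
  unfolding inv_mod_def by (rule exI[of _ "rem u m"]) (simp add: rem_mult_rem rem_less)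

lemma inv_mod_one: "m \<noteq> \<zero> \<Longrightarrow> inv_mod \<one> m"
  by (rule inv_modI[of \<one>]) auto

lemma inv_mod_mult:
  assumes "inv_mod x m" "inv_mod y m" "m \<noteq> \<zero>"
  shows "inv_mod (x \<otimes> y) m"
proof -
  obtain u v where uv: "rem (u \<otimes> x) m = rem \<one> m" "rem (v \<otimes> y) m = rem \<one> m"
    using assms(1,2) inv_mod_def by auto
  have "rem (u \<otimes> v \<otimes> (x \<otimes> y)) m = rem ((u \<otimes> x) \<otimes> (v \<otimes> y)) m"
    by (simp add: algebra_simps)
  also have "\<dots> = rem (rem (u \<otimes> x) m \<otimes> (v \<otimes> y)) m"
    by (simp add: rem_mult_rem)
  also have "\<dots> = rem (v \<otimes> y) m"
    using uv(1) rem_mult_rem[of \<one> m] by simp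
  finally show ?thesis
    using uv(2) assms(3) inv_modI by metis
qed

text \<open>With \<open>d = e q\<close>, the larger modulus \<open>m = T + 1\<close>, \<open>T = (i + e + 1) d\<close>, exceeds the smaller one by
  \<open>e d\<close>, and \<open>(i + e + 1)\<^sup>2 q e d = T\<^sup>2 \<equiv> 1\<close> modulo \<open>m\<close>.\<close>

lemma modulus_coprime:
  assumes "d = e \<otimes> q"
  shows "inv_mod (modulus d i) (modulus d (i \<oplus> e))"
proof -
  define T where "T = (i \<oplus> e \<oplus> \<one>) \<otimes> d"
  define X where "X = (i \<oplus> e \<oplus> \<one>) \<otimes> (i \<oplus> e \<oplus> \<one>) \<otimes> q"
  let ?m = "modulus d i" and ?m' = "modulus d (i \<oplus> e)"
  have m': "?m' = \<one> \<oplus> T"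
    by (simp add: modulus_def T_def)
  have "?m' = ?m \<oplus> e \<otimes> d"
    by (simp add: modulus_def algebra_simps)
  then have "X \<otimes> ?m' = X \<otimes> ?m \<oplus> X \<otimes> (e \<otimes> d)"
    by (simp add: mul_distrib_right)
  moreover have "X \<otimes> (e \<otimes> d) = T \<otimes> T"
    by (simp add: X_def T_def assms arith.mult.assoc arith.mult.commute arith.mult.left_commute)
  ultimately have *: "X \<otimes> ?m' = X \<otimes> ?m \<oplus> T \<otimes> T"
    by simp
  \<comment> \<open>Modulo the larger modulus \<open>T\<close> is congruent to -1, and so is
    \<open>X\<close> times the smaller modulus; hence \<open>T \<otimes> X\<close> is the inverse.
    The identity says this without subtraction.\<close>
  have "T \<otimes> X \<otimes> ?m \<oplus> (T \<otimes> T \<oplus> \<one>) \<otimes> ?m' = T \<otimes> (X \<otimes> ?m \<oplus> T \<otimes> T) \<oplus> T \<otimes> ?m' \<oplus> \<one>"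
    unfolding m' by (simp add: algebra_simps)
  also have "\<dots> = (T \<otimes> X \<oplus> T) \<otimes> ?m' \<oplus> \<one>"
    unfolding *[symmetric] by (simp add: algebra_simps)
  finally show ?thesis
    using inv_modI[OF rem_cong] modulus_nonzero by blast
qed

lemma bounded_below:
  assumes "delta_fun g" shows "\<exists>b. \<forall>i. i \<prec> j \<longrightarrow> g i \<preceq> b"
proof (induct j rule: sigma_induct)
  case definable
  show ?case
    by (intro delta_intros delta_fun_comp[OF assms])
next
  case (step j b)
  then have "\<forall>i. i \<prec> j \<oplus> \<one> \<longrightarrow> g i \<preceq> b \<oplus> g j"
    by (metis lt_add_one_iff le_iff_add arith.order_trans add_commute)
  then show ?case
    by blast
qed auto

text \<open>Takes the place of the factorial of \<open>j\<close>: each step multiplies by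
  \<open>j \<oplus> \<one>\<close>. The bound on \<open>k\<close> keeps the matrix
  decidable.\<close>

lemma common_multiple: "\<exists>d. d \<noteq> \<zero> \<and> (\<forall>i. i \<prec> j \<longrightarrow> (\<exists>k. k \<preceq> d \<and> d = (i \<oplus> \<one>) \<otimes> k))"
proof (induct j rule: sigma_induct)
  case definable
  show ?case
    by (intro delta_intros)
next
  case zero
  show ?case
    by (auto intro!: exI[of _ \<one>])
next
  case (step j d)
  have "\<exists>k. k \<preceq> d \<otimes> (j \<oplus> \<one>) \<and> d \<otimes> (j \<oplus> \<one>) = (i \<oplus> \<one>) \<otimes> k" if "i \<prec> j \<oplus> \<one>" for i
  proof (cases "i = j")
    case True
    have "d \<preceq> d \<otimes> (j \<oplus> \<one>)"
      by (auto simp: mul_Suc_right le_iff_add arith.add.commute)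
    with True show ?thesis
      by (auto simp: mul_commute)
  next
    case False
    then have "\<exists>k. k \<preceq> d \<and> d = (i \<oplus> \<one>) \<otimes> k"
      using that step by (simp add: lt_add_one_iff)
    then obtain k where k: "d = (i \<oplus> \<one>) \<otimes> k"
      by blast
    then have "d \<otimes> (j \<oplus> \<one>) = (i \<oplus> \<one>) \<otimes> (k \<otimes> (j \<oplus> \<one>))"
      by (simp add: mul_assoc)
    moreover have "k \<otimes> (j \<oplus> \<one>) \<preceq> (i \<oplus> \<one>) \<otimes> (k \<otimes> (j \<oplus> \<one>))"
      unfolding mul_commute[of "i \<oplus> \<one>"] mul_Suc_right le_iff_add using add_commute by blast
    ultimately show ?thesis
      by metis
  qed
  then show ?case
    using step by (intro exI[of _ "d \<otimes> (j \<oplus> \<one>)"]) auto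
qed

lemma rem_add_rem: "rem (c \<oplus> rem x m) m = rem (c \<oplus> x) m"
proof -
  have "c \<oplus> x = c \<oplus> (quo x m \<otimes> m \<oplus> rem x m)"
    by (simp only: quo_rem)
  also have "\<dots> = quo x m \<otimes> m \<oplus> (c \<oplus> rem x m)"
    by (rule arith.add.left_commute)
  finally show ?thesis
    by simp
qed

lemma beta_step:
  assumes "inv_mod P m" "y \<prec> m"
  shows "\<exists>k. rem (c \<oplus> k \<otimes> P) m = y"
proof -
  have m: "m \<noteq> \<zero>"
    using assms(2) by auto
  obtain u where u: "rem (u \<otimes> P) m = rem \<one> m"
    using assms(1) inv_mod_def by auto
  obtain T where T: "m = T \<oplus> \<one>"
    using m zero_or_add_one by blast
  \<comment> \<open>\<open>T\<close> is congruent to -1, so \<open>y \<oplus> T \<otimes> c\<close>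
    stands for the difference of \<open>y\<close> and \<open>c\<close>, and the factor
    \<open>u\<close> inverts \<open>P\<close>.\<close>
  have "rem (c \<oplus> (y \<oplus> T \<otimes> c) \<otimes> u \<otimes> P) m = rem (c \<oplus> rem ((u \<otimes> P) \<otimes> (y \<oplus> T \<otimes> c)) m) m"
    unfolding rem_add_rem by (simp only: arith.mult.assoc arith.mult.commute arith.mult.left_commute)
  also have "rem ((u \<otimes> P) \<otimes> (y \<oplus> T \<otimes> c)) m = rem (y \<oplus> T \<otimes> c) m"
    using rem_mult_rem[of "u \<otimes> P" m] rem_mult_rem[of \<one> m] u by simp
  also have "rem (c \<oplus> rem (y \<oplus> T \<otimes> c) m) m = rem (c \<oplus> (y \<oplus> T \<otimes> c)) m"
    by (rule rem_add_rem)
  also have "c \<oplus> (y \<oplus> T \<otimes> c) = c \<otimes> m \<oplus> y"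
    by (simp add: T algebra_simps)
  finally show ?thesis
    using assms(2) rem_small by auto
qed

text \<open>Chinese remaindering in stages: \<open>proj1 w\<close> is the solution so far and
  \<open>proj2 w\<close> the product of the moduli treated. Adding a multiple of the product
  preserves the earlier remainders, and its invertibility modulo the next modulus allows the next
  remainder to be adjusted.\<close>

lemma beta_aux:
  assumes "delta_fun g" and small: "\<And>i. i \<prec> j \<Longrightarrow> g i \<prec> modulus d i"
    and d: "\<And>i. i \<prec> j \<Longrightarrow> \<exists>k. d = (i \<oplus> \<one>) \<otimes> k"
  shows "\<exists>w. n \<preceq> j \<longrightarrow> (\<forall>i. i \<prec> n \<longrightarrow> rem (proj1 w) (modulus d i) = g i) \<and>
    (\<forall>i. i \<prec> n \<longrightarrow> rem (proj2 w) (modulus d i) = \<zero>) \<and>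
    (\<forall>i. i \<prec> j \<longrightarrow> n \<preceq> i \<longrightarrow> inv_mod (proj2 w) (modulus d i))"
proof (induct n rule: sigma_induct)
  case definable
  show ?case
    by (intro delta_intros delta_fun_comp[OF assms(1)])
next
  case zero
  show ?case
    by (rule exI[of _ "\<langle>\<zero>, \<one>\<rangle>"]) (auto simp: inv_mod_one)
next
  case (step n w)
  let ?m = "modulus d"
  show ?case
  proof (cases "n \<prec> j")
    case False
    then have "\<not> n \<oplus> \<one> \<preceq> j"
      by (simp add: add_one_le_iff)
    then show ?thesis
      by blast
  next
    case True
    then have IH: "\<And>i. i \<prec> n \<Longrightarrow> rem (proj1 w) (?m i) = g i" "\<And>i. i \<prec> n \<Longrightarrow> rem (proj2 w) (?m i) = \<zero>"
        "\<And>i. i \<prec> j \<Longrightarrow> n \<preceq> i \<Longrightarrow> inv_mod (proj2 w) (?m i)"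
      using step lt_imp_le by blast+
    obtain k where k: "rem (proj1 w \<oplus> k \<otimes> proj2 w) (?m n) = g n"
      using beta_step IH(3)[OF True] small[OF True] by blast
    let ?w = "\<langle>proj1 w \<oplus> k \<otimes> proj2 w, proj2 w \<otimes> ?m n\<rangle>"
    have "rem (proj1 w \<oplus> k \<otimes> proj2 w) (?m i) = g i" if "i \<prec> n" for i
    proof -
      have "proj1 w \<oplus> k \<otimes> proj2 w = k \<otimes> quo (proj2 w) (?m i) \<otimes> ?m i \<oplus> proj1 w"
        using quo_rem[of "proj2 w" "?m i"] IH(2)[OF that]
        by (metis add_commute add_zero_right mul_assoc)
      then show ?thesis
        using IH(1)[OF that] by simp
    qed
    then have 1: "rem (proj1 ?w) (?m i) = g i" if "i \<prec> n \<oplus> \<one>" for i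
      using k that by (auto simp: lt_add_one_iff)
    have "rem (proj2 w \<otimes> ?m n) (?m i) = \<zero>" if "i \<prec> n" for i
      using rem_mult_rem[of "proj2 w" "?m i" "?m n"] IH(2)[OF that] pos_iff by simp
    moreover have "rem (proj2 w \<otimes> ?m n) (?m n) = \<zero>"
      using rem_add_mult[of "proj2 w" "?m n" \<zero>] pos_iff by simp
    ultimately have 2: "rem (proj2 ?w) (?m i) = \<zero>" if "i \<prec> n \<oplus> \<one>" for i
      using that by (auto simp: lt_add_one_iff)
    have 3: "inv_mod (proj2 ?w) (?m i)" if i: "i \<prec> j" "n \<oplus> \<one> \<preceq> i" for i
    proof -
      have "n \<prec> i"
        using i(2) by (simp add: add_one_le_iff)
      then obtain e where e: "i = n \<oplus> (e \<oplus> \<one>)"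
        using lt_iff by blast
      \<comment> \<open>The two indices differ by \<open>e \<oplus> \<one>\<close>; the hypothesis
        on \<open>d\<close> makes this a divisor of \<open>d\<close>, as
        \<open>modulus_coprime\<close> requires.\<close>
      have "e \<prec> j"
        using i(1) e lt_addI[of e n] lt_trans[of e i j] by (simp add: arith.add.commute arith.add.left_commute)
      then obtain q where "d = (e \<oplus> \<one>) \<otimes> q"
        using d by blast
      then have "inv_mod (?m n) (?m i)"
        unfolding e by (rule modulus_coprime)
      then show ?thesis
        using IH(3)[OF i(1)] \<open>n \<prec> i\<close> lt_imp_le inv_mod_mult by simp
    qed
    from 1 2 3 show ?thesis
      by (intro exI[of _ ?w]) simp
  qed
qed

lemma beta:
  assumes "delta_fun g" obtains w where "\<And>i. i \<prec> j \<Longrightarrow> entry_at w i = g i"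
proof -
  obtain b where b: "\<And>i. i \<prec> j \<Longrightarrow> g i \<preceq> b"
    using bounded_below[OF assms] by blast
  obtain d where d: "d \<noteq> \<zero>" "\<And>i. i \<prec> j \<Longrightarrow> \<exists>k. d = (i \<oplus> \<one>) \<otimes> k"
    using common_multiple[of j] by blast
  \<comment> \<open>The factor \<open>b \<oplus> \<one>\<close> makes every modulus exceed all
    values and preserves the divisibility properties of \<open>d\<close>.\<close>
  let ?d = "d \<otimes> (b \<oplus> \<one>)"
  have "b \<oplus> \<one> \<preceq> ?d"
    using d(1) arith.mult_right_mono[of \<one> d "b \<oplus> \<one>"] pos_iff[of d] arith.less_iff_succ_less_eq[of \<zero> d] by simp
  then have "b \<prec> ?d"
    by (simp only: add_one_le_iff)
  have "g i \<prec> modulus ?d i" if "i \<prec> j" for i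
  proof -
    have "?d \<preceq> modulus ?d i"
      unfolding modulus_def le_iff_add
      by (rule exI[of _ "\<one> \<oplus> i \<otimes> ?d"]) (simp add: mul_distrib_left arith.add.left_commute arith.add.commute)
    then show ?thesis
      using b[OF that] \<open>b \<prec> ?d\<close> le_lt_trans lt_le_trans by metis
  qed
  moreover have "\<exists>k. ?d = (i \<oplus> \<one>) \<otimes> k" if "i \<prec> j" for i
    using d(2)[OF that] by (metis mul_assoc)
  ultimately obtain w where "\<And>i. i \<prec> j \<Longrightarrow> rem (proj1 w) (modulus ?d i) = g i"
    using beta_aux[OF assms, of j ?d j] by auto
  then show thesis
    using that[of "\<langle>proj1 w, ?d\<rangle>"] by (simp add: entry_at_def)
qed

section \<open>Primitive recursion, sums and powers of two\<close>

lemma delta_fun_comp3: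
  assumes "delta_fun (\<lambda>z. G (proj1 (proj1 z)) (proj2 (proj1 z)) (proj2 z))" "delta_fun a" "delta_fun b" "delta_fun c"
  shows "delta_fun (\<lambda>x. G (a x) (b x) (c x))"
  using delta_fun_comp[OF assms(1) delta_fun_pair[OF delta_fun_pair[OF assms(2,3)] assms(4)]] by simp

text \<open>\<open>R p n w\<close> says that \<open>w\<close> codes the course of values up to
  \<open>n\<close>. Such codes exist by induction on \<open>n\<close>, one is selected by
  \<open>minimisation\<close>, and the value is read off from it.\<close>

lemma primitive_recursion:
  assumes s: "delta_fun s" and G: "delta_fun (\<lambda>z. G (proj1 (proj1 z)) (proj2 (proj1 z)) (proj2 z))"
  obtains f where "delta_fun (\<lambda>z. f (proj1 z) (proj2 z))" "\<And>p. f p \<zero> = s p" "\<And>p i. f p (i \<oplus> \<one>) = G p i (f p i)"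
proof -
  define R where "R p n w \<longleftrightarrow> entry_at w \<zero> = s p \<and>
    (\<forall>i. i \<prec> n \<longrightarrow> entry_at w (i \<oplus> \<one>) = G p i (entry_at w i))" for p n w
  have ex: "\<exists>w. R p n w" for p n
  proof (induct n rule: sigma_induct)
    case definable
    show ?case
      unfolding R_def by (intro delta_intros delta_fun_comp3[OF G])
  next
    case zero
    obtain w where "\<And>i. i \<prec> \<one> \<Longrightarrow> entry_at w i = s p"
      using beta[OF delta_fun_const] by metis
    then have "R p \<zero> w"
      by (simp add: R_def)
    then show ?case
      by blast
  next
    case (step n w)
    \<comment> \<open>The old list with one value appended; the beta function recodes it as a
      whole.\<close>
    define g where "g i = (if i \<preceq> n then entry_at w i else G p n (entry_at w n))" for i
    have "delta_fun g"
      unfolding g_def by (intro delta_intros)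
    then obtain w' where w': "\<And>i. i \<prec> n \<oplus> \<one> \<oplus> \<one> \<Longrightarrow> entry_at w' i = g i"
      using beta by metis
    have old: "entry_at w' i = entry_at w i" if "i \<preceq> n" for i
      using that w'[of i] lt_imp_le[of i "n \<oplus> \<one>"] by (simp add: g_def lt_add_one_le)
    have new: "entry_at w' (n \<oplus> \<one>) = G p n (entry_at w n)"
      using w'[of "n \<oplus> \<one>"] by (simp add: g_def lt_add_one_le add_one_le_iff)
    have "R p (n \<oplus> \<one>) w'"
      unfolding R_def
    proof (intro conjI allI impI)
      show "entry_at w' \<zero> = s p"
        using step old by (simp add: R_def)
      fix i assume "i \<prec> n \<oplus> \<one>"
      then consider "i = n" | "i \<prec> n"
        using lt_add_one_iff by blast
      then show "entry_at w' (i \<oplus> \<one>) = G p i (entry_at w' i)"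
      proof cases
        case 1
        then show ?thesis
          using old[of n] new by simp
      next
        case 2
        then show ?thesis
          using old[of i] old[of "i \<oplus> \<one>"] step by (simp add: add_one_le_iff R_def lt_imp_le)
      qed
    qed
    then show ?case
      by blast
  qed
  have "delta_pred (\<lambda>z. R (proj1 (proj1 z)) (proj2 (proj1 z)) (proj2 z))"
    unfolding R_def by (intro delta_intros delta_fun_comp[OF s] delta_fun_comp3[OF G])
  from minimisation[OF this] ex obtain W where W: "delta_fun W" "\<And>x. R (proj1 x) (proj2 x) (W x)"
    by metis
  define f where "f p n = entry_at (W \<langle>p, n\<rangle>) n" for p n
  have unique: "i \<preceq> n \<longrightarrow> i \<preceq> n' \<longrightarrow> entry_at w i = entry_at w' i" if "R p n w" "R p n' w'" for p n n' w w' i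
  proof (induct i rule: delta_induct)
    case definable
    show ?case
      by (intro delta_intros)
  next
    case zero
    then show ?case
      using that by (simp add: R_def)
  next
    case (step i)
    then show ?case
      using that by (auto simp: R_def add_one_le_iff lt_imp_le)
  qed
  have WR: "R p n (W \<langle>p, n\<rangle>)" for p n
    using W(2)[of "\<langle>p, n\<rangle>"] by simp
  show thesis
  proof
    show "delta_fun (\<lambda>z. f (proj1 z) (proj2 z))"
      unfolding f_def by (intro delta_intros delta_fun_comp[OF W(1)])
    show "f p \<zero> = s p" for p
      using WR by (simp add: f_def R_def)
    show "f p (i \<oplus> \<one>) = G p i (f p i)" for p i
    proof -
      have "i \<prec> i \<oplus> \<one>"
        by (simp add: lt_add_one_iff)
      then have "f p (i \<oplus> \<one>) = G p i (entry_at (W \<langle>p, i \<oplus> \<one>\<rangle>) i)"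
        using WR[of p "i \<oplus> \<one>"] by (simp add: f_def R_def)
      also have "entry_at (W \<langle>p, i \<oplus> \<one>\<rangle>) i = entry_at (W \<langle>p, i\<rangle>) i"
        using unique[OF WR[of p "i \<oplus> \<one>"] WR[of p i], of i] lt_imp_le[OF \<open>i \<prec> i \<oplus> \<one>\<close>] by simp
      finally show ?thesis
        by (simp add: f_def)
    qed
  qed
qed

text \<open>For definable \<open>g\<close> the recursion has exactly one definable solution, by
  \<open>primitive_recursion\<close> and \<open>delta_fun_eqI\<close>.\<close>

definition psum :: "('a \<Rightarrow> 'a) \<Rightarrow> 'a \<Rightarrow> 'a" where
  "psum g = (SOME f. delta_fun f \<and> f \<zero> = \<zero> \<and> (\<forall>i. f (i \<oplus> \<one>) = f i \<oplus> g i))"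

lemma delta_fun_eqI:
  assumes "delta_fun f" "delta_fun f'" "f \<zero> = f' \<zero>" "\<And>i. f i = f' i \<Longrightarrow> f (i \<oplus> \<one>) = f' (i \<oplus> \<one>)"
  shows "f n = f' n"
proof (induct n rule: delta_induct)
  case definable
  show ?case
    by (intro delta_intros assms(1,2))
qed (use assms in auto)

lemma psum_props:
  assumes "delta_fun g" shows "delta_fun (psum g)" "psum g \<zero> = \<zero>" "psum g (i \<oplus> \<one>) = psum g i \<oplus> g i"
proof -
  have "delta_fun (\<lambda>z. proj2 z \<oplus> g (proj2 (proj1 z)))"
    by (intro delta_intros delta_fun_comp[OF assms])
  from primitive_recursion[of "\<lambda>_. \<zero>" "\<lambda>p i y. y \<oplus> g i", OF delta_fun_const this]
  obtain f where "delta_fun (\<lambda>z. f (proj1 z) (proj2 z))" "\<And>p. f p \<zero> = \<zero>" "\<And>p i. f p (i \<oplus> \<one>) = f p i \<oplus> g i"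
    by metis
  then have "delta_fun (f \<zero>) \<and> f \<zero> \<zero> = \<zero> \<and> (\<forall>i. f \<zero> (i \<oplus> \<one>) = f \<zero> i \<oplus> g i)"
    using delta_fun_comp2[of f "\<lambda>_. \<zero>" "\<lambda>x. x"] delta_fun_const delta_fun_id by simp
  then have "delta_fun (psum g) \<and> psum g \<zero> = \<zero> \<and> (\<forall>i. psum g (i \<oplus> \<one>) = psum g i \<oplus> g i)"
    unfolding psum_def
    by (rule someI[where P = "\<lambda>f. delta_fun f \<and> f \<zero> = \<zero> \<and> (\<forall>i. f (i \<oplus> \<one>) = f i \<oplus> g i)"])
  then show "delta_fun (psum g)" "psum g \<zero> = \<zero>" "psum g (i \<oplus> \<one>) = psum g i \<oplus> g i"
    by auto
qed

text \<open>The choice in \<open>psum\<close> is made separately for each parameter; joint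
  definability comes from a recursion with parameter, whose values agree with these choices by
  uniqueness.\<close>

lemma delta_fun_psum [delta_intros]:
  assumes g: "delta_fun (\<lambda>z. g (proj1 z) (proj2 z))" and t: "delta_fun t"
  shows "delta_fun (\<lambda>x. psum (g x) (t x))"
proof -
  have "delta_fun (\<lambda>z. proj2 z \<oplus> g (proj1 (proj1 z)) (proj2 (proj1 z)))"
    by (intro delta_intros delta_fun_comp2[OF g])
  from primitive_recursion[of "\<lambda>_. \<zero>" "\<lambda>p i y. y \<oplus> g p i", OF delta_fun_const this]
  obtain f where f: "delta_fun (\<lambda>z. f (proj1 z) (proj2 z))" "\<And>p. f p \<zero> = \<zero>" "\<And>p i. f p (i \<oplus> \<one>) = f p i \<oplus> g p i"
    by metis
  have gp: "delta_fun (g p)" for p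
    using delta_fun_comp2[OF g delta_fun_const delta_fun_id] .
  have "psum (g p) n = f p n" for p n
    by (rule delta_fun_eqI[OF psum_props(1)[OF gp] delta_fun_comp2[OF f(1) delta_fun_const delta_fun_id]])
      (simp_all add: psum_props[OF gp] f)
  then show ?thesis
    using delta_fun_comp2[OF f(1) delta_fun_id t] by simp
qed

section \<open>Powers of two and divisibility\<close>

definition pow2 :: "'a \<Rightarrow> 'a" where
  "pow2 = (SOME f. delta_fun f \<and> f \<zero> = \<one> \<and> (\<forall>i. f (i \<oplus> \<one>) = (\<one> \<oplus> \<one>) \<otimes> f i))"

lemma pow2_props: "delta_fun pow2" "pow2 \<zero> = \<one>" "pow2 (i \<oplus> \<one>) = (\<one> \<oplus> \<one>) \<otimes> pow2 i"
proof -
  have "delta_fun (\<lambda>z. (\<one> \<oplus> \<one>) \<otimes> proj2 z)"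
    by (intro delta_intros)
  from primitive_recursion[of "\<lambda>_. \<one>" "\<lambda>p i y. (\<one> \<oplus> \<one>) \<otimes> y", OF delta_fun_const this]
  obtain f where f: "delta_fun (\<lambda>z. f (proj1 z) (proj2 z))" "\<And>p. f p \<zero> = \<one>" "\<And>p i. f p (i \<oplus> \<one>) = (\<one> \<oplus> \<one>) \<otimes> f p i"
    by metis
  then have "delta_fun (f \<zero>) \<and> f \<zero> \<zero> = \<one> \<and> (\<forall>i. f \<zero> (i \<oplus> \<one>) = (\<one> \<oplus> \<one>) \<otimes> f \<zero> i)"
    using delta_fun_comp2[of f "\<lambda>_. \<zero>" "\<lambda>x. x"] delta_fun_const delta_fun_id by simp
  then have "delta_fun pow2 \<and> pow2 \<zero> = \<one> \<and> (\<forall>i. pow2 (i \<oplus> \<one>) = (\<one> \<oplus> \<one>) \<otimes> pow2 i)"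
    unfolding pow2_def
    by (rule someI[where P = "\<lambda>f. delta_fun f \<and> f \<zero> = \<one> \<and> (\<forall>i. f (i \<oplus> \<one>) = (\<one> \<oplus> \<one>) \<otimes> f i)"])
  then show "delta_fun pow2" "pow2 \<zero> = \<one>" "pow2 (i \<oplus> \<one>) = (\<one> \<oplus> \<one>) \<otimes> pow2 i"
    by auto
qed

lemma delta_fun_pow [delta_intros]: "delta_fun f \<Longrightarrow> delta_fun (\<lambda>x. pow2 (f x))"
  using delta_fun_comp[OF pow2_props(1)] .

lemma pow2_double: "pow2 (i \<oplus> \<one>) = pow2 i \<oplus> pow2 i"
  by (simp only: pow2_props mul_distrib_left mul_one_left)

lemma pow2_add: "pow2 (i \<oplus> j) = pow2 i \<otimes> pow2 j"
proof (induct j rule: delta_induct)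
  case definable
  show ?case
    by (intro delta_intros)
next
  case (step j)
  then show ?case
    by (simp only: add_assoc[symmetric] pow2_double mul_distrib_right)
qed (simp add: pow2_props)

lemma pow2_nonzero [simp]: "pow2 i \<noteq> \<zero>"
proof (induct i rule: delta_induct)
  case definable
  show ?case
    by (intro delta_intros)
next
  case (step i)
  then show ?case
    by (simp add: pow2_double arith.add_nonneg_eq_0_iff)
qed (simp add: pow2_props)

text \<open>Bounds exponents by the number itself, which makes quantifiers over exponents
  bounded.\<close>

lemma pow2_gt: "i \<prec> pow2 i"
proof (induct i rule: delta_induct)
  case definable
  show ?case
    by (intro delta_intros)
next
  case (step i)
  have "\<one> \<preceq> pow2 i"
    using arith.less_iff_succ_less_eq[of \<zero> "pow2 i"] pos_iff[of "pow2 i"] by simp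
  then show ?case
    using step arith.add_less_le_mono by (simp add: pow2_double)
qed (simp add: pow2_props)

lemma pow2_less_iff [simp]: "pow2 i \<prec> pow2 j \<longleftrightarrow> i \<prec> j"
proof -
  have "pow2 i \<prec> pow2 j" if "i \<prec> j" for i j
  proof -
    obtain z where "j = i \<oplus> (z \<oplus> \<one>)"
      using \<open>i \<prec> j\<close> lt_iff by blast
    then have "pow2 j = pow2 i \<otimes> pow2 (z \<oplus> \<one>)"
      using pow2_add by simp
    moreover have "\<one> \<prec> pow2 (z \<oplus> \<one>)"
      using pow2_gt[of "z \<oplus> \<one>"] by (metis arith.less_add_one add_commute le_iff_add le_lt_trans)
    ultimately show ?thesis
      using arith.mult_strict_left_mono[of \<one> "pow2 (z \<oplus> \<one>)" "pow2 i"] by (simp add: pos_iff)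
  qed
  then show ?thesis
    using lt_linear lt_irrefl lt_trans by metis
qed

lemma pow2_le_iff [simp]: "pow2 i \<preceq> pow2 j \<longleftrightarrow> i \<preceq> j"
  using pow2_less_iff[of j i] arith.not_less by metis

definition dvd_M (infix "dvd\<^sub>M" 50) where "x dvd\<^sub>M y \<longleftrightarrow> (\<exists>k. y = x \<otimes> k)"

lemma pow2_dvd: "i \<preceq> j \<Longrightarrow> pow2 i dvd\<^sub>M pow2 j"
  unfolding dvd_M_def le_iff_add using pow2_add by metis

lemma dvd_trans: "x dvd\<^sub>M y \<Longrightarrow> y dvd\<^sub>M z \<Longrightarrow> x dvd\<^sub>M z"
  unfolding dvd_M_def using mul_assoc by metis

lemma dvd_add: "x dvd\<^sub>M y \<Longrightarrow> x dvd\<^sub>M z \<Longrightarrow> x dvd\<^sub>M y \<oplus> z"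
  unfolding dvd_M_def using mul_distrib_right by metis

lemma dvd_imp_le: "x dvd\<^sub>M y \<Longrightarrow> y \<noteq> \<zero> \<Longrightarrow> x \<preceq> y"
  unfolding dvd_M_def le_iff_add using zero_or_add_one mul_Suc_right mul_zero_right add_commute by metis

lemma delta_pred_dvd [delta_intros]:
  assumes "delta_fun f" "delta_fun g" shows "delta_pred (\<lambda>x. f x dvd\<^sub>M g x)"
proof -
  have "x dvd\<^sub>M y \<longleftrightarrow> (\<exists>k. k \<preceq> y \<and> y = x \<otimes> k)" for x y
  proof (cases "y = \<zero>")
    case False
    have "k \<preceq> x \<otimes> k" if "x \<otimes> k \<noteq> \<zero>" for k
      using that dvd_imp_le[of k "x \<otimes> k"] unfolding dvd_M_def using mul_commute by blast
    then show ?thesis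
      using False unfolding dvd_M_def by blast
  next
    case True
    then show ?thesis
      unfolding dvd_M_def by (metis mul_zero_right zero_le)
  qed
  then show ?thesis
    by simp (intro delta_intros delta_fun_comp[OF assms(1)] delta_fun_comp[OF assms(2)] assms)
qed

text \<open>For nonzero \<open>n\<close>, \<open>pow2 x \<preceq> n\<close> expresses that
  \<open>x\<close> is at most \<mu>(n). In these terms \<mu>(n + m) = \<mu>(m): dividing by
  \<open>pow2 u\<close> shows that a summand below \<open>pow2 u\<close> cannot carry a multiple of
  it past a higher power of two.\<close>

lemma pow2_le_add_iff:
  assumes "n \<prec> pow2 u" "pow2 u dvd\<^sub>M m" "m \<noteq> \<zero>"
  shows "pow2 x \<preceq> n \<oplus> m \<longleftrightarrow> pow2 x \<preceq> m"
proof
  assume le: "pow2 x \<preceq> n \<oplus> m"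
  show "pow2 x \<preceq> m"
  proof (cases "x \<preceq> u")
    case True
    then show ?thesis
      using dvd_imp_le[OF assms(2,3)] arith.order_trans pow2_le_iff by blast
  next
    case False
    then have "u \<preceq> x"
      using le_total by blast
    then obtain k where k: "pow2 x = pow2 u \<otimes> k"
      using pow2_dvd dvd_M_def by blast
    obtain l where l: "m = pow2 u \<otimes> l"
      using assms(2) dvd_M_def by blast
    have "pow2 u \<otimes> k \<prec> pow2 u \<otimes> (l \<oplus> \<one>)"
      using le assms(1) le_lt_trans[of "pow2 u \<otimes> k" "n \<oplus> pow2 u \<otimes> l" "pow2 u \<otimes> (l \<oplus> \<one>)"]
      unfolding k l by (simp add: mul_distrib_right add_commute)
    then have "k \<preceq> l"
      using arith.mult_left_less_imp_less[of "pow2 u" k "l \<oplus> \<one>"] lt_add_one_le[of k l] zero_le[of "pow2 u"] by blast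
    then show ?thesis
      unfolding k l using arith.mult_left_mono by simp
  qed
next
  show "pow2 x \<preceq> m \<Longrightarrow> pow2 x \<preceq> n \<oplus> m"
    using arith.order_trans le_iff_add add_commute by metis
qed

section \<open>Parity\<close>

definition Even :: "'a \<Rightarrow> bool" where
  "Even x \<longleftrightarrow> (\<exists>y. y \<preceq> x \<and> x = y \<oplus> y)"

lemma delta_pred_Even [delta_intros]:
  assumes "delta_fun f" shows "delta_pred (\<lambda>x. Even (f x))"
  unfolding Even_def by (intro delta_intros delta_fun_comp[OF assms] assms)

lemma Even_iff: "Even x \<longleftrightarrow> (\<exists>y. x = y \<oplus> y)"
  unfolding Even_def le_iff_add by blast

lemma Even_add_one [simp]: "Even (x \<oplus> \<one>) \<longleftrightarrow> \<not> Even x"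
proof -
  have 1: "Even x \<or> Even (x \<oplus> \<one>)"
  proof (induct x rule: delta_induct)
    case definable
    show ?case
      by (intro delta_intros)
  next
    case zero
    show ?case
      unfolding Even_iff by (metis add_zero_right)
  next
    case (step x)
    then show ?case
      unfolding Even_iff by (metis add_assoc add_commute)
  qed
  have "u \<oplus> u \<noteq> v \<oplus> v \<oplus> \<one>" for u v
  proof
    assume eq: "u \<oplus> u = v \<oplus> v \<oplus> \<one>"
    consider "u \<preceq> v" | "v \<oplus> \<one> \<preceq> u"
      using add_one_le_iff arith.not_less by blast
    then show False
    proof cases
      case 1
      then have "u \<oplus> u \<prec> v \<oplus> v \<oplus> \<one>"
        using arith.add_mono[of u v u v] lt_add_one_le by simp
      then show False
        using eq lt_irrefl by simp
    next
      case 2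
      then have "v \<oplus> \<one> \<oplus> (v \<oplus> \<one>) \<preceq> u \<oplus> u"
        using arith.add_mono by blast
      then have "v \<oplus> v \<oplus> \<one> \<oplus> \<one> \<preceq> u \<oplus> u"
        by (simp add: arith.add.commute arith.add.left_commute)
      then show False
        unfolding eq add_one_le_iff using lt_irrefl by blast
    qed
  qed
  with 1 show ?thesis
    unfolding Even_iff by metis
qed

lemma Even_add [simp]: "Even (x \<oplus> y) \<longleftrightarrow> (Even x \<longleftrightarrow> Even y)"
proof (induct y rule: delta_induct)
  case definable
  show ?case
    by (intro delta_intros)
next
  case zero
  have "Even \<zero>"
    unfolding Even_iff by (metis add_zero_right)
  then show ?case
    by simp
next
  case (step y)
  then show ?case
    by (simp only: add_assoc[symmetric] Even_add_one) blast
qed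

lemma Even_zero [simp]: "Even \<zero>"
  using Even_add[of \<zero> \<zero>] by auto

lemma Even_one [simp]: "\<not> Even \<one>"
  using Even_add_one[of \<zero>] by (simp add: add_zero_left del: Even_add_one)

lemma Even_double [simp]: "Even (k \<otimes> pow2 (i \<oplus> \<one>))"
  by (simp add: pow2_double mul_distrib_right)

lemma le_add_left: "x \<preceq> x \<oplus> y" and le_add_right: "x \<preceq> y \<oplus> x"
  unfolding le_iff_add using add_commute by blast+

section \<open>Laws for definable sums\<close>

lemma psum_add:
  assumes "delta_fun f" "delta_fun g" shows "psum (\<lambda>i. f i \<oplus> g i) n = psum f n \<oplus> psum g n"
proof (rule delta_fun_eqI[where f = "psum (\<lambda>i. f i \<oplus> g i)" and f' = "\<lambda>n. psum f n \<oplus> psum g n"])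
  have fg: "delta_fun (\<lambda>i. f i \<oplus> g i)"
    by (intro delta_intros assms)
  show "delta_fun (psum (\<lambda>i. f i \<oplus> g i))" "delta_fun (\<lambda>n. psum f n \<oplus> psum g n)"
    by (intro delta_fun_add psum_props fg assms)+
  show "psum (\<lambda>i. f i \<oplus> g i) \<zero> = psum f \<zero> \<oplus> psum g \<zero>"
    by (simp add: psum_props assms fg)
  show "psum (\<lambda>i. f i \<oplus> g i) (i \<oplus> \<one>) = psum f (i \<oplus> \<one>) \<oplus> psum g (i \<oplus> \<one>)"
    if "psum (\<lambda>i. f i \<oplus> g i) i = psum f i \<oplus> psum g i" for i
    using that by (simp add: psum_props[OF assms(1)] psum_props[OF assms(2)] psum_props[OF fg]
        arith.add.assoc arith.add.left_commute)
qed

lemma psum_mono: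
  assumes "delta_fun f" "delta_fun g" "\<And>i. i \<prec> n \<Longrightarrow> f i \<preceq> g i"
  shows "psum f n \<preceq> psum g n"
proof -
  have "k \<preceq> n \<longrightarrow> psum f k \<preceq> psum g k" for k
  proof (induct k rule: delta_induct)
    case definable
    show ?case
      by (intro delta_intros psum_props assms)
  next
    case (step k)
    then show ?case
      using assms(3)[of k] by (simp add: psum_props assms(1,2) add_one_le_iff lt_imp_le arith.add_mono)
  qed (simp add: psum_props assms(1,2))
  then show ?thesis
    by simp
qed

lemma psum_cong: "delta_fun f \<Longrightarrow> delta_fun g \<Longrightarrow> (\<And>i. i \<prec> n \<Longrightarrow> f i = g i) \<Longrightarrow> psum f n = psum g n"
  using psum_mono[of f g n] psum_mono[of g f n] arith.order_antisym by simp

lemma psum_strict_mono: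
  assumes "delta_fun f" "delta_fun g" "\<And>i. f i \<preceq> g i" "f j \<prec> g j"
  shows "j \<prec> n \<longrightarrow> psum f n \<prec> psum g n"
proof (induct n rule: delta_induct)
  case definable
  show ?case
    by (intro delta_intros psum_props assms)
next
  case (step n)
  have "psum f n \<preceq> psum g n"
    using psum_mono assms by blast
  then show ?case
    using step assms(3)[of n] assms(4)
    by (auto simp: psum_props assms(1,2) lt_add_one_iff intro: arith.add_less_le_mono arith.add_le_less_mono)
qed simp

lemma psum_append:
  assumes "delta_fun g" shows "psum g (n \<oplus> k) = psum g n \<oplus> psum (\<lambda>i. g (n \<oplus> i)) k"
proof (rule delta_fun_eqI[where f = "\<lambda>k. psum g (n \<oplus> k)" and f' = "\<lambda>k. psum g n \<oplus> psum (\<lambda>i. g (n \<oplus> i)) k"])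
  have g: "delta_fun (\<lambda>i. g (n \<oplus> i))"
    by (intro delta_intros delta_fun_comp[OF assms])
  show "delta_fun (\<lambda>k. psum g (n \<oplus> k))"
    by (intro delta_fun_comp[OF psum_props(1)[OF assms]] delta_intros)
  show "delta_fun (\<lambda>k. psum g n \<oplus> psum (\<lambda>i. g (n \<oplus> i)) k)"
    by (intro delta_fun_add delta_fun_const psum_props g)
  show "psum g (n \<oplus> \<zero>) = psum g n \<oplus> psum (\<lambda>i. g (n \<oplus> i)) \<zero>"
    by (simp add: psum_props g)
  show "psum g (n \<oplus> (i \<oplus> \<one>)) = psum g n \<oplus> psum (\<lambda>i. g (n \<oplus> i)) (i \<oplus> \<one>)"
    if "psum g (n \<oplus> i) = psum g n \<oplus> psum (\<lambda>i. g (n \<oplus> i)) i" for i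
    using that by (simp only: add_assoc[symmetric] psum_props(3)[OF assms] psum_props(3)[OF g])
qed

lemma psum_zero: "psum (\<lambda>_. \<zero>) n = \<zero>"
  by (rule delta_fun_eqI[where f = "psum (\<lambda>_. \<zero>)" and f' = "\<lambda>_. \<zero>"]) (simp_all add: psum_props delta_fun_const)

lemma psum_stable:
  assumes "delta_fun g" "\<And>i. n \<preceq> i \<Longrightarrow> g i = \<zero>" "n \<preceq> k"
  shows "psum g k = psum g n"
proof -
  obtain l where l: "k = n \<oplus> l"
    using assms(3) unfolding le_iff_add by blast
  have "psum (\<lambda>i. g (n \<oplus> i)) l = \<zero>"
    using assms(2) le_add_left psum_zero by simp
  then show ?thesis
    unfolding l psum_append[OF assms(1)] by simp
qed

lemma psum_indicator:
  "psum (\<lambda>i. if i = l \<and> E then \<one> else \<zero>) n = (if l \<prec> n \<and> E then \<one> else \<zero>)"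
proof (rule delta_fun_eqI[where f = "psum (\<lambda>i. if i = l \<and> E then \<one> else \<zero>)" and
      f' = "\<lambda>n. if l \<prec> n \<and> E then \<one> else \<zero>"])
  have g: "delta_fun (\<lambda>i. if i = l \<and> E then \<one> else \<zero>)"
    by (intro delta_intros)
  show "delta_fun (psum (\<lambda>i. if i = l \<and> E then \<one> else \<zero>))"
    by (rule psum_props[OF g])
  show "delta_fun (\<lambda>n. if l \<prec> n \<and> E then \<one> else \<zero>)"
    by (intro delta_intros)
  show "psum (\<lambda>i. if i = l \<and> E then \<one> else \<zero>) \<zero> = (if l \<prec> \<zero> \<and> E then \<one> else \<zero>)"
    by (simp add: psum_props[OF g])
  show "psum (\<lambda>i. if i = l \<and> E then \<one> else \<zero>) (i \<oplus> \<one>) = (if l \<prec> i \<oplus> \<one> \<and> E then \<one> else \<zero>)"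
    if "psum (\<lambda>i. if i = l \<and> E then \<one> else \<zero>) i = (if l \<prec> i \<and> E then \<one> else \<zero>)" for i
    using that lt_irrefl by (auto simp: psum_props[OF g] lt_add_one_iff)
qed

lemma psum_le:
  assumes "delta_fun g" "\<And>i. g i \<preceq> \<one>" shows "psum g n \<preceq> n"
proof (induct n rule: delta_induct)
  case definable
  show ?case
    by (intro delta_intros psum_props assms)
next
  case (step n)
  then show ?case
    using assms(2)[of n] by (simp add: psum_props(3)[OF assms(1)] arith.add_mono)
qed (simp add: psum_props(2)[OF assms(1)])

text \<open>Strong \<open>\<Sigma>\<^sub>1\<close> bounding: if no bound works, then the number of \<open>x < k\<close> with a witness below \<open>b\<close>
  can be increased forever.\<close>

lemma strong_bounding:
  assumes A: "A \<in> Sets M"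
  obtains b where "\<And>x s. x \<prec> k \<Longrightarrow> \<langle>x, s\<rangle> \<in> A \<Longrightarrow> \<exists>s. s \<prec> b \<and> \<langle>x, s\<rangle> \<in> A"
proof (rule ccontr)
  assume "\<not> thesis"
  then have no: "\<exists>x s. x \<prec> k \<and> \<langle>x, s\<rangle> \<in> A \<and> \<not> (\<exists>s. s \<prec> b \<and> \<langle>x, s\<rangle> \<in> A)" for b
    using that by metis
  define g where "g b x = (if \<exists>s. s \<prec> b \<and> \<langle>x, s\<rangle> \<in> A then \<one> else \<zero>)" for b x
  have g: "delta_fun (g b)" for b
    unfolding g_def by (intro delta_intros A)
  have "\<exists>b. w \<preceq> psum (g b) k" for w
  proof (induct w rule: sigma_induct)
    case definable
    show ?case
      unfolding g_def by (intro delta_intros A)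
  next
    case (step w b)
    obtain x s where x: "x \<prec> k" "\<langle>x, s\<rangle> \<in> A" "\<not> (\<exists>s. s \<prec> b \<and> \<langle>x, s\<rangle> \<in> A)"
      using no by metis
    let ?b = "b \<oplus> (s \<oplus> \<one>)"
    have "b \<preceq> ?b"
      by (rule le_add_left)
    then have "g b i \<preceq> g ?b i" for i
      unfolding g_def using lt_le_trans[of _ b ?b] by auto
    moreover have "s \<prec> ?b"
      using lt_addI[of s b] by (simp add: arith.add.left_commute)
    then have "g b x \<prec> g ?b x"
      using x(2,3) by (auto simp: g_def)
    ultimately have "psum (g b) k \<prec> psum (g ?b) k"
      using psum_strict_mono[OF g g] x(1) by blast
    then have "w \<oplus> \<one> \<preceq> psum (g ?b) k"
      using step le_lt_trans by (simp add: add_one_le_iff)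
    then show ?case
      by blast
  qed simp
  \<comment> \<open>Only \<open>k\<close> arguments are counted, so the count cannot reach
    \<open>k \<oplus> \<one>\<close>.\<close>
  then obtain b where "k \<oplus> \<one> \<preceq> psum (g b) k"
    by blast
  moreover have "psum (g b) k \<preceq> k"
    by (rule psum_le[OF g]) (simp add: g_def)
  ultimately show False
    using add_one_le_iff arith.not_less by blast
qed

section \<open>The gap coloring\<close>

text \<open>For \<open>t\<close> an exponent of \<open>n\<close>, the remainder of \<open>n\<close> modulo \<open>2\<^sup>t\<close> is nonzero iff \<open>t\<close> closes a gap, and
  \<open>2\<^sup>x\<close> is at most this remainder iff \<open>x\<close> is at most the beginning of the gap.\<close>

definition gap :: "('a \<Rightarrow> 'a \<Rightarrow> bool) \<Rightarrow> 'a \<Rightarrow> 'a \<Rightarrow> bool" where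
  "gap B n t \<longleftrightarrow> \<not> Even (quo n (pow2 t)) \<and> (\<exists>x. pow2 x \<preceq> rem n (pow2 t) \<and> B t x)"

text \<open>\<lambda>(m) in terms of division instead of a coded binary expansion.\<close>

definition lowest_exponent :: "'a \<Rightarrow> 'a \<Rightarrow> bool" where
  "lowest_exponent m l \<longleftrightarrow> \<not> Even (quo m (pow2 l)) \<and> rem m (pow2 l) = \<zero>"

lemma even_multiple_pow2:
  assumes "pow2 u dvd\<^sub>M m" "t \<prec> u"
  shows "\<exists>k. Even k \<and> m = k \<otimes> pow2 t"
proof -
  obtain l where l: "m = pow2 u \<otimes> l"
    using assms(1) dvd_M_def by blast
  obtain z where "u = t \<oplus> (z \<oplus> \<one>)"
    using assms(2) lt_iff by blast
  then have "m = (l \<otimes> pow2 (z \<oplus> \<one>)) \<otimes> pow2 t"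
    unfolding l by (simp only: pow2_add arith.mult.assoc arith.mult.commute arith.mult.left_commute)
  then show ?thesis
    using Even_double by blast
qed

lemma quo_rem_multiple: "m \<noteq> \<zero> \<Longrightarrow> quo (k \<otimes> m) m = k" "m \<noteq> \<zero> \<Longrightarrow> rem (k \<otimes> m) m = \<zero>"
  using quo_rem_unique[of "k \<otimes> m" k m \<zero>] pos_iff by auto

text \<open>Take the least \<open>t\<close> for which \<open>pow2 (t \<oplus> \<one>)\<close> does
  not divide \<open>m\<close>; the search ends because \<open>pow2 (m \<oplus> \<one>)\<close>
  exceeds \<open>m\<close>.\<close>

lemma lowest_exponent_ex:
  assumes "m \<noteq> \<zero>" obtains l where "lowest_exponent m l"
proof -
  have "delta_pred (\<lambda>t. \<not> pow2 (t \<oplus> \<one>) dvd\<^sub>M m)"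
    by (intro delta_intros)
  moreover have "m \<prec> pow2 (m \<oplus> \<one>)"
    using pow2_gt[of m] by (simp add: pow2_double) (metis lt_le_trans le_add_left)
  then have "\<not> pow2 (m \<oplus> \<one>) dvd\<^sub>M m"
    using dvd_imp_le[OF _ assms] arith.not_less by blast
  ultimately obtain l where l: "\<not> pow2 (l \<oplus> \<one>) dvd\<^sub>M m" "\<And>w. w \<prec> l \<Longrightarrow> \<not> \<not> pow2 (w \<oplus> \<one>) dvd\<^sub>M m"
    by (rule delta_least[where P = "\<lambda>t. \<not> pow2 (t \<oplus> \<one>) dvd\<^sub>M m"]) blast
  have "pow2 l dvd\<^sub>M m"
  proof (cases "l = \<zero>")
    case True
    then show ?thesis
      by (simp add: pow2_props dvd_M_def)
  next
    case False
    then obtain w where "l = w \<oplus> \<one>"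
      using zero_or_add_one by blast
    then show ?thesis
      using l(2)[of w] by (simp add: lt_add_one_le)
  qed
  then obtain k where k: "m = k \<otimes> pow2 l"
    unfolding dvd_M_def by (auto simp: mul_commute)
  have "\<not> Even k"
  proof
    assume "Even k"
    then obtain y where "k = y \<oplus> y"
      unfolding Even_def by blast
    then have "m = pow2 (l \<oplus> \<one>) \<otimes> y"
      unfolding k pow2_double by (simp add: mul_distrib_left mul_distrib_right mul_commute)
    then show False
      using l(1) dvd_M_def by blast
  qed
  then have "lowest_exponent m l"
    unfolding lowest_exponent_def k by (simp add: quo_rem_multiple)
  then show thesis
    by (rule that)
qed

lemma lowest_exponent_dvd: "lowest_exponent m l \<Longrightarrow> pow2 l dvd\<^sub>M m"
  unfolding lowest_exponent_def dvd_M_def using quo_rem[of m "pow2 l"] by (metis add_zero_right mul_commute)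

lemma lowest_exponent_ge:
  assumes "pow2 u dvd\<^sub>M m" "lowest_exponent m l" shows "u \<preceq> l"
proof (rule ccontr)
  assume "\<not> u \<preceq> l"
  then have "l \<prec> u"
    using arith.not_less by blast
  then obtain k where "Even k" "m = k \<otimes> pow2 l"
    using even_multiple_pow2[OF assms(1)] by blast
  then show False
    using assms(2) by (simp add: lowest_exponent_def quo_rem_multiple)
qed

lemma lowest_exponent_unique: "lowest_exponent m l \<Longrightarrow> lowest_exponent m l' \<Longrightarrow> l = l'"
  using lowest_exponent_ge lowest_exponent_dvd arith.order_antisym by blast

text \<open>For \<open>t \<prec> u\<close> the summand \<open>m\<close> adds an even amount to the
  quotient and nothing to the remainder. For \<open>u \<preceq> t\<close> the quotient is that of
  \<open>m\<close>, and \<open>n\<close> is added to the remainder. By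
  \<open>pow2_le_add_iff\<close> this matters only if the remainder of \<open>m\<close> is zero,
  which together with an odd quotient happens at \<open>t = l\<close> alone.\<close>

lemma gap_add:
  assumes n: "n \<prec> pow2 u" and m: "pow2 u dvd\<^sub>M m" "m \<noteq> \<zero>" and l: "lowest_exponent m l"
  shows "t \<prec> u \<Longrightarrow> gap B (n \<oplus> m) t \<longleftrightarrow> gap B n t" "t \<prec> u \<Longrightarrow> \<not> gap B m t" "t \<prec> u \<Longrightarrow> t \<noteq> l"
    "u \<preceq> t \<Longrightarrow> \<not> gap B n t"
    "u \<preceq> t \<Longrightarrow> t \<noteq> l \<Longrightarrow> gap B (n \<oplus> m) t \<longleftrightarrow> gap B m t"
    "\<not> gap B m l" "gap B (n \<oplus> m) l \<longleftrightarrow> (\<exists>x. pow2 x \<preceq> n \<and> B l x)"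
proof -
  have "u \<preceq> l"
    by (rule lowest_exponent_ge[OF m(1) l])
  have no_pow: "\<not> pow2 x \<preceq> \<zero>" for x
    using pow2_nonzero[of x] zero_le[of "pow2 x"] arith.order_antisym by blast
  show "gap B (n \<oplus> m) t \<longleftrightarrow> gap B n t" "\<not> gap B m t" "t \<noteq> l" if t: "t \<prec> u"
  proof -
    obtain k where k: "Even k" "m = k \<otimes> pow2 t"
      using even_multiple_pow2[OF m(1) t] by blast
    have "quo (n \<oplus> m) (pow2 t) = k \<oplus> quo n (pow2 t)" "rem (n \<oplus> m) (pow2 t) = rem n (pow2 t)"
      unfolding k(2) using quo_add_mult[of "pow2 t" k n] rem_add_mult[of k "pow2 t" n]
      by (simp_all add: add_commute)
    then show "gap B (n \<oplus> m) t \<longleftrightarrow> gap B n t"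
      using k(1) by (simp add: gap_def)
    show "\<not> gap B m t"
      unfolding k(2) gap_def using k(1) by (simp add: quo_rem_multiple)
    show "t \<noteq> l"
      using t \<open>u \<preceq> l\<close> arith.not_less by blast
  qed
  \<comment> \<open>The remainder of \<open>m\<close> and the larger \<open>pow2 t\<close> are both
    multiples of \<open>pow2 u\<close>, so adding \<open>n\<close> to the remainder does not reach
    \<open>pow2 t\<close> and causes no carry.\<close>
  have large: "quo (n \<oplus> m) (pow2 t) = quo m (pow2 t)" "rem (n \<oplus> m) (pow2 t) = n \<oplus> rem m (pow2 t)"
    "pow2 u dvd\<^sub>M rem m (pow2 t)" "n \<prec> pow2 t" if t: "u \<preceq> t" for t
  proof -
    obtain m' where m': "m = pow2 u \<otimes> m'"
      using m(1) dvd_M_def by blast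
    obtain e where e: "pow2 t = pow2 u \<otimes> e"
      using pow2_dvd[OF t] dvd_M_def by blast
    have "e \<noteq> \<zero>"
      using e pow2_nonzero[of t] by auto
    define q r where "q = quo m' e" and "r = rem m' e"
    have r: "r \<prec> e"
      unfolding r_def using \<open>e \<noteq> \<zero>\<close> by (rule rem_less)
    have "m' = q \<otimes> e \<oplus> r"
      unfolding q_def r_def by (simp add: quo_rem)
    then have mq: "m = q \<otimes> pow2 t \<oplus> pow2 u \<otimes> r"
      unfolding m' e by (simp only: mul_distrib_right arith.mult.assoc arith.mult.commute arith.mult.left_commute)
    have "n \<oplus> pow2 u \<otimes> r \<prec> pow2 u \<otimes> (r \<oplus> \<one>)"
      using n by (simp add: mul_Suc_right add_commute)
    also have "pow2 u \<otimes> (r \<oplus> \<one>) \<preceq> pow2 t"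
      unfolding e using r arith.mult_left_mono[of "r \<oplus> \<one>" e "pow2 u"] by (simp add: add_one_le_iff)
    finally have 1: "n \<oplus> pow2 u \<otimes> r \<prec> pow2 t"
      using lt_le_trans by blast
    then have 2: "pow2 u \<otimes> r \<prec> pow2 t"
      using le_lt_trans[OF le_add_right] by blast
    have "n \<oplus> m = q \<otimes> pow2 t \<oplus> (n \<oplus> pow2 u \<otimes> r)"
      unfolding mq by (rule arith.add.left_commute)
    then show "quo (n \<oplus> m) (pow2 t) = quo m (pow2 t)" "rem (n \<oplus> m) (pow2 t) = n \<oplus> rem m (pow2 t)"
      using quo_rem_unique[OF mq 2] quo_rem_unique[OF _ 1] by simp_all
    show "pow2 u dvd\<^sub>M rem m (pow2 t)"
      using quo_rem_unique[OF mq 2] dvd_M_def by blast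
    show "n \<prec> pow2 t"
      using n t lt_le_trans pow2_le_iff by blast
  qed
  show "\<not> gap B n t" if "u \<preceq> t"
    using large(4)[OF that] by (simp add: gap_def)
  show "gap B (n \<oplus> m) t \<longleftrightarrow> gap B m t" if "u \<preceq> t" "t \<noteq> l"
  proof (cases "rem m (pow2 t) = \<zero>")
    case True
    then have "Even (quo m (pow2 t))"
      using lowest_exponent_unique[OF l, of t] that(2) lowest_exponent_def by blast
    then show ?thesis
      using large[OF that(1)] by (simp add: gap_def)
  next
    case False
    then show ?thesis
      using pow2_le_add_iff[OF n large(3)[OF that(1)]] large(1,2)[OF that(1)] by (simp add: gap_def)
  qed
  show "\<not> gap B m l"
    using l no_pow by (simp add: gap_def lowest_exponent_def)
  show "gap B (n \<oplus> m) l \<longleftrightarrow> (\<exists>x. pow2 x \<preceq> n \<and> B l x)"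
    using l large(1,2)[OF \<open>u \<preceq> l\<close>] by (simp add: gap_def lowest_exponent_def)
qed

text \<open>A gap is identified with the exponent closing it, which lies below
  \<open>n\<close>.\<close>

definition gaps :: "('a \<Rightarrow> 'a \<Rightarrow> bool) \<Rightarrow> 'a \<Rightarrow> 'a" where
  "gaps B n = psum (\<lambda>t. if gap B n t then \<one> else \<zero>) n"

lemma gap_bounded: "gap B n t \<Longrightarrow> t \<prec> n"
proof (rule ccontr)
  assume "gap B n t" "\<not> t \<prec> n"
  then have "n \<prec> pow2 t"
    using pow2_gt[of t] arith.not_less le_lt_trans by blast
  with \<open>gap B n t\<close> show False
    by (simp add: gap_def)
qed

lemma delta_pred_comp3:
  assumes "delta_pred (\<lambda>z. P (proj1 (proj1 z)) (proj2 (proj1 z)) (proj2 z))" "delta_fun f" "delta_fun g" "delta_fun h"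
  shows "delta_pred (\<lambda>x. P (f x) (g x) (h x))"
  using delta_pred_comp[OF assms(1) delta_fun_pair[OF delta_fun_pair[OF assms(2,3)] assms(4)]] by simp

lemma delta_pred_gap:
  assumes "delta_pred (\<lambda>z. B (proj1 (proj1 z)) (proj2 (proj1 z)) (proj2 z))" "delta_fun f" "delta_fun g"
  shows "delta_pred (\<lambda>z. gap (B z) (f z) (g z))"
proof -
  have "gap B n t \<longleftrightarrow> \<not> Even (quo n (pow2 t)) \<and>
      (\<exists>x. x \<preceq> rem n (pow2 t) \<and> (pow2 x \<preceq> rem n (pow2 t) \<and> B t x))" for B n t
    unfolding gap_def using pow2_gt le_lt_trans lt_imp_le arith.order_trans by metis
  then show ?thesis
    by simp (intro delta_intros delta_pred_comp3[OF assms(1)] delta_fun_comp[OF assms(2)] delta_fun_comp[OF assms(3)] assms(2,3))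
qed

lemma delta_fun_gap:
  assumes "delta_pred (\<lambda>z. B (proj1 z) (proj2 z))" shows "delta_fun (\<lambda>t. if gap B n t then \<one> else \<zero>)"
  by (intro delta_intros delta_pred_gap delta_pred_comp2[OF assms])

text \<open>Lets the gaps of two numbers and of their sum be counted up to a common bound.\<close>

lemma gaps_eq:
  assumes "delta_pred (\<lambda>z. B (proj1 z) (proj2 z))" "n \<preceq> k"
  shows "gaps B n = psum (\<lambda>t. if gap B n t then \<one> else \<zero>) k"
proof -
  have "psum (\<lambda>t. if gap B n t then \<one> else \<zero>) k = psum (\<lambda>t. if gap B n t then \<one> else \<zero>) n"
  proof (rule psum_stable[OF delta_fun_gap[OF assms(1)] _ assms(2)])
    show "(if gap B n i then \<one> else \<zero>) = \<zero>" if "n \<preceq> i" for i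
      using that gap_bounded[of B n i] arith.not_less by auto
  qed
  then show ?thesis
    by (simp add: gaps_def)
qed

text \<open>Sums the pointwise description \<open>gap_add\<close>; the indicator \<open>e\<close>
  accounts for the new gap, closed at \<open>l\<close>.\<close>

lemma gaps_add:
  assumes B: "delta_pred (\<lambda>z. B (proj1 z) (proj2 z))"
    and n: "n \<prec> pow2 u" and m: "pow2 u dvd\<^sub>M m" "m \<noteq> \<zero>" and l: "lowest_exponent m l"
  shows "gaps B (n \<oplus> m) = gaps B n \<oplus> gaps B m \<oplus> (if \<exists>x. pow2 x \<preceq> n \<and> B l x then \<one> else \<zero>)"
proof -
  define E where "E \<longleftrightarrow> (\<exists>x. pow2 x \<preceq> n \<and> B l x)"
  define g where "g n t = (if gap B n t then \<one> else \<zero>)" for n t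
  define e where "e t = (if t = l \<and> E then \<one> else \<zero>)" for t
  have Fg: "delta_fun (g n)" for n
    unfolding g_def by (rule delta_fun_gap[OF B])
  have Fe: "delta_fun e"
    unfolding e_def by (intro delta_intros)
  have "l \<prec> n \<oplus> m"
    using pow2_gt[of l] dvd_imp_le[OF lowest_exponent_dvd[OF l] m(2)] lt_le_trans le_add_right by metis
  then have "psum e (n \<oplus> m) = (if E then \<one> else \<zero>)"
    unfolding e_def using psum_indicator[of l E "n \<oplus> m"] by simp
  moreover have "gaps B (n \<oplus> m) = psum (g (n \<oplus> m)) (n \<oplus> m)" "gaps B n = psum (g n) (n \<oplus> m)"
      "gaps B m = psum (g m) (n \<oplus> m)"
    unfolding g_def using gaps_eq[OF B] le_add_left le_add_right by simp_all
  moreover have "g (n \<oplus> m) = (\<lambda>t. g n t \<oplus> g m t \<oplus> e t)"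
  proof
    fix t
    note * = gap_add[OF n m l]
    consider "t \<prec> u" | "u \<preceq> t" "t \<noteq> l" | "u \<preceq> t" "t = l"
      using arith.not_less by blast
    then show "g (n \<oplus> m) t = g n t \<oplus> g m t \<oplus> e t"
    proof cases
      case 1
      then show ?thesis
        using *(1-3)[OF 1] by (simp add: g_def e_def)
    next
      case 2
      then show ?thesis
        using *(4)[OF 2(1)] *(5)[OF 2] by (simp add: g_def e_def)
    next
      case 3
      then show ?thesis
        using *(4)[OF 3(1)] *(6,7) by (simp add: g_def e_def E_def)
    qed
  qed
  moreover have "psum (\<lambda>t. g n t \<oplus> g m t \<oplus> e t) (n \<oplus> m) =
      psum (g n) (n \<oplus> m) \<oplus> psum (g m) (n \<oplus> m) \<oplus> psum e (n \<oplus> m)"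
    by (simp only: psum_add[OF delta_fun_add[OF Fg Fg] Fe] psum_add[OF Fg Fg])
  ultimately show ?thesis
    by (simp add: E_def)
qed

text \<open>\<open>A\<close> is read as a \<open>\<Sigma>\<^sub>1\<close> set enumerated in stages: \<open>late A n t x\<close> says that \<open>x\<close> appears by stage
  \<open>\<mu>(n)\<close>, but not by stage \<open>t\<close>.\<close>

definition late :: "'a set \<Rightarrow> 'a \<Rightarrow> 'a \<Rightarrow> 'a \<Rightarrow> bool" where
  "late A n t x \<longleftrightarrow> (\<exists>s. pow2 s \<preceq> n \<and> \<langle>x, s\<rangle> \<in> A) \<and> \<not> (\<exists>s. s \<preceq> t \<and> \<langle>x, s\<rangle> \<in> A)"

lemma delta_pred_late:
  assumes "A \<in> Sets M" "delta_fun f" "delta_fun g" "delta_fun h"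
  shows "delta_pred (\<lambda>z. late A (f z) (g z) (h z))"
proof -
  have "(\<exists>s. pow2 s \<preceq> n \<and> \<langle>x, s\<rangle> \<in> A) \<longleftrightarrow> (\<exists>s. s \<preceq> n \<and> (pow2 s \<preceq> n \<and> \<langle>x, s\<rangle> \<in> A))" for n x
    using pow2_gt lt_imp_le arith.order_trans by metis
  then show ?thesis
    unfolding late_def
    by simp (intro delta_intros assms delta_fun_comp[OF assms(2)] delta_fun_comp[OF assms(3)] delta_fun_comp[OF assms(4)])
qed

definition color :: "'a set \<Rightarrow> 'a \<Rightarrow> 'a" where
  "color A n = (if Even (gaps (late A n) n) then \<zero> else \<one>)"

lemma delta_fun_color: "A \<in> Sets M \<Longrightarrow> delta_fun (color A)"
  unfolding color_def gaps_def by (intro delta_intros delta_pred_gap delta_pred_late)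

text \<open>As \<mu>(n + m) = \<mu>(m), lateness means the same for \<open>n \<oplus> m\<close> and
  for \<open>m\<close>. So the very short gaps of \<open>m\<close> cancel against its own color,
  leaving the short gaps of \<open>n\<close> and the new gap.\<close>

lemma color_add:
  assumes A: "A \<in> Sets M"
    and n: "n \<prec> pow2 u" and m: "pow2 u dvd\<^sub>M m" "m \<noteq> \<zero>" and l: "lowest_exponent m l"
  shows "color A (n \<oplus> m) = color A m \<longleftrightarrow>
    (Even (gaps (late A m) n) \<longleftrightarrow> \<not> (\<exists>x. pow2 x \<preceq> n \<and> late A m l x))"
proof -
  have "late A (n \<oplus> m) = late A m"
    unfolding late_def pow2_le_add_iff[OF n m] ..
  then show ?thesis
    using gaps_add[OF delta_pred_late[OF A delta_fun_const delta_fun_proj1[OF delta_fun_id] delta_fun_proj2[OF delta_fun_id]] n m l] arith.zero_neq_one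
    by (auto simp: color_def)
qed

text \<open>\<open>x0_stage\<close> puts all appearances up to \<mu>(x0) before stage
  \<open>u\<close>, and \<open>z_ex\<close> is homogeneity. Existence of \<open>z\<close> is assumed
  beyond every \<open>w\<close> because \<open>w\<close> depends on stages found only inside the
  proof.\<close>

lemma color_core:
  assumes A: "A \<in> Sets M" and x0: "x0 \<prec> pow2 u" and x: "x \<prec> pow2 u" and y: "pow2 u dvd\<^sub>M y" "y \<noteq> \<zero>"
    and x0_stage: "\<And>v s. pow2 v \<preceq> x0 \<Longrightarrow> \<langle>v, s\<rangle> \<in> A \<Longrightarrow> \<exists>s. s \<preceq> u \<and> \<langle>v, s\<rangle> \<in> A"
    and z_ex: "\<And>w. y \<prec> pow2 w \<Longrightarrow> u \<preceq> w \<Longrightarrow> \<exists>z. pow2 w dvd\<^sub>M z \<and> z \<noteq> \<zero> \<and>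
      (\<forall>n\<in>{x, x0, x \<oplus> y, x0 \<oplus> y}. color A (n \<oplus> z) = color A z)"
    and v: "pow2 v \<preceq> x" "\<langle>v, s\<rangle> \<in> A"
  shows "\<exists>s. s \<preceq> y \<and> \<langle>v, s\<rangle> \<in> A"
proof -
  define k where "k = x \<oplus> x0 \<oplus> y"
  obtain b where b: "\<And>v s. v \<prec> k \<Longrightarrow> \<langle>v, s\<rangle> \<in> A \<Longrightarrow> \<exists>s. s \<prec> b \<and> \<langle>v, s\<rangle> \<in> A"
    using strong_bounding[OF A] by metis
  \<comment> \<open>Every number below \<open>k\<close> that ever appears has appeared by stage
    \<open>b\<close>, hence by \<open>w\<close>. For such numbers, being late with respect to a
    \<open>z\<close> beyond \<open>w\<close> means appearing at all, but only after the given
    stage.\<close>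
  define w where "w = k \<oplus> u \<oplus> b"
  have "k \<preceq> w" "u \<preceq> w" "b \<preceq> w"
    unfolding w_def by (metis le_add_left le_add_right arith.order_trans)+
  have le_k: "n \<preceq> k" if "n \<in> {x, x0, y, x \<oplus> y, x0 \<oplus> y}" for n
    using that by (auto simp: k_def add_assoc intro: arith.add_increasing arith.add_increasing2)
  have less_pow: "n \<prec> pow2 w" if "n \<in> {x, x0, y, x \<oplus> y, x0 \<oplus> y}" for n
    using le_k[OF that] \<open>k \<preceq> w\<close> pow2_gt[of w] arith.order_trans le_lt_trans by blast
  obtain z where z: "pow2 w dvd\<^sub>M z" "z \<noteq> \<zero>"
    and col: "\<And>n. n \<in> {x, x0, x \<oplus> y, x0 \<oplus> y} \<Longrightarrow> color A (n \<oplus> z) = color A z"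
    using z_ex[OF less_pow \<open>u \<preceq> w\<close>] by auto
  obtain l where l: "lowest_exponent z l"
    using lowest_exponent_ex[OF z(2)] .
  have "w \<preceq> l"
    using lowest_exponent_ge[OF z(1) l] .
  have stage: "\<exists>s. s \<prec> w \<and> \<langle>v, s\<rangle> \<in> A" if "pow2 v \<preceq> k" "\<langle>v, s\<rangle> \<in> A" for v s
  proof -
    have "v \<prec> k"
      using pow2_gt that(1) lt_le_trans by blast
    then show ?thesis
      using b that(2) \<open>b \<preceq> w\<close> lt_le_trans by blast
  qed
  \<comment> \<open>By stage \<open>l\<close> everything up to \<mu>(n) has appeared, so the gap
    between \<open>n\<close> and \<open>z\<close> is not short, and equality of colors leaves an
    even number of short gaps in \<open>n\<close>.\<close>
  have even: "Even (gaps (late A z) n)" if n: "n \<in> {x, x0, x \<oplus> y, x0 \<oplus> y}" for n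
  proof -
    have "n \<prec> pow2 w" "n \<preceq> k"
      using less_pow[of n] le_k[of n] n by auto
    have "\<not> late A z l v" if "pow2 v \<preceq> n" for v
      using stage[of v] arith.order_trans[OF that \<open>n \<preceq> k\<close>] \<open>w \<preceq> l\<close> lt_le_trans lt_imp_le
      unfolding late_def by metis
    then show ?thesis
      using color_add[OF A \<open>n \<prec> pow2 w\<close> z l] col[OF n] by blast
  qed
  obtain ly where ly: "lowest_exponent y ly"
    using lowest_exponent_ex[OF y(2)] .
  have "u \<preceq> ly"
    using lowest_exponent_ge[OF y(1) ly] .
  note add = gaps_add[OF delta_pred_late[OF A delta_fun_const delta_fun_proj1[OF delta_fun_id] delta_fun_proj2[OF delta_fun_id]] _ y ly, of _ z]
  \<comment> \<open>The gap between \<open>x0\<close> and \<open>y\<close> is closed at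
    \<open>ly\<close>, not before stage \<open>u\<close>, so it is not short. As \<open>x0\<close>
    and \<open>x0 \<oplus> y\<close> have even counts, so has \<open>y\<close>.\<close>
  have "\<not> (\<exists>v. pow2 v \<preceq> x0 \<and> late A z ly v)"
    using x0_stage arith.order_trans[OF _ \<open>u \<preceq> ly\<close>] unfolding late_def by metis
  then have "Even (gaps (late A z) y)"
    using add[OF x0] even[of x0] even[of "x0 \<oplus> y"] by simp
  \<comment> \<open>The same equation for \<open>x\<close>: the counts of \<open>x\<close>,
    \<open>y\<close> and \<open>x \<oplus> y\<close> are even, so the gap between \<open>x\<close>
    and \<open>y\<close> is not short.\<close>
  then have "\<not> late A z ly v"
    using add[OF x] even[of x] even[of "x \<oplus> y"] v(1) by (auto split: if_splits)
  moreover have "\<exists>s. pow2 s \<preceq> z \<and> \<langle>v, s\<rangle> \<in> A"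
  proof -
    have "pow2 v \<preceq> k"
      using v(1) le_k[of x] arith.order_trans by blast
    then obtain s where "s \<prec> w" "\<langle>v, s\<rangle> \<in> A"
      using stage v(2) by blast
    moreover have "pow2 w \<preceq> z"
      using dvd_imp_le z by blast
    ultimately show ?thesis
      using pow2_le_iff[of s w] lt_imp_le[of s w] arith.order_trans by blast
  qed
  ultimately obtain s where s: "s \<preceq> ly" "\<langle>v, s\<rangle> \<in> A"
    unfolding late_def by blast
  have "ly \<preceq> y"
    using pow2_gt[of ly] dvd_imp_le[OF lowest_exponent_dvd[OF ly] y(2)] lt_imp_le arith.order_trans by blast
  with s show ?thesis
    using arith.order_trans by blast
qed

section \<open>Sums of elements of apart sets\<close>

lemma Is_pow2_eq:
  assumes "Is_pow2 M t x" shows "x = pow2 t"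
proof -
  obtain w where w: "entry_at w \<zero> = \<one>" "entry_at w t = x"
    "\<And>i. i \<prec> t \<Longrightarrow> entry_at w (i \<oplus> \<one>) = (\<one> \<oplus> \<one>) \<otimes> entry_at w i"
    using assms unfolding Is_pow2_def Entry_iff by metis
  have "i \<preceq> t \<longrightarrow> entry_at w i = pow2 i" for i
  proof (induct i rule: delta_induct)
    case definable
    show ?case
      by (intro delta_intros)
  next
    case (step i)
    then show ?case
      using w(3)[of i] by (simp only: add_one_le_iff pow2_props lt_imp_le simp_thms) (metis lt_imp_le)
  qed (simp add: w pow2_props)
  then show ?thesis
    using w(2) by simp
qed

text \<open>Induction along the partial sums: with increasing exponents each partial sum stays below
  twice its last power, and the first power divides every term.\<close>

lemma Expansion_bounds:
  assumes "Expansion M c d l n"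
  shows "n \<prec> pow2 (entry_at \<langle>c, d\<rangle> l \<oplus> \<one>)" "pow2 (entry_at \<langle>c, d\<rangle> \<zero>) dvd\<^sub>M n"
proof -
  define e where "e = entry_at \<langle>c, d\<rangle>"
  have Fe: "delta_fun e"
    unfolding e_def by (intro delta_intros)
  have incr: "e i \<prec> e (i \<oplus> \<one>)" if "i \<prec> l" for i
    using assms that unfolding Expansion_def Entry_iff e_def by auto
  have "Is_sum M (\<lambda>i x. \<exists>t. t = e i \<and> Is_pow2 M t x) (l \<oplus> \<one>) n"
    using assms unfolding Expansion_def Entry_iff e_def by blast
  then obtain w where w: "entry_at w \<zero> = \<zero>" "entry_at w (l \<oplus> \<one>) = n"
      "\<And>i. i \<prec> l \<oplus> \<one> \<Longrightarrow> \<exists>x. Is_pow2 M (e i) x \<and> entry_at w (i \<oplus> \<one>) = entry_at w i \<oplus> x"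
    unfolding Is_sum_def Entry_iff by metis
  have sum: "entry_at w (i \<oplus> \<one>) = entry_at w i \<oplus> pow2 (e i)" if "i \<preceq> l" for i
    using w(3)[of i] that Is_pow2_eq by (auto simp: lt_add_one_le)
  have "i \<preceq> l \<longrightarrow> entry_at w (i \<oplus> \<one>) \<prec> pow2 (e i \<oplus> \<one>) \<and> e \<zero> \<preceq> e i \<and> pow2 (e \<zero>) dvd\<^sub>M entry_at w (i \<oplus> \<one>)" for i
  proof (induct i rule: delta_induct)
    case definable
    show ?case
      by (intro delta_intros delta_fun_comp[OF Fe])
  next
    case zero
    have "pow2 (e \<zero>) \<prec> pow2 (e \<zero> \<oplus> \<one>)"
      by (simp add: lt_add_one_iff)
    moreover have "pow2 (e \<zero>) dvd\<^sub>M pow2 (e \<zero>)"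
      by (rule pow2_dvd) simp
    ultimately show ?case
      using sum[of \<zero>] w(1) by simp
  next
    case (step i)
    show ?case
    proof
      assume "i \<oplus> \<one> \<preceq> l"
      then have "i \<prec> l"
        by (simp add: add_one_le_iff)
      with step have IH: "entry_at w (i \<oplus> \<one>) \<prec> pow2 (e i \<oplus> \<one>)" "e \<zero> \<preceq> e i" "pow2 (e \<zero>) dvd\<^sub>M entry_at w (i \<oplus> \<one>)"
        using lt_imp_le by blast+
      have "e i \<oplus> \<one> \<preceq> e (i \<oplus> \<one>)"
        using incr[OF \<open>i \<prec> l\<close>] by (simp add: add_one_le_iff)
      then have "entry_at w (i \<oplus> \<one>) \<prec> pow2 (e (i \<oplus> \<one>))"
        using IH(1) lt_le_trans pow2_le_iff by blast
      moreover have "e \<zero> \<preceq> e (i \<oplus> \<one>)"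
        using IH(2) incr[OF \<open>i \<prec> l\<close>] lt_imp_le arith.order_trans by blast
      ultimately show "entry_at w (i \<oplus> \<one> \<oplus> \<one>) \<prec> pow2 (e (i \<oplus> \<one>) \<oplus> \<one>) \<and> e \<zero> \<preceq> e (i \<oplus> \<one>) \<and>
          pow2 (e \<zero>) dvd\<^sub>M entry_at w (i \<oplus> \<one> \<oplus> \<one>)"
        unfolding sum[OF \<open>i \<oplus> \<one> \<preceq> l\<close>] pow2_double using IH(3) by (auto intro: dvd_add pow2_dvd)
    qed
  qed
  from this[of l] w(2) show "n \<prec> pow2 (entry_at \<langle>c, d\<rangle> l \<oplus> \<one>)" "pow2 (entry_at \<langle>c, d\<rangle> \<zero>) dvd\<^sub>M n"
    by (auto simp: e_def)
qed

lemma Is_mu_bound: "Is_mu M n t \<Longrightarrow> n \<prec> pow2 (t \<oplus> \<one>)"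
  unfolding Is_mu_def Entry_iff using Expansion_bounds(1) by blast

lemma Is_lambda_dvd: "Is_lambda M n t \<Longrightarrow> pow2 t dvd\<^sub>M n"
  unfolding Is_lambda_def Entry_iff using Expansion_bounds(2) by blast

text \<open>If \<open>x\<close> in \<open>H\<close> exceeds \<open>m \<oplus> pow2 w\<close>, then
  \<mu>(x) is at least \<open>w\<close>, so any later element of \<open>H\<close> has its lowest
  exponent above \<open>w\<close>.\<close>

lemma Apart_multiples:
  assumes inf: "\<And>m. \<exists>x. m \<prec> x \<and> x \<in> H" and "Apart M H"
  shows "\<exists>x. x \<in> H \<and> m \<prec> x \<and> pow2 w dvd\<^sub>M x"
proof -
  obtain x where x: "m \<oplus> pow2 w \<prec> x" "x \<in> H"
    using inf by blast
  obtain x' where x': "x \<prec> x'" "x' \<in> H"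
    using inf by blast
  obtain t u where tu: "Is_mu M x t" "Is_lambda M x' u" "t \<prec> u"
    using assms(2) x x' unfolding Apart_def by blast
  have "pow2 w \<prec> x" "m \<prec> x"
    using x(1) le_lt_trans le_add_left le_add_right by blast+
  then have "pow2 w \<prec> pow2 (t \<oplus> \<one>)"
    using Is_mu_bound[OF tu(1)] lt_trans by blast
  then have "w \<preceq> u"
    using tu(3) by (simp add: lt_add_one_le)
  then have "pow2 w dvd\<^sub>M x'"
    using pow2_dvd dvd_trans Is_lambda_dvd[OF tu(2)] by blast
  then show ?thesis
    using x' \<open>m \<prec> x\<close> lt_trans by blast
qed

lemma psum_ge:
  assumes "delta_fun g" shows "i \<prec> n \<longrightarrow> g i \<preceq> psum g n"
proof (induct n rule: delta_induct)
  case definable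
  show ?case
    by (intro delta_intros psum_props assms)
next
  case (step n)
  then show ?case
    by (auto simp: psum_props(3)[OF assms] lt_add_one_iff le_add_right intro: arith.add_increasing2)
qed simp

text \<open>All exponents of the summands lie from \<open>u\<close> up to below \<open>v\<close>.
  The listing is a definable function rather than a beta code, so lists can be concatenated by a
  case distinction.\<close>

definition block :: "'a set \<Rightarrow> 'a \<Rightarrow> 'a \<Rightarrow> 'a \<Rightarrow> 'a \<Rightarrow> bool" where
  "block H j n u v \<longleftrightarrow> (\<exists>g. delta_fun g \<and> n = psum g j \<and> (\<forall>i i'. i \<prec> j \<longrightarrow> i' \<prec> i \<longrightarrow> g i \<noteq> g i') \<and>
    (\<forall>i. i \<prec> j \<longrightarrow> g i \<in> H \<and> g i \<noteq> \<zero> \<and> pow2 u dvd\<^sub>M g i \<and> g i \<prec> pow2 v))"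

text \<open>Summands of the first block are below \<open>pow2 v\<close> and those of the second are
  nonzero multiples of it, so the combined list has no repetition.\<close>

lemma block_append:
  assumes "block H j n u v" "block H k m v w" "u \<preceq> v" "v \<preceq> w"
  shows "block H (j \<oplus> k) (n \<oplus> m) u w"
proof -
  obtain g where g: "delta_fun g" "n = psum g j" "\<And>i i'. i \<prec> j \<Longrightarrow> i' \<prec> i \<Longrightarrow> g i \<noteq> g i'"
    "\<And>i. i \<prec> j \<Longrightarrow> g i \<in> H \<and> g i \<noteq> \<zero> \<and> pow2 u dvd\<^sub>M g i \<and> g i \<prec> pow2 v"
    using assms(1) unfolding block_def by metis
  obtain h where h: "delta_fun h" "m = psum h k" "\<And>i i'. i \<prec> k \<Longrightarrow> i' \<prec> i \<Longrightarrow> h i \<noteq> h i'"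
    "\<And>i. i \<prec> k \<Longrightarrow> h i \<in> H \<and> h i \<noteq> \<zero> \<and> pow2 v dvd\<^sub>M h i \<and> h i \<prec> pow2 w"
    using assms(2) unfolding block_def by metis
  define f where "f i = (if i \<prec> j then g i else h (i \<ominus> j))" for i
  have f: "delta_fun f"
    unfolding f_def by (intro delta_intros g(1) delta_fun_comp[OF h(1)])
  have f_g: "f i = g i" if "i \<prec> j" for i
    using that by (simp add: f_def)
  have f_h: "f (j \<oplus> i) = h i" for i
    using arith.not_less[of "j \<oplus> i" j] by (simp add: f_def le_add_left add_diff)
  have split: thesis if "i \<prec> j \<Longrightarrow> thesis" "\<And>i'. i = j \<oplus> i' \<Longrightarrow> i' \<prec> k \<Longrightarrow> thesis" "i \<prec> j \<oplus> k" for i thesis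
  proof (cases "i \<prec> j")
    case False
    then obtain i' where "i = j \<oplus> i'"
      using arith.not_less le_iff_add by auto
    then show ?thesis
      using that by simp
  qed (use that in blast)
  have less: "g i \<prec> h i'" if "i \<prec> j" "i' \<prec> k" for i i'
    using g(4)[OF that(1)] h(4)[OF that(2)] dvd_imp_le lt_le_trans by blast
  have "psum f (j \<oplus> k) = psum f j \<oplus> psum (\<lambda>i. f (j \<oplus> i)) k"
    by (rule psum_append[OF f])
  also have "\<dots> = n \<oplus> m"
    unfolding f_h g(2) h(2) using psum_cong[OF f g(1)] f_g by simp
  finally have "n \<oplus> m = psum f (j \<oplus> k)" ..
  moreover have "f i \<noteq> f i'" if i: "i \<prec> j \<oplus> k" "i' \<prec> i" for i i'
    using i(1)
  proof (rule split[rotated 2])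
    show "f i \<noteq> f i'" if "i \<prec> j"
      using that i(2) f_g g(3) lt_trans by metis
    show "f i \<noteq> f i'" if l: "i = j \<oplus> l" "l \<prec> k" for l
      using lt_trans[OF i(2,1)]
    proof (rule split[rotated 2])
      show "f i \<noteq> f i'" if "i' \<prec> j"
        using that l f_g f_h less lt_irrefl by metis
      show "f i \<noteq> f i'" if "i' = j \<oplus> l'" for l'
        using i(2) h(3)[OF l(2), of l'] unfolding l(1) that f_h by simp
    qed
  qed
  moreover have "f i \<in> H \<and> f i \<noteq> \<zero> \<and> pow2 u dvd\<^sub>M f i \<and> f i \<prec> pow2 w" if "i \<prec> j \<oplus> k" for i
    using that
  proof (rule split[rotated 2])
    show "f i \<in> H \<and> f i \<noteq> \<zero> \<and> pow2 u dvd\<^sub>M f i \<and> f i \<prec> pow2 w" if "i \<prec> j"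
      using g(4)[OF that] f_g[OF that] assms(4) lt_le_trans pow2_le_iff by metis
    show "f i \<in> H \<and> f i \<noteq> \<zero> \<and> pow2 u dvd\<^sub>M f i \<and> f i \<prec> pow2 w" if "i = j \<oplus> l" "l \<prec> k" for l
      using h(4)[OF that(2)] f_h[of l] that(1) pow2_dvd[OF assms(3)] dvd_trans by metis
  qed
  ultimately show ?thesis
    unfolding block_def using f by (intro exI[of _ f] conjI allI impI) simp_all
qed

lemma block_mono:
  assumes "block H j n u v" "v \<preceq> w" shows "block H j n u w"
proof -
  have "x \<prec> pow2 w" if "x \<prec> pow2 v" for x
    using that assms(2) lt_le_trans pow2_le_iff by blast
  with assms(1) show ?thesis
    unfolding block_def by (elim ex_forward) simp
qed

text \<open>The beta function codes the listing and, up to index \<open>j\<close> inclusive, its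
  partial sums.\<close>

lemma block_Sum_of_distinct:
  assumes "block H j n u v" shows "Sum_of_distinct M H j n"
proof -
  obtain g where g: "delta_fun g" "n = psum g j" "\<And>i i'. i \<prec> j \<Longrightarrow> i' \<prec> i \<Longrightarrow> g i \<noteq> g i'"
    "\<And>i. i \<prec> j \<Longrightarrow> g i \<in> H"
    using assms unfolding block_def by metis
  obtain w where w: "\<And>i. i \<prec> j \<Longrightarrow> entry_at w i = g i"
    using beta[OF g(1)] by metis
  obtain w' where w': "\<And>i. i \<prec> j \<oplus> \<one> \<Longrightarrow> entry_at w' i = psum g i"
    using beta[OF psum_props(1)[OF g(1)]] by metis
  have Entry: "Entry M (proj1 w) (proj2 w) i y \<longleftrightarrow> y = entry_at w i" for w i y
    unfolding Entry_iff by (simp add: entry_at_def)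
  have "Is_sum M (Entry M (proj1 w) (proj2 w)) j n"
    unfolding Is_sum_def
  proof (intro exI conjI allI impI)
    show "Entry M (proj1 w') (proj2 w') \<zero> \<zero>" "Entry M (proj1 w') (proj2 w') j n"
      using w'[of \<zero>] w'[of j] by (simp_all add: Entry psum_props(2)[OF g(1)] g(2) lt_add_one_le)
    fix i assume "i \<prec> j"
    then show "Entry M (proj1 w') (proj2 w') i (psum g i)" "Entry M (proj1 w) (proj2 w) i (g i)"
        "Entry M (proj1 w') (proj2 w') (i \<oplus> \<one>) (psum g i \<oplus> g i)"
      using w[of i] w'[of i] w'[of "i \<oplus> \<one>"]
      by (simp_all add: Entry lt_add_one_le add_one_le_iff lt_imp_le psum_props(3)[OF g(1)])
  qed
  moreover have "\<exists>x. Entry M (proj1 w) (proj2 w) i x \<and> x \<in> H" if "i \<prec> j" for i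
    using g(4) w that by (simp add: Entry)
  moreover have "\<exists>x x'. Entry M (proj1 w) (proj2 w) i x \<and> Entry M (proj1 w) (proj2 w) i' x' \<and> x \<noteq> x'" if "i \<prec> j" "i' \<prec> i" for i i'
    using g(3)[OF that] w[OF that(1)] w[OF lt_trans[OF that(2,1)]] by (simp add: Entry)
  ultimately show ?thesis
    unfolding Sum_of_distinct_def by (rule_tac exI[of _ "proj1 w"], rule_tac exI[of _ "proj2 w"]) simp
qed

text \<open>\<open>f u j\<close> sums the first \<open>j\<close> terms of an increasing sequence of
  multiples of \<open>pow2 u\<close> in \<open>H\<close>. Definability in \<open>u\<close> and
  \<open>j\<close> together is what makes the final bound on the stages a definable
  function.\<close>

lemma blocks_ex:
  assumes H: "H \<in> Sets M" and inf: "\<And>m. \<exists>x. m \<prec> x \<and> x \<in> H" and "Apart M H"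
    and pos: "\<And>x. x \<in> H \<Longrightarrow> \<zero> \<prec> x"
  obtains f where "delta_fun (\<lambda>z. f (proj1 z) (proj2 z))"
    "\<And>j u v. f u j \<prec> pow2 v \<Longrightarrow> block H j (f u j) u v"
    "\<And>u j. pow2 u dvd\<^sub>M f u j" "\<And>u j. j \<noteq> \<zero> \<Longrightarrow> f u j \<noteq> \<zero>"
proof -
  have "delta_pred (\<lambda>z. proj2 z \<in> H \<and> proj2 (proj1 z) \<prec> proj2 z \<and> pow2 (proj1 (proj1 z)) dvd\<^sub>M proj2 z)"
    by (intro delta_intros H)
  from minimisation[of "\<lambda>p x. x \<in> H \<and> proj2 p \<prec> x \<and> pow2 (proj1 p) dvd\<^sub>M x", OF this]
    Apart_multiples[OF inf assms(3)]
  obtain nx where nx: "delta_fun nx" "\<And>p. nx p \<in> H \<and> proj2 p \<prec> nx p \<and> pow2 (proj1 p) dvd\<^sub>M nx p"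
    by metis
  have "delta_fun (\<lambda>u. nx \<langle>u, \<zero>\<rangle>)" "delta_fun (\<lambda>z. nx \<langle>proj1 (proj1 z), proj2 z\<rangle>)"
    by (intro delta_fun_comp[OF nx(1)] delta_intros)+
  from primitive_recursion[of "\<lambda>u. nx \<langle>u, \<zero>\<rangle>" "\<lambda>u i y. nx \<langle>u, y\<rangle>", OF this]
  obtain g where g: "delta_fun (\<lambda>z. g (proj1 z) (proj2 z))" "\<And>u. g u \<zero> = nx \<langle>u, \<zero>\<rangle>"
      "\<And>u i. g u (i \<oplus> \<one>) = nx \<langle>u, g u i\<rangle>"
    by metis
  have Fg: "delta_fun (g u)" for u
    using delta_fun_comp2[OF g(1) delta_fun_const delta_fun_id] .
  have g_next: "\<exists>m. g u i = nx \<langle>u, m\<rangle>" for u i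
    using zero_or_add_one[of i] g(2,3) by metis
  have gH: "g u i \<in> H" "pow2 u dvd\<^sub>M g u i" for u i
    using g_next[of u i] nx(2) by (metis proj1_pair)+
  have incr: "i' \<prec> i \<longrightarrow> g u i' \<prec> g u i" for u i i'
  proof (induct i rule: delta_induct)
    case definable
    show ?case
      by (intro delta_intros delta_fun_comp[OF Fg])
  next
    case (step i)
    have "g u i \<prec> g u (i \<oplus> \<one>)"
      unfolding g(3) using nx(2)[of "\<langle>u, g u i\<rangle>"] by simp
    with step show ?case
      unfolding lt_add_one_iff using lt_trans by blast
  qed simp
  show thesis
  proof
    show "delta_fun (\<lambda>z. psum (g (proj1 z)) (proj2 z))"
      by (intro delta_intros delta_fun_comp2[OF g(1)])
    show "block H j (psum (g u) j) u v" if "psum (g u) j \<prec> pow2 v" for j u v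
      unfolding block_def
    proof (intro exI[of _ "g u"] conjI allI impI)
      show "g u i \<noteq> g u i'" if "i' \<prec> i" for i i'
        using incr that lt_irrefl by metis
      show "g u i \<noteq> \<zero>" for i
        using pos[OF gH(1)] lt_irrefl by metis
      show "g u i \<prec> pow2 v" if "i \<prec> j" for i
        using psum_ge[OF Fg] that \<open>psum (g u) j \<prec> pow2 v\<close> le_lt_trans by blast
    qed (simp_all add: Fg gH)
    show "pow2 u dvd\<^sub>M psum (g u) j" for u j
    proof (induct j rule: delta_induct)
      case definable
      show ?case
        by (intro delta_intros psum_props Fg)
    next
      case zero
      show ?case
        unfolding psum_props(2)[OF Fg] dvd_M_def using mul_zero_right by metis
    next
      case (step j)
      then show ?case
        unfolding psum_props(3)[OF Fg] using gH(2) by (rule dvd_add)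
    qed
    show "psum (g u) j \<noteq> \<zero>" if "j \<noteq> \<zero>" for u j
    proof -
      have "g u \<zero> \<preceq> psum (g u) j"
        using psum_ge[OF Fg] that pos_iff by blast
      then show ?thesis
        using lt_le_trans[OF pos[OF gH(1)]] lt_irrefl by metis
    qed
  qed
qed

section \<open>Arithmetical comprehension\<close>

lemma color_coloring: "Two_coloring M {z. \<exists>n. z = \<langle>n, color A n\<rangle>}"
  unfolding Two_coloring_def color_def by auto

text \<open>By \<open>color_core\<close>, every \<open>v\<close> that ever appears does so by stage
  \<open>Y v\<close>. As \<open>Y\<close> is definable, the unbounded search becomes a bounded
  one.\<close>

lemma projection:
  assumes AP: "M \<Turnstile> {apart_hindman_AP}" and A: "A \<in> Sets M"
  shows "delta_pred (\<lambda>v. \<exists>s. \<langle>v, s\<rangle> \<in> A)"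
proof -
  let ?C = "{z. \<exists>n. z = \<langle>n, color A n\<rangle>}"
  have C: "?C \<in> Sets M"
    using delta_fun_color[OF A] by (simp add: delta_fun_def)
  have "sat M undefined some_set apart_hindman_AP"
    using AP range_some_set by (simp add: models_def)
  from this[unfolded sat_apart_hindman_AP, THEN bspec, OF C, THEN mp, OF color_coloring]
  obtain H a b i where H: "H \<in> Sets M" "\<forall>m. \<exists>x. m \<prec> x \<and> x \<in> H" "\<forall>x\<in>H. \<zero> \<prec> x" "Apart M H"
    and ab: "\<zero> \<prec> a" "\<zero> \<prec> b"
    and mono: "\<forall>n\<in>FS_set M ({a, a \<oplus> b, a \<oplus> (\<one> \<oplus> \<one>) \<otimes> b} \<union> {b}) H. \<langle>n, i\<rangle> \<in> ?C"
    by (elim bexE conjE exE) (rule that)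
  \<comment> \<open>The number of summands in the form produced by two applications of
    \<open>block_append\<close>.\<close>
  have two_b: "a \<oplus> (\<one> \<oplus> \<one>) \<otimes> b = a \<oplus> b \<oplus> b"
    by (simp only: mul_distrib_left mul_one_left add_assoc)
  have mono: "color A n = i" if "block H j n u v" "j \<in> {a, a \<oplus> b, a \<oplus> b \<oplus> b, b}" for j n u v
  proof -
    have "n \<in> FS_set M ({a, a \<oplus> b, a \<oplus> (\<one> \<oplus> \<one>) \<otimes> b} \<union> {b}) H"
      using block_Sum_of_distinct[OF that(1)] that(2) unfolding FS_set_def two_b by blast
    with mono have "\<langle>n, i\<rangle> \<in> ?C"
      by blast
    then show ?thesis
      by simp
  qed
  obtain f where Ff: "delta_fun (\<lambda>z. f (proj1 z) (proj2 z))"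
    and f_block: "\<And>j u v. f u j \<prec> pow2 v \<Longrightarrow> block H j (f u j) u v"
    and f_dvd: "\<And>u j. pow2 u dvd\<^sub>M f u j" and f_nonzero: "\<And>u j. j \<noteq> \<zero> \<Longrightarrow> f u j \<noteq> \<zero>"
  proof (rule blocks_ex[OF H(1) _ H(4)])
    show "\<exists>x. m \<prec> x \<and> x \<in> H" for m
      using H(2) by blast
    show "\<zero> \<prec> x" if "x \<in> H" for x
      using H(3) that by blast
  qed (rule that)
  define x0 where "x0 = f \<zero> a"
  \<comment> \<open>\<open>B\<close> is chosen once, for the fixed sum \<open>x0\<close>, and enters
    the bounds below as a constant.\<close>
  obtain B where B: "\<And>v s. v \<prec> x0 \<Longrightarrow> \<langle>v, s\<rangle> \<in> A \<Longrightarrow> \<exists>s. s \<prec> B \<and> \<langle>v, s\<rangle> \<in> A"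
    using strong_bounding[OF A] by metis
  \<comment> \<open>\<open>f v a\<close> is a nonzero multiple of \<open>pow2 v\<close>, so
    \<open>v\<close> is at most its highest exponent. \<open>U v\<close> lies beyond the exponents
    of \<open>x0\<close> and of \<open>f v a\<close>, and beyond stage \<open>B\<close>.\<close>
  define U where "U v = B \<oplus> x0 \<oplus> f v a" for v
  define Y where "Y v = f (U v) b" for v
  have "delta_fun Y"
    unfolding Y_def U_def by (intro delta_fun_comp2[OF Ff] delta_intros)
  have "(\<exists>s. \<langle>v, s\<rangle> \<in> A) \<longleftrightarrow> (\<exists>s. s \<preceq> Y v \<and> \<langle>v, s\<rangle> \<in> A)" for v
  proof
    assume "\<exists>s. \<langle>v, s\<rangle> \<in> A"
    then obtain s where s: "\<langle>v, s\<rangle> \<in> A" ..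
    let ?x = "f v a" and ?y = "Y v" and ?u = "U v"
    have le_U: "B \<preceq> ?u" "x0 \<preceq> ?u" "?x \<preceq> ?u"
      by (auto simp: U_def add_assoc intro: arith.add_increasing arith.add_increasing2)
    then have less: "x0 \<prec> pow2 ?u" "?x \<prec> pow2 ?u"
      using pow2_gt le_lt_trans by blast+
    have "pow2 v \<preceq> ?x"
      using dvd_imp_le[OF f_dvd f_nonzero] ab(1) pos_iff by blast
    then have "v \<preceq> ?u"
      using pow2_gt[of v] le_U(3) lt_imp_le arith.order_trans by blast
    have z: "\<exists>z. pow2 w dvd\<^sub>M z \<and> z \<noteq> \<zero> \<and>
        (\<forall>n\<in>{?x, x0, ?x \<oplus> ?y, x0 \<oplus> ?y}. color A (n \<oplus> z) = color A z)"
      if w: "?y \<prec> pow2 w" "?u \<preceq> w" for w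
    proof (intro exI conjI)
      let ?z = "f w b"
      show "pow2 w dvd\<^sub>M ?z" "?z \<noteq> \<zero>"
        using f_dvd f_nonzero ab(2) pos_iff by auto
      \<comment> \<open>\<open>w \<oplus> ?z\<close> serves as upper exponent: it is at least
        \<open>w\<close>, and its power of two exceeds \<open>?z\<close>.\<close>
      have z: "block H b ?z w (w \<oplus> ?z)"
        using f_block pow2_gt[of "w \<oplus> ?z"] le_lt_trans[OF le_add_right] by blast
      have "w \<preceq> w \<oplus> ?z"
        by (rule le_add_left)
      have y: "block H b ?y ?u w"
        unfolding Y_def using w(1) by (intro f_block) (simp add: Y_def)
      have "color A (n \<oplus> ?z) = i" if n: "block H a n t ?u" "t \<preceq> ?u" for n t
      proof -
        have "t \<preceq> w"
          using n(2) w(2) arith.order_trans by blast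
        show ?thesis
          using mono[OF block_append[OF block_mono[OF n(1) w(2)] z \<open>t \<preceq> w\<close> \<open>w \<preceq> w \<oplus> ?z\<close>]] by simp
      qed
      moreover have "color A (n \<oplus> ?y \<oplus> ?z) = i" if n: "block H a n t ?u" "t \<preceq> ?u" for n t
      proof -
        have "t \<preceq> w"
          using n(2) w(2) arith.order_trans by blast
        show ?thesis
          using mono[OF block_append[OF block_append[OF n(1) y n(2) w(2)] z \<open>t \<preceq> w\<close> \<open>w \<preceq> w \<oplus> ?z\<close>]] by simp
      qed
      moreover have "block H a ?x v ?u" "block H a x0 \<zero> ?u"
        unfolding x0_def using less by (auto intro!: f_block simp: x0_def)
      moreover have "color A ?z = i"
        using mono[OF z] by simp
      ultimately show "\<forall>n\<in>{?x, x0, ?x \<oplus> ?y, x0 \<oplus> ?y}. color A (n \<oplus> ?z) = color A ?z"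
        using \<open>v \<preceq> ?u\<close> zero_le[of ?u] by (simp only: ball_simps simp_thms)
    qed
    show "\<exists>s. s \<preceq> ?y \<and> \<langle>v, s\<rangle> \<in> A"
    proof (rule color_core[OF A less])
      show "pow2 ?u dvd\<^sub>M ?y" "?y \<noteq> \<zero>"
        unfolding Y_def using f_dvd f_nonzero ab(2) pos_iff by auto
      show "\<exists>s. s \<preceq> ?u \<and> \<langle>v, s\<rangle> \<in> A" if "pow2 v \<preceq> x0" "\<langle>v, s\<rangle> \<in> A" for v s
      proof -
        have "v \<prec> x0"
          using pow2_gt that(1) lt_le_trans by blast
        then show ?thesis
          using B that(2) le_U(1) lt_imp_le arith.order_trans by blast
      qed
    qed (fact z \<open>pow2 v \<preceq> ?x\<close> s)+
  qed blast
  then show ?thesis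
    by simp (intro delta_intros delta_fun_comp[OF \<open>delta_fun Y\<close>] \<open>delta_fun Y\<close> A)
qed

lemma delta_fun_eval: "(\<And>k. delta_fun (\<lambda>x. E x k)) \<Longrightarrow> delta_fun (\<lambda>x. eval M (E x) t)"
  by (induction t) (simp_all add: delta_fun_const delta_fun_add delta_fun_mul)

text \<open>Each number quantifier costs one application of \<open>projection\<close>, a universal
  one after negation. The assignment depends on a single number, so the bound variable is absorbed
  by passing to codes of pairs.\<close>

lemma arithmetical_definable:
  assumes AP: "M \<Turnstile> {apart_hindman_AP}" and s: "range s \<subseteq> Sets M"
  shows "arithmetical \<phi> \<Longrightarrow> (\<And>k. delta_fun (\<lambda>x. E x k)) \<Longrightarrow> delta_pred (\<lambda>x. sat M (E x) s \<phi>)"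
proof (induction \<phi> arbitrary: E)
  case (Mem t X)
  have "s X \<in> Sets M"
    using s by auto
  then show ?case
    using delta_pred_mem delta_fun_eval Mem.prems(2) by simp
next
  case (ExN y \<phi>)
  let ?E = "\<lambda>z. (E (proj1 z))(y := proj2 z)"
  have "delta_fun (\<lambda>z. ?E z k)" for k
    by (cases "k = y") (simp_all add: delta_fun_proj2[OF delta_fun_id] delta_fun_comp[OF ExN.prems(2) delta_fun_proj1[OF delta_fun_id]])
  with ExN have "delta_pred (\<lambda>z. sat M (?E z) s \<phi>)"
    by simp
  then have "{z. sat M (?E z) s \<phi>} \<in> Sets M"
    by (simp only: delta_pred_def)
  from projection[OF AP this] show ?case
    by simp
next
  case (AllN y \<phi>)
  let ?E = "\<lambda>z. (E (proj1 z))(y := proj2 z)"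
  have "delta_fun (\<lambda>z. ?E z k)" for k
    by (cases "k = y") (simp_all add: delta_fun_proj2[OF delta_fun_id] delta_fun_comp[OF AllN.prems(2) delta_fun_proj1[OF delta_fun_id]])
  with AllN have "delta_pred (\<lambda>z. sat M (?E z) s \<phi>)"
    by simp
  then have "delta_pred (\<lambda>z. \<not> sat M (?E z) s \<phi>)"
    by (rule delta_pred_not)
  then have "{z. \<not> sat M (?E z) s \<phi>} \<in> Sets M"
    by (simp only: delta_pred_def)
  from delta_pred_not[OF projection[OF AP this]] show ?case
    by simp
qed (simp_all add: delta_pred_eq delta_pred_lt delta_pred_not delta_pred_conj delta_pred_disj delta_pred_imp delta_pred_iff delta_fun_eval)

lemma ACA0_if_apart_hindman_AP:
  assumes AP: "M \<Turnstile> {apart_hindman_AP}"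
  shows "M \<Turnstile> ACA0"
  unfolding models_def
proof (intro ballI allI impI)
  fix \<phi> e and s :: "nat \<Rightarrow> 'a set"
  assume \<phi>: "\<phi> \<in> ACA0" and s: "range s \<subseteq> Sets M"
  from \<phi> consider "\<phi> \<in> basic_axioms" | "\<phi> = induction_for 0 (Var 0 \<^bold>\<in> 0)"
    | X n \<psi> where "\<phi> = comprehension_for X n \<psi>" "arithmetical \<psi>" "X \<notin> free_sets \<psi>"
    unfolding ACA0_def by blast
  then show "sat M e s \<phi>"
  proof cases
    case 1
    then show ?thesis
      using RCA0 s by (auto simp: models_def RCA0_def)
  next
    case 2
    have "delta_pred (\<lambda>x. x \<in> s 0)"
      using s by (auto simp: delta_pred_def)
    then show ?thesis
      unfolding 2 sat_induction_for using delta_induct[of "\<lambda>x. x \<in> s 0"] by simp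
  next
    case 3
    have "delta_fun (\<lambda>x. (e(n := x)) k)" for k
      by (cases "k = n") (simp_all add: delta_fun_id delta_fun_const)
    then have "delta_pred (\<lambda>x. sat M (e(n := x)) s \<psi>)"
      using arithmetical_definable[OF AP s 3(2)] by blast
    then have "{x. sat M (e(n := x)) s \<psi>} \<in> Sets M"
      by (simp only: delta_pred_def)
    then show ?thesis
      unfolding 3(1) comprehension_for_def
      by (auto simp: sat_set_upd[OF 3(3)] fun_upd_same simp del: fun_upd_apply
          intro!: bexI[of _ "{x. sat M (e(n := x)) s \<psi>}"])
  qed
qed

end

theorem proposition3:
  fixes M :: "'a l2_struct"
  assumes "Sets M \<noteq> {}"
    and "M \<Turnstile> RCA0"
    and "M \<Turnstile> {apart_hindman_AP}"
  shows "M \<Turnstile> ACA0"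
proof -
  interpret RCA0_model M
    using assms by unfold_locales
  show ?thesis
    using assms(3) by (rule ACA0_if_apart_hindman_AP)
qed

end
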